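(* Let $X$ be a finite loop which is both a (right) Bol loop and an $A_r$-loop. Then $X$ is solvable if and only if the enveloping group of $X$ is solvable.
   Context: A loop is a set $X$ with a binary operation $\circ$ and an identity $1$ such that all maps $R(x):y\mapsto y\circ x$ and $L(x):y\mapsto x\circ y$ are permutations of $X$. A (right) Bol loop is a loop satisfying $((z\circ x)\circ y)\circ x=z\circ((x\circ y)\circ x)$ for all $x,y,z$. The enveloping group of $X$ is the subgroup $G=\langle R(x):x\in X\rangle$ of $\mathrm{Sym}(X)$, and the (right) inner mapping group is the stabilizer $H=G_1$ of $1\in X$ in $G$. $X$ is an $A_r$-loop if every element of $H$ is a loop automorphism of $X$. A normal subloop is the kernel of a loop homomorphism. A loop is solvable if it has a series $1=X_0\le X_1\le\dots\le X_n=X$ of subloops with $X_i$ normal in $X_{i+1}$ and $X_{i+1}/X_i$ an abelian group. *)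

theory Defs
  imports "HOL-Algebra.Solvable_Groups" "HOL-Algebra.Group_Action"
begin

definition right_mult :: "('a, 'b) monoid_scheme \<Rightarrow> 'a \<Rightarrow> 'a \<Rightarrow> 'a"
  where "right_mult X x = (\<lambda>y\<in>carrier X. y \<otimes>\<^bsub>X\<^esub> x)"

definition left_mult :: "('a, 'b) monoid_scheme \<Rightarrow> 'a \<Rightarrow> 'a \<Rightarrow> 'a"
  where "left_mult X x = (\<lambda>y\<in>carrier X. x \<otimes>\<^bsub>X\<^esub> y)"

text \<open>Closure of the carrier under multiplication is part of \<open>right_mult_Bij\<close>.\<close>

locale loop =
  fixes X (structure)
  assumes one_closed: "\<one> \<in> carrier X"
    and l_one: "x \<in> carrier X \<Longrightarrow> \<one> \<otimes> x = x"
    and r_one: "x \<in> carrier X \<Longrightarrow> x \<otimes> \<one> = x"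
    and right_mult_Bij: "x \<in> carrier X \<Longrightarrow> right_mult X x \<in> Bij (carrier X)"
    and left_mult_Bij: "x \<in> carrier X \<Longrightarrow> left_mult X x \<in> Bij (carrier X)"

locale right_bol_loop = loop +
  assumes right_bol: "\<lbrakk>x \<in> carrier X; y \<in> carrier X; z \<in> carrier X\<rbrakk>
    \<Longrightarrow> ((z \<otimes> x) \<otimes> y) \<otimes> x = z \<otimes> ((x \<otimes> y) \<otimes> x)"

definition enveloping_group :: "('a, 'b) monoid_scheme \<Rightarrow> ('a \<Rightarrow> 'a) monoid"
  where "enveloping_group X =
    subgroup_generated (BijGroup (carrier X)) (right_mult X ` carrier X)"

definition inner_mapping_group :: "('a, 'b) monoid_scheme \<Rightarrow> ('a \<Rightarrow> 'a) set"
  where "inner_mapping_group X = stabilizer (enveloping_group X) (\<lambda>g. g) \<one>\<^bsub>X\<^esub>"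

locale Ar_loop = loop +
  assumes inner_mappings_auto: "inner_mapping_group X \<subseteq> auto X"

definition subloop :: "'a set \<Rightarrow> ('a, 'b) monoid_scheme \<Rightarrow> bool"
  where "subloop S X \<longleftrightarrow> S \<subseteq> carrier X \<and> loop (X\<lparr>carrier := S\<rparr>)"

text \<open>
  An existential quantifier cannot range over types, so the codomain is a loop on
  \<^typ>\<open>'a set\<close>. This is no restriction: by \<open>normal_subloop_kernel\<close> below, the kernel of
  a homomorphism into a loop of any type is normal in this sense.
\<close>

definition normal_subloop :: "'a set \<Rightarrow> ('a, 'b) monoid_scheme \<Rightarrow> bool"
  where "normal_subloop N X \<longleftrightarrow>
    (\<exists>(Y :: 'a set monoid) f. loop Y \<and> f \<in> hom X Y \<and> N = kernel X Y f)"

text \<open>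
  The quotient is \<^const>\<open>FactGroup\<close>, whose definition (right cosets with elementwise
  multiplication) does not use associativity. For the kernel of a loop homomorphism the cosets
  are the fibres, they multiply as representatives do, and they form a loop; see
  \<open>kernel_rcos_eq_fibre\<close>, \<open>kernel_rcos_mult\<close> and \<open>loop_Mod_kernel\<close>.
\<close>

definition solvable_loop :: "('a, 'b) monoid_scheme \<Rightarrow> bool"
  where "solvable_loop X \<longleftrightarrow>
    (\<exists>(n :: nat) S. S 0 = {\<one>\<^bsub>X\<^esub>} \<and> S n = carrier X \<and>
      (\<forall>i\<le>n. subloop (S i) X) \<and>
      (\<forall>i<n. normal_subloop (S i) (X\<lparr>carrier := S (Suc i)\<rparr>) \<and>
             comm_group (X\<lparr>carrier := S (Suc i)\<rparr> Mod S i)))"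

context loop
begin

lemma m_closed: "\<lbrakk>x \<in> carrier X; y \<in> carrier X\<rbrakk> \<Longrightarrow> x \<otimes> y \<in> carrier X"
  using right_mult_Bij[of y] by (auto simp: Bij_def right_mult_def dest: bij_betwE)

lemma r_cancel:
  "\<lbrakk>x \<in> carrier X; y \<in> carrier X; z \<in> carrier X; y \<otimes> x = z \<otimes> x\<rbrakk> \<Longrightarrow> y = z"
  using right_mult_Bij[of x] by (auto simp: Bij_def right_mult_def bij_betw_def inj_on_def)

lemma l_cancel:
  "\<lbrakk>x \<in> carrier X; y \<in> carrier X; z \<in> carrier X; x \<otimes> y = x \<otimes> z\<rbrakk> \<Longrightarrow> y = z"
  using left_mult_Bij[of x] by (auto simp: Bij_def left_mult_def bij_betw_def inj_on_def)

lemma r_div: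
  assumes "x \<in> carrier X" "z \<in> carrier X"
  obtains y where "y \<in> carrier X" "y \<otimes> x = z"
proof -
  have "z \<in> right_mult X x ` carrier X"
    using right_mult_Bij[OF assms(1)] assms(2) by (simp add: Bij_def bij_betw_def)
  then show thesis by (auto simp: right_mult_def intro: that)
qed

lemma l_div:
  assumes "x \<in> carrier X" "z \<in> carrier X"
  obtains y where "y \<in> carrier X" "x \<otimes> y = z"
proof -
  have "z \<in> left_mult X x ` carrier X"
    using left_mult_Bij[OF assms(1)] assms(2) by (simp add: Bij_def bij_betw_def)
  then show thesis by (auto simp: left_mult_def intro: that)
qed

end

lemma loopI:
  fixes X (structure)
  assumes one: "\<one> \<in> carrier X"
    and l1: "\<And>x. x \<in> carrier X \<Longrightarrow> \<one> \<otimes> x = x"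
    and r1: "\<And>x. x \<in> carrier X \<Longrightarrow> x \<otimes> \<one> = x"
    and cl: "\<And>x y. \<lbrakk>x \<in> carrier X; y \<in> carrier X\<rbrakk> \<Longrightarrow> x \<otimes> y \<in> carrier X"
    and rc: "\<And>x y z. \<lbrakk>x \<in> carrier X; y \<in> carrier X; z \<in> carrier X; y \<otimes> x = z \<otimes> x\<rbrakk> \<Longrightarrow> y = z"
    and lc: "\<And>x y z. \<lbrakk>x \<in> carrier X; y \<in> carrier X; z \<in> carrier X; x \<otimes> y = x \<otimes> z\<rbrakk> \<Longrightarrow> y = z"
    and rd: "\<And>x z. \<lbrakk>x \<in> carrier X; z \<in> carrier X\<rbrakk> \<Longrightarrow> \<exists>y\<in>carrier X. y \<otimes> x = z"
    and ld: "\<And>x z. \<lbrakk>x \<in> carrier X; z \<in> carrier X\<rbrakk> \<Longrightarrow> \<exists>y\<in>carrier X. x \<otimes> y = z"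
  shows "loop X"
proof
  fix x assume x: "x \<in> carrier X"
  have "inj_on (right_mult X x) (carrier X)"
    using rc[OF x] by (auto simp: inj_on_def right_mult_def)
  moreover have "right_mult X x ` carrier X = carrier X"
  proof
    show "right_mult X x ` carrier X \<subseteq> carrier X"
      using cl x by (auto simp: right_mult_def)
    show "carrier X \<subseteq> right_mult X x ` carrier X"
      using rd[OF x] by (force simp: right_mult_def image_iff)
  qed
  ultimately show "right_mult X x \<in> Bij (carrier X)"
    by (simp add: Bij_def bij_betw_def right_mult_def)
  have "inj_on (left_mult X x) (carrier X)"
    using lc[OF x] by (auto simp: inj_on_def left_mult_def)
  moreover have "left_mult X x ` carrier X = carrier X"
  proof
    show "left_mult X x ` carrier X \<subseteq> carrier X"
      using cl x by (auto simp: left_mult_def)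
    show "carrier X \<subseteq> left_mult X x ` carrier X"
      using ld[OF x] by (force simp: left_mult_def image_iff)
  qed
  ultimately show "left_mult X x \<in> Bij (carrier X)"
    by (simp add: Bij_def bij_betw_def left_mult_def)
qed (use one l1 r1 in auto)

lemma loop_hom_one:
  assumes "loop X" "loop Y" "f \<in> hom X Y"
  shows "f \<one>\<^bsub>X\<^esub> = \<one>\<^bsub>Y\<^esub>"
proof -
  interpret X: loop X by fact
  interpret Y: loop Y by fact
  have c: "f \<one>\<^bsub>X\<^esub> \<in> carrier Y" using assms(3) X.one_closed by (rule hom_in_carrier)
  have "f \<one>\<^bsub>X\<^esub> \<otimes>\<^bsub>Y\<^esub> f \<one>\<^bsub>X\<^esub> = f \<one>\<^bsub>X\<^esub>"
    using hom_mult[OF assms(3) X.one_closed X.one_closed] X.l_one X.one_closed by simp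
  also have "\<dots> = f \<one>\<^bsub>X\<^esub> \<otimes>\<^bsub>Y\<^esub> \<one>\<^bsub>Y\<^esub>" using Y.r_one c by simp
  finally show ?thesis using Y.l_cancel c Y.one_closed by blast
qed

lemma kernel_rcos_eq_fibre:
  assumes "loop X" "loop Y" "f \<in> hom X Y" "x \<in> carrier X"
  shows "kernel X Y f #>\<^bsub>X\<^esub> x = {y \<in> carrier X. f y = f x}"
proof -
  interpret X: loop X by fact
  interpret Y: loop Y by fact
  note c = hom_in_carrier[OF assms(3)]
  note m = hom_mult[OF assms(3)]
  have "\<exists>k\<in>kernel X Y f. k \<otimes>\<^bsub>X\<^esub> x = y" if y: "y \<in> carrier X" "f y = f x" for y
  proof -
    obtain k where k: "k \<in> carrier X" "k \<otimes>\<^bsub>X\<^esub> x = y"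
      using X.r_div[OF assms(4) y(1)] .
    have "f k \<otimes>\<^bsub>Y\<^esub> f x = \<one>\<^bsub>Y\<^esub> \<otimes>\<^bsub>Y\<^esub> f x"
      using m[OF k(1) assms(4)] k(2) y(2) Y.l_one[OF c[OF assms(4)]] by simp
    then have "f k = \<one>\<^bsub>Y\<^esub>"
      using Y.r_cancel[OF c[OF assms(4)] c[OF k(1)] Y.one_closed] by blast
    then show ?thesis using k by (auto simp: kernel_def)
  qed
  moreover have "k \<otimes>\<^bsub>X\<^esub> x \<in> carrier X \<and> f (k \<otimes>\<^bsub>X\<^esub> x) = f x" if "k \<in> kernel X Y f" for k
    using that m[of k x] Y.l_one[OF c[OF assms(4)]] X.m_closed assms(4)
    by (auto simp: kernel_def)
  ultimately show ?thesis by (force simp: r_coset_def)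
qed

lemma kernel_rcos_mult:
  assumes "loop X" "loop Y" "f \<in> hom X Y" "x \<in> carrier X" "y \<in> carrier X"
  shows "(kernel X Y f #>\<^bsub>X\<^esub> x) <#>\<^bsub>X\<^esub> (kernel X Y f #>\<^bsub>X\<^esub> y) = kernel X Y f #>\<^bsub>X\<^esub> (x \<otimes>\<^bsub>X\<^esub> y)"
proof -
  interpret X: loop X by fact
  interpret Y: loop Y by fact
  note c = hom_in_carrier[OF assms(3)]
  note m = hom_mult[OF assms(3)]
  note fib = kernel_rcos_eq_fibre[OF assms(1-3)]
  have "\<exists>v\<in>carrier X. f v = f y \<and> x \<otimes>\<^bsub>X\<^esub> v = z"
    if z: "z \<in> carrier X" "f z = f (x \<otimes>\<^bsub>X\<^esub> y)" for z
  proof -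
    obtain v where v: "v \<in> carrier X" "x \<otimes>\<^bsub>X\<^esub> v = z"
      using X.l_div[OF assms(4) z(1)] .
    have "f x \<otimes>\<^bsub>Y\<^esub> f v = f x \<otimes>\<^bsub>Y\<^esub> f y"
      using m[OF assms(4) v(1)] m[OF assms(4,5)] v(2) z(2) by simp
    then have "f v = f y"
      using Y.l_cancel[OF c[OF assms(4)] c[OF v(1)] c[OF assms(5)]] by blast
    with v show ?thesis by blast
  qed
  moreover have "u \<otimes>\<^bsub>X\<^esub> v \<in> carrier X \<and> f (u \<otimes>\<^bsub>X\<^esub> v) = f (x \<otimes>\<^bsub>X\<^esub> y)"
    if "u \<in> carrier X" "f u = f x" "v \<in> carrier X" "f v = f y" for u v
    using that m X.m_closed assms(4,5) by simp
  ultimately have "{y \<in> carrier X. f y = f x} <#>\<^bsub>X\<^esub> {z \<in> carrier X. f z = f y}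
      = {z \<in> carrier X. f z = f (x \<otimes>\<^bsub>X\<^esub> y)}"
    unfolding set_mult_def using assms(4) by blast
  then show ?thesis using X.m_closed assms(4,5) by (simp add: fib)
qed

lemma loop_Mod_kernel:
  assumes "loop X" "loop Y" "f \<in> hom X Y"
  shows "loop (X Mod kernel X Y f)"
    and "(\<lambda>x. kernel X Y f #>\<^bsub>X\<^esub> x) \<in> hom X (X Mod kernel X Y f)"
    and "kernel X (X Mod kernel X Y f) (\<lambda>x. kernel X Y f #>\<^bsub>X\<^esub> x) = kernel X Y f"
proof -
  interpret X: loop X by fact
  interpret Y: loop Y by fact
  define K where "K = kernel X Y f"
  note c = hom_in_carrier[OF assms(3)]
  note m = hom_mult[OF assms(3)]
  note fib = kernel_rcos_eq_fibre[OF assms, folded K_def]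
  note mult = kernel_rcos_mult[OF assms, folded K_def]
  have eq: "K #>\<^bsub>X\<^esub> x = K #>\<^bsub>X\<^esub> y \<longleftrightarrow> f x = f y" if "x \<in> carrier X" "y \<in> carrier X" for x y
    using that by (auto simp: fib)
  have one: "K #>\<^bsub>X\<^esub> \<one>\<^bsub>X\<^esub> = K"
    using fib[OF X.one_closed] loop_hom_one[OF assms] by (simp add: K_def kernel_def)
  have car: "carrier (X Mod K) = (\<lambda>x. K #>\<^bsub>X\<^esub> x) ` carrier X"
    by (auto simp: FactGroup_def RCOSETS_def)
  have mm: "A \<otimes>\<^bsub>X Mod K\<^esub> B = A <#>\<^bsub>X\<^esub> B" for A B by (simp add: FactGroup_def)
  have oo: "\<one>\<^bsub>X Mod K\<^esub> = K #>\<^bsub>X\<^esub> \<one>\<^bsub>X\<^esub>" by (simp add: FactGroup_def one)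
  show "loop (X Mod kernel X Y f)"
    unfolding K_def[symmetric]
  proof (rule loopI)
    show "\<one>\<^bsub>X Mod K\<^esub> \<in> carrier (X Mod K)" using X.one_closed by (simp add: oo car del: one_FactGroup)
  next
    fix A assume "A \<in> carrier (X Mod K)"
    then show "\<one>\<^bsub>X Mod K\<^esub> \<otimes>\<^bsub>X Mod K\<^esub> A = A" "A \<otimes>\<^bsub>X Mod K\<^esub> \<one>\<^bsub>X Mod K\<^esub> = A"
      using X.one_closed X.l_one X.r_one by (auto simp: car mm oo mult simp del: one_FactGroup)
  next
    fix A B assume "A \<in> carrier (X Mod K)" "B \<in> carrier (X Mod K)"
    then show "A \<otimes>\<^bsub>X Mod K\<^esub> B \<in> carrier (X Mod K)"
      using X.m_closed by (auto simp: car mm mult)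
  next
    fix A B C assume "A \<in> carrier (X Mod K)" "B \<in> carrier (X Mod K)" "C \<in> carrier (X Mod K)"
      and E: "B \<otimes>\<^bsub>X Mod K\<^esub> A = C \<otimes>\<^bsub>X Mod K\<^esub> A"
    then obtain a b d where abd: "a \<in> carrier X" "b \<in> carrier X" "d \<in> carrier X"
      and ABC: "A = K #>\<^bsub>X\<^esub> a" "B = K #>\<^bsub>X\<^esub> b" "C = K #>\<^bsub>X\<^esub> d"
      by (auto simp: car)
    have "f b \<otimes>\<^bsub>Y\<^esub> f a = f d \<otimes>\<^bsub>Y\<^esub> f a"
      using E abd by (simp add: ABC mm mult eq X.m_closed m)
    then have "f b = f d" using Y.r_cancel[OF c c c] abd by blast
    then show "B = C" using abd by (simp add: ABC eq)
  next
    fix A B C assume "A \<in> carrier (X Mod K)" "B \<in> carrier (X Mod K)" "C \<in> carrier (X Mod K)"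
      and E: "A \<otimes>\<^bsub>X Mod K\<^esub> B = A \<otimes>\<^bsub>X Mod K\<^esub> C"
    then obtain a b d where abd: "a \<in> carrier X" "b \<in> carrier X" "d \<in> carrier X"
      and ABC: "A = K #>\<^bsub>X\<^esub> a" "B = K #>\<^bsub>X\<^esub> b" "C = K #>\<^bsub>X\<^esub> d"
      by (auto simp: car)
    have "f a \<otimes>\<^bsub>Y\<^esub> f b = f a \<otimes>\<^bsub>Y\<^esub> f d"
      using E abd by (simp add: ABC mm mult eq X.m_closed m)
    then have "f b = f d" using Y.l_cancel[OF c c c] abd by blast
    then show "B = C" using abd by (simp add: ABC eq)
  next
    fix A C assume "A \<in> carrier (X Mod K)" "C \<in> carrier (X Mod K)"
    then obtain a b where ab: "a \<in> carrier X" "b \<in> carrier X" "A = K #>\<^bsub>X\<^esub> a" "C = K #>\<^bsub>X\<^esub> b"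
      by (auto simp: car)
    obtain u where "u \<in> carrier X" "u \<otimes>\<^bsub>X\<^esub> a = b" using X.r_div[OF ab(1,2)] .
    with ab show "\<exists>B\<in>carrier (X Mod K). B \<otimes>\<^bsub>X Mod K\<^esub> A = C"
      by (auto simp: car mm mult)
    obtain u where "u \<in> carrier X" "a \<otimes>\<^bsub>X\<^esub> u = b" using X.l_div[OF ab(1,2)] .
    with ab show "\<exists>B\<in>carrier (X Mod K). A \<otimes>\<^bsub>X Mod K\<^esub> B = C"
      by (auto simp: car mm mult)
  qed
  show "(\<lambda>x. kernel X Y f #>\<^bsub>X\<^esub> x) \<in> hom X (X Mod kernel X Y f)"
    unfolding K_def[symmetric] by (auto simp: hom_def car mm mult)
  have "K #>\<^bsub>X\<^esub> x = \<one>\<^bsub>X Mod K\<^esub> \<longleftrightarrow> f x = \<one>\<^bsub>Y\<^esub>" if "x \<in> carrier X" for x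
    unfolding oo using eq[OF that X.one_closed] loop_hom_one[OF assms] by simp
  then have "kernel X (X Mod K) (\<lambda>x. K #>\<^bsub>X\<^esub> x) = K"
    by (simp add: kernel_def[of X "X Mod K"] cong: conj_cong) (simp add: K_def kernel_def)
  then show "kernel X (X Mod kernel X Y f) (\<lambda>x. kernel X Y f #>\<^bsub>X\<^esub> x) = kernel X Y f"
    unfolding K_def .
qed

lemma normal_subloop_kernel:
  assumes "loop X" "loop Y" "f \<in> hom X Y"
  shows "normal_subloop (kernel X Y f) X"
  unfolding normal_subloop_def
  using loop_Mod_kernel(1,2)[OF assms] loop_Mod_kernel(3)[OF assms, symmetric]
  by (intro exI conjI)

end

theory Submission
  imports Defs "HOL-Algebra.Multiplicative_Group" "HOL-Algebra.Sylow" "HOL-Combinatorics.Perm"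
begin

text \<open>The loop is translated to its folder \<open>(G, H, K)\<close>: the enveloping group, the inner mapping group
  and the set of right multiplications, so that \<open>G = H K\<close>. Solvability of the loop means that iterating
  the passage from \<open>K\<close> to \<open>K \<inter> \<langle>H, G'\<rangle>\<close> ends in \<open>{1}\<close>. Dividing by the normal subgroup
  \<open>{g. K g = K}\<close>, which is contained in \<open>K\<close>, reduces the theorem to folders with
  an automorphism \<open>\<tau>\<close> that inverts \<open>K\<close> and centralises \<open>H\<close>. For these, \<open>\<tau>\<close>-invariant normal
  subgroups of odd order give quotient folders, and both implications go by induction on \<open>|G|\<close>,
  where a solvable loop even makes \<open>G\<close> an extension of a solvable group of odd order by a 2-group.
  In the absence of solvable normal subgroups of odd order, Frattini, centraliser and counting arguments
  show that all products \<open>k l\<^sup>-\<^sup>1\<close> of \<open>k, l \<in> K\<close> have 2-power order, and the Baer--Suzuki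
  theorem, applied to the involutions \<open>k \<tau>\<close>, makes \<open>G\<close> a 2-group. Quotients are realised as permutation groups
  on the natural numbers, which keeps the induction within one type.\<close>

text \<open>A quotient of a folder by a normal subgroup \<open>N\<close> is a folder only if
  \<open>k * inverse l\<close> lies in \<open>N\<close> whenever one of its conjugates lies in
  \<open>H N\<close>. This obstacle shapes the proof. The condition is established for the subgroup
  stabilising \<open>K\<close> and, once \<tau> is available, for \<tau>-invariant \<open>N\<close>
  of odd order, where involutions acting on odd sets have fixed points. For normal 2-subgroups
  nothing of the kind is shown; they enter only through centralisers, indices and the Baer--Suzuki
  theorem.

  The automorphism sends \<open>h * m\<close> to \<open>h * inverse m\<close>; this satisfies
  \<open>g K = K \<tau>(g)\<close>, and that equation determines \<tau>(g) up to the subgroup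
  divided out.

  A solvable loop has to yield more than a solvable \<open>G\<close> because of the induction: the
  odd part of a subfolder over a normal subgroup \<open>M\<close> is characteristic, so it lies in
  an odd solvable normal subgroup of \<open>G\<close>. If \<open>G\<close> has only the trivial one,
  the group of the subfolder is a 2-group. The converse implication uses this stronger form for
  proper subfolders.\<close>

section \<open>Finite groups as subsets of a multiplicative group type\<close>

class grp = monoid_mult + inverse +
  assumes left_inv [simp]: "inverse a * a = 1"
begin

sublocale grp: Groups.group times 1 inverse
  by standard simp_all

lemma right_inv [simp]: "a * inverse a = 1"
  by (rule grp.right_inverse)

lemma inv_mult: "inverse (a * b) = inverse b * inverse a"
  by (rule grp.inverse_distrib_swap)

lemma inv_cancel [simp]: "inverse a * (a * b) = b" "a * (inverse a * b) = b"
  by (simp_all flip: mult.assoc)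

lemma mult_left_cancel [simp]: "a * b = a * c \<longleftrightarrow> b = c"
  by (rule grp.left_cancel)

lemma mult_right_cancel [simp]: "b * a = c * a \<longleftrightarrow> b = c"
  by (rule grp.right_cancel)

lemma inv_eq_iff [simp]: "inverse a = inverse b \<longleftrightarrow> a = b"
  by (metis grp.inverse_inverse)

lemma mult_inv_eq_one [simp]: "a * inverse b = 1 \<longleftrightarrow> a = b"
  by (metis mult.assoc left_inv mult_1_right right_inv mult_1_left)

lemmas grp_simps = mult.assoc inv_mult

lemma conj_power: "(b * a * inverse b) ^ n = b * a ^ n * inverse b"
  by (induction n) (simp_all add: mult.assoc)

lemma power_inverse: "inverse a ^ n = inverse (a ^ n)"
proof (induction n)
  case (Suc n)
  have "inverse a ^ Suc n = inverse a ^ n * inverse a" by (rule power_Suc2)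
  also have "\<dots> = inverse (a ^ Suc n)" using Suc by (simp add: inv_mult)
  finally show ?case .
qed simp

end

instance perm :: (type) grp
  by standard simp

text \<open>Finiteness supplies the inverses: two powers of \<open>x\<close> agree, so some positive
  power of \<open>x\<close> is 1 (\<open>sgrp_inv\<close>).\<close>

definition sgrp :: "'a::grp set \<Rightarrow> bool" where
  "sgrp A \<longleftrightarrow> finite A \<and> 1 \<in> A \<and> (\<forall>x\<in>A. \<forall>y\<in>A. x * y \<in> A)"

lemma sgrpI: "\<lbrakk>finite A; 1 \<in> A; \<And>x y. \<lbrakk>x \<in> A; y \<in> A\<rbrakk> \<Longrightarrow> x * y \<in> A\<rbrakk> \<Longrightarrow> sgrp A"
  by (simp add: sgrp_def)

lemma sgrp_finite: "sgrp A \<Longrightarrow> finite A"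
  and sgrp_one [simp]: "sgrp A \<Longrightarrow> 1 \<in> A"
  and sgrp_mult [simp]: "\<lbrakk>sgrp A; x \<in> A; y \<in> A\<rbrakk> \<Longrightarrow> x * y \<in> A"
  by (simp_all add: sgrp_def)

lemma sgrp_power [simp]: "\<lbrakk>sgrp A; x \<in> A\<rbrakk> \<Longrightarrow> x ^ n \<in> A"
  by (induction n) simp_all

lemma sgrp_inv [simp]:
  assumes "sgrp A" "x \<in> A" shows "inverse x \<in> A"
proof -
  have "range (\<lambda>n::nat. x ^ n) \<subseteq> A" using assms by auto
  then have "\<not> inj (\<lambda>n::nat. x ^ n)"
    using sgrp_finite[OF assms(1)] finite_subset finite_imageD by blast
  then obtain m n :: nat where "m < n" "x ^ m = x ^ n"
    unfolding inj_def by (metis linorder_neqE_nat)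
  then obtain d where "x ^ m * 1 = x ^ m * x ^ Suc d"
    by (metis less_imp_Suc_add add_Suc_right power_add mult_1_right)
  then have "1 = x ^ Suc d" by (rule mult_left_cancel[THEN iffD1])
  then have "x * x ^ d = 1" by simp
  then have "inverse x = x ^ d"
    by (metis inv_cancel(1) mult_1_right)
  then show ?thesis using assms by simp
qed

lemma sgrp_Int: "\<lbrakk>sgrp A; sgrp B\<rbrakk> \<Longrightarrow> sgrp (A \<inter> B)"
  by (rule sgrpI) (auto simp: sgrp_finite)

lemma sgrp_trivial [simp]: "sgrp {1}"
  by (simp add: sgrp_def)

text \<open>The bridge to the record-based groups of HOL-Algebra, through which Lagrange, Sylow, the
  derived series and the loops of the statement are reached.\<close>

definition mk_group :: "'a::grp set \<Rightarrow> 'a monoid" where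
  "mk_group A = \<lparr>carrier = A, monoid.mult = (*), one = 1\<rparr>"

lemma mk_group_simps [simp]:
  "carrier (mk_group A) = A" "x \<otimes>\<^bsub>mk_group A\<^esub> y = x * y" "\<one>\<^bsub>mk_group A\<^esub> = 1"
  by (simp_all add: mk_group_def)

lemma group_mk_group: "sgrp A \<Longrightarrow> Group.group (mk_group A)"
proof (rule groupI)
  fix x assume "sgrp A" "x \<in> carrier (mk_group A)"
  then show "\<exists>y\<in>carrier (mk_group A). y \<otimes>\<^bsub>mk_group A\<^esub> x = \<one>\<^bsub>mk_group A\<^esub>"
    by (intro bexI[of _ "inverse x"]) auto
qed (auto simp: mult.assoc)

lemma mk_group_pow [simp]: "x [^]\<^bsub>mk_group A\<^esub> (n::nat) = x ^ n"
  by (induction n) (simp_all add: nat_pow_def power_commutes)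

lemma mk_group_inv: assumes "sgrp A" "x \<in> A" shows "inv\<^bsub>mk_group A\<^esub> x = inverse x"
proof -
  interpret Group.group "mk_group A" by (rule group_mk_group[OF assms(1)])
  show ?thesis using assms by (intro inv_equality) auto
qed

lemma subgroup_mk_group: "\<lbrakk>sgrp A; sgrp B; A \<subseteq> B\<rbrakk> \<Longrightarrow> subgroup A (mk_group B)"
  by (rule subgroup.intro) (auto simp: mk_group_inv)

lemma power_card: assumes "sgrp A" "x \<in> A" shows "x ^ card A = 1"
proof -
  interpret Group.group "mk_group A" by (rule group_mk_group[OF assms(1)])
  show ?thesis using pow_order_eq_1[of x] assms by (simp add: Coset.order_def)
qed

section \<open>Right cosets and indices\<close>

definition rcos :: "'a::grp set \<Rightarrow> 'a \<Rightarrow> 'a set" where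
  "rcos A b = (\<lambda>a. a * b) ` A"

text \<open>\<open>A\<close> need not be contained in \<open>B\<close>: for subgroups these are the
  right cosets of \<open>A\<close> that meet \<open>B\<close>, as many as the index of
  \<open>A \<inter> B\<close> in \<open>B\<close> (\<open>card_rcoss\<close>). Orbits of
  \<open>B\<close> on the cosets of \<open>A\<close> can so be counted without forming a product
  group.\<close>

definition rcoss :: "'a::grp set \<Rightarrow> 'a set \<Rightarrow> 'a set set" where
  "rcoss A B = rcos A ` B"

lemma rcos_self: "sgrp A \<Longrightarrow> b \<in> rcos A b"
  unfolding rcos_def by (rule image_eqI[of _ _ 1]) simp_all

lemma rcos_eq_iff: assumes "sgrp A" shows "rcos A b = rcos A c \<longleftrightarrow> c * inverse b \<in> A"
proof
  assume "rcos A b = rcos A c"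
  then have "c \<in> rcos A b" using rcos_self[OF assms] by blast
  then show "c * inverse b \<in> A" by (auto simp: rcos_def mult.assoc)
next
  assume a: "c * inverse b \<in> A"
  have sub: "rcos A b \<subseteq> rcos A c" if "c * inverse b \<in> A" for b c
  proof
    fix x assume "x \<in> rcos A b"
    then obtain a where "a \<in> A" "x = a * b" by (auto simp: rcos_def)
    then have "a * inverse (c * inverse b) \<in> A" "x = (a * inverse (c * inverse b)) * c"
      using that assms by (simp, simp add: grp_simps)
    then show "x \<in> rcos A c" unfolding rcos_def by blast
  qed
  have "b * inverse c \<in> A" using sgrp_inv[OF assms a] by (simp add: grp_simps)
  then show "rcos A b = rcos A c" using sub a by blast
qed

lemma rcos_eq_self: "sgrp A \<Longrightarrow> rcos A b = A \<longleftrightarrow> b \<in> A"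
  using rcos_eq_iff[of A 1 b] by (auto simp: rcos_def)

lemma rcos_mult_eq: "(\<lambda>x. x * c) ` rcos A b = rcos A (b * c)"
  by (auto simp: rcos_def image_iff mult.assoc)

lemma finite_rcoss: "finite B \<Longrightarrow> finite (rcoss A B)"
  by (simp add: rcoss_def)

lemma card_rcoss:
  assumes A: "sgrp A" and B: "sgrp B"
  shows "card (rcoss A B) * card (A \<inter> B) = card B"
proof -
  have "card B = (\<Sum>c\<in>rcoss A B. card {b \<in> B. rcos A b = c})"
    unfolding rcoss_def using sgrp_finite[OF B] using sum.image_gen[of B "\<lambda>_. 1::nat" "rcos A"] by simp
  also have "\<dots> = (\<Sum>c\<in>rcoss A B. card (A \<inter> B))"
  proof (rule sum.cong[OF refl])
    fix c assume "c \<in> rcoss A B"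
    then obtain b where b: "b \<in> B" "c = rcos A b" by (auto simp: rcoss_def)
    have "{x \<in> B. rcos A x = c} = (\<lambda>a. a * b) ` (A \<inter> B)"
    proof (rule Set.set_eqI, rule iffI)
      fix x assume "x \<in> {x \<in> B. rcos A x = c}"
      then have "x \<in> B" "x * inverse b \<in> A" using rcos_eq_iff[OF A, of b x] b by auto
      then have "x * inverse b \<in> A \<inter> B" "x = x * inverse b * b" using b B by (auto simp: mult.assoc)
      then show "x \<in> (\<lambda>a. a * b) ` (A \<inter> B)" by blast
    next
      fix x assume "x \<in> (\<lambda>a. a * b) ` (A \<inter> B)"
      then obtain a where "a \<in> A" "a \<in> B" "x = a * b" by auto
      then show "x \<in> {x \<in> B. rcos A x = c}" using b rcos_eq_iff[OF A, of b x] B by (auto simp: mult.assoc)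
    qed
    then show "card {x \<in> B. rcos A x = c} = card (A \<inter> B)"
      by (simp add: card_image inj_on_def)
  qed
  finally show ?thesis by simp
qed

lemma lagrange_rcoss: "\<lbrakk>sgrp A; sgrp B; A \<subseteq> B\<rbrakk> \<Longrightarrow> card (rcoss A B) * card A = card B"
  using card_rcoss[of A B] by (simp add: Int_absorb2)

text \<open>Sylow's theorem with exponent 1 gives a subgroup of order \<open>p\<close>; each of its
  elements other than 1 will do.\<close>

lemma cauchy:
  assumes "sgrp A" "prime p" "p dvd card A"
  obtains x where "x \<in> A" "x \<noteq> 1" "x ^ p = 1"
proof -
  have "Coset.order (mk_group A) = p ^ 1 * (card A div p)" using assms(3) by (simp add: Coset.order_def)
  then obtain P where Q: "subgroup P (mk_group A)" "card P = p ^ 1"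
    using sylow_thm[OF assms(2) group_mk_group[OF assms(1)]] sgrp_finite[OF assms(1)]
    by (metis mk_group_simps(1))
  have PA: "P \<subseteq> A" using subgroup.subset[OF Q(1)] by simp
  then have "finite P" using sgrp_finite[OF assms(1)] finite_subset by blast
  then have P: "sgrp P" "P \<subseteq> A" "card P = p"
    using PA Q subgroup.m_closed[OF Q(1)] subgroup.one_closed[OF Q(1)]
    by (auto intro: sgrpI)
  have "P \<noteq> {1}" using P(3) assms(2) prime_nat_iff by auto
  then obtain x where "x \<in> P" "x \<noteq> 1" using P(1) sgrp_one by blast
  then show thesis using that power_card[OF P(1)] P by auto
qed

subsection \<open>Fixed points of maps and actions of prime power order\<close>

lemma coprime_powers_eq_one:
  assumes "(x::'a::grp) ^ m = 1" "x ^ n = 1" "coprime m n" shows "x = 1"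
proof -
  obtain a b where ab: "a * m = Suc (b * n) \<or> b * n = Suc (a * m)"
  proof (cases "m = 0")
    case True then have "n = 1" using assms(3) by simp
    then show ?thesis using that[of 0 1] True by simp
  next
    case False
    then obtain a b where "m * a = n * b + gcd m n" using bezout_nat by blast
    then have "a * m = Suc (b * n)" using assms(3) by (simp add: mult.commute)
    then show ?thesis using that by blast
  qed
  have "x ^ (a * m) = 1" "x ^ (b * n) = 1"
    using assms by (simp_all add: power_mult[of x] mult.commute[of a] mult.commute[of b])
  with ab show ?thesis by (metis power_Suc mult_1_right)
qed

text \<open>A point that is not fixed has an orbit \<open>Q\<close> of exactly \<open>q\<close>
  points, by primality of \<open>q\<close>; the induction removes one such orbit at a time. Only
  iterates of a map occur, so that twisted maps such as \<open>x \<mapsto> \<tau> (x * k)\<close>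
  are covered as well.\<close>

lemma card_fixpoints_prime:
  fixes f :: "'a \<Rightarrow> 'a"
  assumes "prime q" "finite S" "\<And>x. x \<in> S \<Longrightarrow> f x \<in> S" "\<And>x. x \<in> S \<Longrightarrow> (f ^^ q) x = x"
  shows "card S mod q = card {x \<in> S. f x = x} mod q"
  using assms(2-)
proof (induction "card S" arbitrary: S rule: less_induct)
  case less
  show ?case
  proof (cases "\<forall>x\<in>S. f x = x")
    case True
    then have "{x \<in> S. f x = x} = S" by auto
    then show ?thesis by simp
  next
    case False
    then obtain x where x: "x \<in> S" "f x \<noteq> x" by auto
    have q: "q > 0" using assms(1) prime_gt_0_nat by blast
    have pS: "(f ^^ n) y \<in> S" if "y \<in> S" for n y using that less.prems(2) by (induction n) auto
    have per: "(f ^^ (n * q)) x = x" for n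
      using x less.prems(3) by (induction n) (auto simp: funpow_add)
    have md: "(f ^^ n) x = (f ^^ (n mod q)) x" for n
    proof -
      have "(f ^^ n) x = (f ^^ (n mod q)) ((f ^^ ((n div q) * q)) x)"
        by (metis comp_apply funpow_add mod_div_mult_eq)
      then show ?thesis using per by simp
    qed
    define Q where "Q = (\<lambda>n. (f ^^ n) x) ` {..<q}"
    have inj: "inj_on (\<lambda>n. (f ^^ n) x) {..<q}"
    proof (rule linorder_inj_onI)
      fix i j assume ij: "i < j" "i \<in> {..<q}" "j \<in> {..<q}"
      show "(f ^^ i) x \<noteq> (f ^^ j) x"
      proof
        assume e: "(f ^^ i) x = (f ^^ j) x"
        define d where "d = j - i"
        have d: "0 < d" "d < q" using ij by (auto simp: d_def)
        have add: "(f ^^ m) ((f ^^ n) x) = (f ^^ (m + n)) x" for m n by (simp add: funpow_add)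
        have "q - i + i = q" "q - i + j = q + d" using ij by (auto simp: d_def)
        then have "x = (f ^^ (q - i)) ((f ^^ i) x)" and "(f ^^ (q - i)) ((f ^^ j) x) = (f ^^ (q + d)) x"
          using less.prems(3)[OF x(1)] by (simp_all add: add)
        then have "x = (f ^^ (q + d)) x" using e by simp
        also have "\<dots> = (f ^^ d) x" using md[of "q+d"] md[of d] by simp
        finally have dx: "(f ^^ d) x = x" by simp
        then have dm: "(f ^^ (n * d)) x = x" for n by (induction n) (auto simp: funpow_add)
        have "coprime d q" using d assms(1) by (metis coprime_commute prime_imp_coprime nat_dvd_not_less)
        then obtain a b where "d * a = q * b + 1" using coprime_bezout_strong[of d q] d assms(1) prime_gt_1_nat by blast
        then have "(a * d) mod q = 1 mod q" by (metis mult.commute mod_mult_self4)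
        then have "(f ^^ 1) x = x" using dm[of a] md[of "a * d"] md[of 1] by metis
        then show False using x by simp
      qed
    qed (use linear in auto)
    then have cO: "card Q = q" by (simp add: Q_def card_image)
    have OS: "Q \<subseteq> S" using pS x by (auto simp: Q_def)
    have fO: "f y \<in> Q" if "y \<in> Q" for y
    proof -
      from that obtain n where "y = (f ^^ n) x" by (auto simp: Q_def)
      then have "f y = (f ^^ (Suc n mod q)) x" using md[of "Suc n"] by simp
      then show ?thesis using q by (auto simp: Q_def)
    qed
    have bO: "y \<in> Q" if "y \<in> S" "f y \<in> Q" for y
    proof -
      have "(f ^^ n) (f y) \<in> Q" for n using that fO by (induction n) auto
      moreover have "(f ^^ (q - 1)) (f y) = y"
        using less.prems(3)[OF that(1)] q by (metis Suc_pred' comp_apply funpow_Suc_right)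
      ultimately show ?thesis by metis
    qed
    have nf: "f y \<noteq> y" if "y \<in> Q" for y
    proof
      assume e: "f y = y"
      from \<open>y \<in> Q\<close> obtain n where n: "n < q" "y = (f ^^ n) x" by (auto simp: Q_def)
      have "(f ^^ m) y = y" for m using e by (induction m) auto
      then have "(f ^^ (q - n)) y = y" .
      moreover have "(f ^^ (q - n)) y = x"
        using n less.prems(3)[OF x(1)] funpow_add[of "q - n" n f] by simp
      ultimately show False using e x by simp
    qed
    have cs: "card S = card (S - Q) + q"
      using OS cO less.prems(1) by (metis card_Diff_subset card_mono finite_subset le_add_diff_inverse2)
    then have "card (S - Q) mod q = card {y \<in> S - Q. f y = y} mod q"
      using q less.prems bO by (intro less.hyps) auto
    moreover have "{y \<in> S - Q. f y = y} = {y \<in> S. f y = y}" using nf by auto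
    ultimately show ?thesis using cs by simp
  qed
qed

text \<open>Let \<open>g\<close> be the iterate of \<open>f\<close> of order dividing
  \<open>q\<close>. Counting first the fixed points of \<open>g\<close>, one is left with a set on
  which \<open>f\<close> has order dividing \<open>q ^ n\<close>.\<close>

lemma card_fixpoints_prime_power:
  fixes f :: "'a \<Rightarrow> 'a"
  assumes "prime q" "finite S" "\<And>x. x \<in> S \<Longrightarrow> f x \<in> S" "\<And>x. x \<in> S \<Longrightarrow> (f ^^ (q ^ n)) x = x"
  shows "card S mod q = card {x \<in> S. f x = x} mod q"
  using assms(2-)
proof (induction n arbitrary: S)
  case 0
  then have "{x \<in> S. f x = x} = S" by auto
  then show ?case by simp
next
  case (Suc n)
  define g where "g = f ^^ (q ^ n)"
  have gS: "g x \<in> S" if "x \<in> S" for x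
  proof -
    have "(f ^^ m) x \<in> S" for m using that Suc.prems(2) by (induction m) auto
    then show ?thesis by (simp add: g_def)
  qed
  have gq: "(g ^^ q) x = x" if "x \<in> S" for x
    using Suc.prems(3)[OF that] by (simp add: g_def funpow_mult mult.commute)
  have "card S mod q = card {x \<in> S. g x = x} mod q"
    by (rule card_fixpoints_prime[OF assms(1) Suc.prems(1) gS gq])
  also have "\<dots> = card {x \<in> {x \<in> S. g x = x}. f x = x} mod q"
  proof (rule Suc.IH)
    show "finite {x \<in> S. g x = x}" using Suc.prems(1) by simp
    show "f x \<in> {x \<in> S. g x = x}" if "x \<in> {x \<in> S. g x = x}" for x
      using that Suc.prems(2) by (auto simp: g_def funpow_swap1[symmetric])
    show "(f ^^ (q ^ n)) x = x" if "x \<in> {x \<in> S. g x = x}" for x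
      using that by (simp add: g_def)
  qed
  also have "{x \<in> {x \<in> S. g x = x}. f x = x} = {x \<in> S. f x = x}"
  proof -
    have "g x = x" if "f x = x" for x
    proof -
      have "(f ^^ m) x = x" for m using that by (induction m) auto
      then show ?thesis by (simp add: g_def)
    qed
    then show ?thesis by auto
  qed
  finally show ?case .
qed

lemma involution_odd_fixpoint:
  assumes "finite S" "odd (card S)" "\<And>x. x \<in> S \<Longrightarrow> f x \<in> S" "\<And>x. x \<in> S \<Longrightarrow> f (f x) = x"
  obtains x where "x \<in> S" "f x = x"
proof -
  have "card S mod 2 = card {x \<in> S. f x = x} mod 2"
    using assms by (intro card_fixpoints_prime) (auto simp: funpow_Suc_right numeral_2_eq_2[symmetric], simp add: numeral_2_eq_2)
  then have "card {x \<in> S. f x = x} \<noteq> 0" using assms(2) by presburger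
  then have "{x \<in> S. f x = x} \<noteq> {}" by force
  then show thesis using that by blast
qed

lemma rcoss_act: "\<lbrakk>sgrp B; C \<in> rcoss A B; v \<in> B\<rbrakk> \<Longrightarrow> (\<lambda>x. x * v) ` C \<in> rcoss A B"
  by (auto simp: rcoss_def rcos_mult_eq intro!: imageI simp del: image_eqI)

text \<open>Right multiplication by \<open>v\<close> permutes the cosets of \<open>A\<close> that
  meet \<open>B\<close>. Their number is prime to \<open>q\<close>, so some coset \<open>A b\<close>
  is fixed, which says that \<open>b * v * inverse b\<close> lies in \<open>A\<close>. This takes
  the place of Sylow's conjugacy theorem.\<close>

lemma conj_into:
  assumes A: "sgrp A" and B: "sgrp B" and v: "v \<in> B" "v ^ (q ^ f) = 1" and q: "prime q"
    and nd: "\<not> q dvd card (rcoss A B)"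
  obtains b where "b \<in> B" "b * v * inverse b \<in> A"
proof -
  define F where "F = (\<lambda>C. (\<lambda>x. x * v) ` C)"
  have Fn: "(F ^^ n) C = (\<lambda>x. x * v ^ n) ` C" for n C
    by (induction n) (auto simp: F_def image_image mult.assoc power_commutes)
  have "card (rcoss A B) mod q = card {C \<in> rcoss A B. F C = C} mod q"
  proof (rule card_fixpoints_prime_power[OF q])
    show "finite (rcoss A B)" by (simp add: finite_rcoss sgrp_finite[OF B])
    show "F C \<in> rcoss A B" if "C \<in> rcoss A B" for C using rcoss_act[OF B that v(1)] by (simp add: F_def)
    show "(F ^^ (q ^ f)) C = C" if "C \<in> rcoss A B" for C by (simp add: Fn v)
  qed
  then have "{C \<in> rcoss A B. F C = C} \<noteq> {}" using nd by (metis card.empty mod_0 dvd_eq_mod_eq_0)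
  then obtain b where b: "b \<in> B" "F (rcos A b) = rcos A b" by (auto simp: rcoss_def)
  then have "b * v * inverse b \<in> A"
    using rcos_eq_iff[OF A, of b "b * v"] by (simp add: F_def rcos_mult_eq)
  with b show thesis using that by blast
qed

lemma rcoss_eq:
  assumes "sgrp A" "\<And>b. b \<in> B \<Longrightarrow> \<exists>a\<in>A. \<exists>l\<in>L. b = a * l" "L \<subseteq> B"
  shows "rcoss A B = rcoss A L"
proof
  show "rcoss A B \<subseteq> rcoss A L"
  proof
    fix C assume "C \<in> rcoss A B"
    then obtain b where b: "b \<in> B" "C = rcos A b" by (auto simp: rcoss_def)
    then obtain a l where al: "a \<in> A" "l \<in> L" "b = a * l" using assms(2) by blast
    then have "rcos A l = rcos A b" using rcos_eq_iff[OF assms(1), of l b] by (simp add: mult.assoc)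
    then show "C \<in> rcoss A L" using al b by (auto simp: rcoss_def)
  qed
qed (use assms(3) in \<open>auto simp: rcoss_def\<close>)

lemma card_rcoss_dvd:
  assumes "sgrp A" "sgrp L" "\<And>b. b \<in> B \<Longrightarrow> \<exists>a\<in>A. \<exists>l\<in>L. b = a * l" "L \<subseteq> B"
  shows "card (rcoss A B) dvd card L"
proof -
  have "rcoss A B = rcoss A L" by (rule rcoss_eq[OF assms(1,3,4)])
  then show ?thesis using card_rcoss[OF assms(1,2)] by (metis dvd_triv_left)
qed

subsection \<open>Generated subgroups\<close>

text \<open>If no finite subgroup contains \<open>S\<close>, the intersection is empty of members
  and equals \<open>UNIV\<close>; hence the recurring premises \<open>sgrp A\<close> and
  \<open>S \<subseteq> A\<close>.\<close>

definition gen :: "'a::grp set \<Rightarrow> 'a set" where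
  "gen S = \<Inter> {A. sgrp A \<and> S \<subseteq> A}"

lemma gen_incl: "S \<subseteq> gen S"
  by (auto simp: gen_def)

lemma gen_least: "\<lbrakk>sgrp A; S \<subseteq> A\<rbrakk> \<Longrightarrow> gen S \<subseteq> A"
  by (auto simp: gen_def)

lemma gen_mono: "S \<subseteq> T \<Longrightarrow> gen S \<subseteq> gen T"
  by (auto simp: gen_def)

lemma sgrp_gen: assumes "sgrp A" "S \<subseteq> A" shows "sgrp (gen S)"
proof (rule sgrpI)
  show "finite (gen S)" using gen_least[OF assms] sgrp_finite[OF assms(1)] finite_subset by blast
qed (auto simp: gen_def)

lemma gen_sgrp: "sgrp A \<Longrightarrow> gen A = A"
  using gen_least[of A A] gen_incl[of A] by blast

lemma gen_induct [consumes 3, case_names one incl mult]: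
  assumes "x \<in> gen S" "sgrp A" "S \<subseteq> A" "P 1" "\<And>s. s \<in> S \<Longrightarrow> P s"
    "\<And>x y. \<lbrakk>x \<in> gen S; y \<in> gen S; P x; P y\<rbrakk> \<Longrightarrow> P (x * y)"
  shows "P x"
proof -
  have g: "sgrp (gen S)" by (rule sgrp_gen[OF assms(2,3)])
  have "sgrp {x \<in> gen S. P x}"
    using g sgrp_finite[OF g] assms(4,6) by (intro sgrpI) auto
  moreover have "S \<subseteq> {x \<in> gen S. P x}" using gen_incl assms(5) by blast
  ultimately show ?thesis using gen_least assms(1) by blast
qed

subsection \<open>Groups of prime power order\<close>

text \<open>Element orders are what Baer--Suzuki speaks about, and they pass at once to subgroups
  and images; \<open>pgrp_prime_dvd\<close> leads back to the order of the group.\<close>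

definition pgrp :: "nat \<Rightarrow> 'a::grp set \<Rightarrow> bool" where
  "pgrp q V \<longleftrightarrow> sgrp V \<and> (\<forall>v\<in>V. \<exists>a. v ^ (q ^ a) = 1)"

lemma pgrp_subset: "\<lbrakk>pgrp q V; sgrp U; U \<subseteq> V\<rbrakk> \<Longrightarrow> pgrp q U"
  by (auto simp: pgrp_def)

lemma pgrp_prime_dvd:
  assumes "pgrp q V" "prime q" "prime p" "p dvd card V" shows "p = q"
proof (rule ccontr)
  assume ne: "p \<noteq> q"
  have V: "sgrp V" using assms(1) by (simp add: pgrp_def)
  obtain x where x: "x \<in> V" "x \<noteq> 1" "x ^ p = 1" using cauchy[OF V assms(3,4)] .
  obtain a where "x ^ (q ^ a) = 1" using x assms(1) by (auto simp: pgrp_def)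
  moreover have "coprime p (q ^ a)" using ne assms(2,3) by (simp add: primes_coprime)
  ultimately show False using coprime_powers_eq_one[of x p "q ^ a"] x by blast
qed

lemma pgrp_index:
  assumes "pgrp q V" "prime q" "sgrp U" "U \<subset> V" shows "q dvd card (rcoss U V)"
proof -
  have V: "sgrp V" using assms(1) by (simp add: pgrp_def)
  have l: "card (rcoss U V) * card U = card V" using lagrange_rcoss[OF assms(3) V] assms(4) by blast
  have "card U < card V" using assms(4) sgrp_finite[OF V] psubset_card_mono by blast
  then have "card (rcoss U V) \<noteq> 1" using l by auto
  then obtain p where p: "prime p" "p dvd card (rcoss U V)" using prime_factor_nat by blast
  then have "p dvd card V" using l by (metis dvd_mult2)
  then show ?thesis using pgrp_prime_dvd[OF assms(1,2)] p by blast
qed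

definition normalizer_in :: "'a::grp set \<Rightarrow> 'a set \<Rightarrow> 'a set" where
  "normalizer_in V U = {g \<in> V. \<forall>u\<in>U. g * u * inverse g \<in> U}"

lemma sgrp_normalizer_in: "sgrp V \<Longrightarrow> sgrp (normalizer_in V U)"
proof (rule sgrpI)
  assume V: "sgrp V"
  fix x y assume x: "x \<in> normalizer_in V U" and y: "y \<in> normalizer_in V U"
  show "x * y \<in> normalizer_in V U"
    unfolding normalizer_in_def
  proof (intro CollectI conjI ballI)
    show "x * y \<in> V" using V x y by (auto simp: normalizer_in_def)
    fix u assume "u \<in> U"
    then have "x * (y * u * inverse y) * inverse x \<in> U" using x y by (auto simp: normalizer_in_def)
    then show "x * y * u * inverse (x * y) \<in> U" by (simp add: grp_simps)
  qed
qed (auto simp: normalizer_in_def sgrp_finite)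

lemma sgrp_maximal:
  assumes "sgrp V" "sgrp U" "U \<subset> V"
  obtains M where "sgrp M" "U \<subseteq> M" "M \<subset> V" "\<And>M'. \<lbrakk>sgrp M'; M \<subset> M'; M' \<subseteq> V\<rbrakk> \<Longrightarrow> M' = V"
proof -
  define \<M> where "\<M> = {M. sgrp M \<and> U \<subseteq> M \<and> M \<subset> V}"
  have "\<M> \<subseteq> Pow V" by (auto simp: \<M>_def)
  then have fin: "finite \<M>" using sgrp_finite[OF assms(1)] finite_subset finite_Pow_iff by blast
  have "U \<in> \<M>" using assms by (simp add: \<M>_def)
  then obtain M where M: "M \<in> \<M>" "\<And>M'. \<lbrakk>M' \<in> \<M>; M \<subseteq> M'\<rbrakk> \<Longrightarrow> M = M'"
    using finite_has_maximal[OF fin] by blast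
  show thesis
  proof (rule that[of M])
    fix M' assume "sgrp M'" "M \<subset> M'" "M' \<subseteq> V"
    then show "M' = V" using M by (auto simp: \<M>_def)
  qed (use M in \<open>auto simp: \<M>_def\<close>)
qed

definition acts :: "'a::grp set \<Rightarrow> 'b set \<Rightarrow> ('a \<Rightarrow> 'b \<Rightarrow> 'b) \<Rightarrow> bool" where
  "acts V S \<alpha> \<longleftrightarrow> (\<forall>v\<in>V. \<forall>s\<in>S. \<alpha> v s \<in> S) \<and> (\<forall>s\<in>S. \<alpha> 1 s = s) \<and>
    (\<forall>u\<in>V. \<forall>v\<in>V. \<forall>s\<in>S. \<alpha> (u * v) s = \<alpha> u (\<alpha> v s))"

lemma acts_mono: "\<lbrakk>acts V S \<alpha>; U \<subseteq> V\<rbrakk> \<Longrightarrow> acts U S \<alpha>"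
  by (simp add: acts_def subset_iff)

text \<open>The two claims support each other in the induction. The congruence for a proper subgroup
  \<open>U\<close>, acting on its own cosets in \<open>V\<close>, yields an element outside
  \<open>U\<close> that normalises \<open>U\<close>. This growth makes a maximal subgroup of
  \<open>V\<close> normal, and the congruence for \<open>V\<close> follows from that for the maximal
  subgroup together with one further element. The points are sets of group elements because the
  induction fixes their type and cosets are the points it needs.\<close>

lemma pgrp_fix_growth:
  fixes V :: "'a::grp set"
  assumes "prime q" "pgrp q V"
  shows "(\<forall>U. sgrp U \<longrightarrow> U \<subset> V \<longrightarrow> (\<exists>b\<in>V - U. \<forall>u\<in>U. b * u * inverse b \<in> U)) \<and>
    (\<forall>(S :: 'a set set) \<alpha>. finite S \<longrightarrow> acts V S \<alpha> \<longrightarrow>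
       card S mod q = card {s \<in> S. \<forall>v\<in>V. \<alpha> v s = s} mod q)"
  using assms(2)
proof (induction "card V" arbitrary: V rule: less_induct)
  case less
  have V: "sgrp V" using less.prems by (simp add: pgrp_def)
  have IH: "card S mod q = card {s \<in> S. \<forall>v\<in>U. \<alpha> v s = s} mod q"
    if "card U < card V" "pgrp q U" "finite S" "acts U S \<alpha>" for U :: "'a set" and \<alpha> and S :: "'a set set"
    using less.hyps[OF that(1,2)] that(3,4) by simp
  have growth: "\<exists>b\<in>V - U. \<forall>u\<in>U. b * u * inverse b \<in> U" if U: "sgrp U" "U \<subset> V" for U
  proof -
    define \<beta> where "\<beta> = (\<lambda>u C. (\<lambda>x. x * inverse u) ` C :: 'a set)"
    have pU: "pgrp q U" using pgrp_subset less.prems U by blast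
    have cU: "card U < card V" using U sgrp_finite[OF V] psubset_card_mono by blast
    have "card (rcoss U V) mod q = card {C \<in> rcoss U V. \<forall>u\<in>U. \<beta> u C = C} mod q"
    proof (rule IH[OF cU pU])
      show "finite (rcoss U V)" by (simp add: finite_rcoss sgrp_finite[OF V])
      have "\<beta> v s \<in> rcoss U V" if "v \<in> U" "s \<in> rcoss U V" for v s
        using rcoss_act[OF V that(2), of "inverse v"] that U V by (auto simp: \<beta>_def)
      then show "acts U (rcoss U V) \<beta>"
        by (auto simp: acts_def \<beta>_def image_image grp_simps)
    qed
    moreover have "q dvd card (rcoss U V)" by (rule pgrp_index[OF less.prems assms(1) U])
    ultimately have d: "q dvd card {C \<in> rcoss U V. \<forall>u\<in>U. \<beta> u C = C}" by (simp add: dvd_eq_mod_eq_0)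
    have sh: "\<beta> u (rcos U b) = rcos U (b * inverse u)" for u b by (simp add: \<beta>_def rcos_mult_eq)
    have U1: "rcos U 1 = U" by (simp add: rcos_def)
    have "U \<in> {C \<in> rcoss U V. \<forall>u\<in>U. \<beta> u C = C}"
    proof (intro CollectI conjI ballI)
      show "U \<in> rcoss U V" unfolding rcoss_def using U1 V by (metis image_eqI sgrp_one)
      show "\<beta> u U = U" if "u \<in> U" for u
        using sh[of u 1] rcos_eq_self[OF U(1), of "inverse u"] U1 that U by simp
    qed
    moreover have "finite {C \<in> rcoss U V. \<forall>u\<in>U. \<beta> u C = C}" by (simp add: finite_rcoss sgrp_finite[OF V])
    \<comment> \<open>\<open>U\<close> itself is a fixed coset and the number of fixed cosets is
      divisible by \<open>q\<close>, so there is a second one.\<close>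
    ultimately have "\<not> {C \<in> rcoss U V. \<forall>u\<in>U. \<beta> u C = C} \<subseteq> {U}"
      using d assms(1) by (metis (no_types, lifting) card.empty card_insert_disjoint empty_iff finite.emptyI
          nat_dvd_1_iff_1 not_prime_1 One_nat_def subset_singletonD)
    then obtain b where b: "b \<in> V" "rcos U b \<noteq> U" "\<And>u. u \<in> U \<Longrightarrow> \<beta> u (rcos U b) = rcos U b"
      by (auto simp: rcoss_def)
    have "b * u * inverse b \<in> U" if "u \<in> U" for u
      using b(3)[OF that] rcos_eq_iff[OF U(1), of "b * inverse u" b] by (simp add: sh grp_simps)
    moreover have "b \<notin> U" using b(2) rcos_eq_self[OF U(1)] by blast
    ultimately show ?thesis using b by blast
  qed
  have "card S mod q = card {s \<in> S. \<forall>v\<in>V. \<alpha> v s = s} mod q"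
    if S: "finite S" and ac: "acts V S \<alpha>" for \<alpha> and S :: "'a set set"
  proof (cases "V = {1}")
    case True
    then have "{s \<in> S. \<forall>v\<in>V. \<alpha> v s = s} = S" using ac by (auto simp: acts_def)
    then show ?thesis by simp
  next
    case False
    have cl: "\<And>v s. \<lbrakk>v \<in> V; s \<in> S\<rbrakk> \<Longrightarrow> \<alpha> v s \<in> S" and one: "\<And>s. s \<in> S \<Longrightarrow> \<alpha> 1 s = s"
      and act: "\<And>u v s. \<lbrakk>u \<in> V; v \<in> V; s \<in> S\<rbrakk> \<Longrightarrow> \<alpha> (u * v) s = \<alpha> u (\<alpha> v s)"
      using ac by (auto simp: acts_def)
    have "{1} \<subset> V" using False V by auto
    then obtain U where U: "sgrp U" "U \<subset> V"
      and max: "\<And>M'. \<lbrakk>sgrp M'; U \<subset> M'; M' \<subseteq> V\<rbrakk> \<Longrightarrow> M' = V"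
      using sgrp_maximal[OF V, of "{1}"] sgrp_trivial by metis
    have pU: "pgrp q U" using pgrp_subset less.prems U by blast
    have cU: "card U < card V" using U sgrp_finite[OF V] psubset_card_mono by blast
    obtain b where b: "b \<in> V" "b \<notin> U" "\<And>u. u \<in> U \<Longrightarrow> b * u * inverse b \<in> U"
      using growth[OF U] by blast
    \<comment> \<open>By growth the normaliser exceeds the maximal \<open>U\<close>, hence is
      \<open>V\<close>. So \<open>b\<close> acts on the fixed points \<open>T\<close> of
      \<open>U\<close>, and a point of \<open>T\<close> fixed by \<open>b\<close> is fixed by
      \<open>V\<close>, again by maximality.\<close>
    have "normalizer_in V U = V"
    proof (rule max)
      show "U \<subset> normalizer_in V U" using b U by (auto simp: normalizer_in_def)
    qed (use sgrp_normalizer_in[OF V] in \<open>auto simp: normalizer_in_def\<close>)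
    then have nU: "v * u * inverse v \<in> U" if "v \<in> V" "u \<in> U" for u v
      using that unfolding normalizer_in_def by blast
    define T where "T = {s \<in> S. \<forall>u\<in>U. \<alpha> u s = s}"
    have "card S mod q = card T mod q"
      unfolding T_def
      using IH[OF cU pU S] acts_mono[OF ac] U by blast
    also have "\<dots> = card {s \<in> T. \<alpha> b s = s} mod q"
    proof -
      obtain a where a: "b ^ (q ^ a) = 1" using less.prems b by (auto simp: pgrp_def)
      have pw: "(\<alpha> b ^^ n) s = \<alpha> (b ^ n) s" if "s \<in> S" for n s
        using that b V by (induction n) (auto simp: one act cl)
      show ?thesis
      proof (rule card_fixpoints_prime_power[OF assms(1)])
        show "finite T" using S by (simp add: T_def)
        show "(\<alpha> b ^^ (q ^ a)) s = s" if "s \<in> T" for s using that pw[of s] one by (simp add: T_def a)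
        show "\<alpha> b s \<in> T" if "s \<in> T" for s
          unfolding T_def
        proof (intro CollectI conjI ballI)
          have s: "s \<in> S" using that by (simp add: T_def)
          then show "\<alpha> b s \<in> S" using cl b by blast
          fix u assume u: "u \<in> U"
          then have u': "inverse b * u * b \<in> U" using nU[of "inverse b" u] b V by simp
          have "\<alpha> u (\<alpha> b s) = \<alpha> (u * b) s" using act s u b U by auto
          also have "u * b = b * (inverse b * u * b)" by (simp add: grp_simps)
          also have "\<alpha> \<dots> s = \<alpha> b (\<alpha> (inverse b * u * b) s)"
            by (rule act) (use s u' b U in auto)
          also have "\<dots> = \<alpha> b s" using that u' by (simp add: T_def)
          finally show "\<alpha> u (\<alpha> b s) = \<alpha> b s" .
        qed
      qed
    qed
    also have "{s \<in> T. \<alpha> b s = s} = {s \<in> S. \<forall>v\<in>V. \<alpha> v s = s}"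
    proof -
      have "\<forall>v\<in>V. \<alpha> v s = s" if s: "s \<in> T" "\<alpha> b s = s" for s
      proof -
        have sS: "s \<in> S" using s by (simp add: T_def)
        have "{v \<in> V. \<alpha> v s = s} = V"
        proof (rule max)
          show "sgrp {v \<in> V. \<alpha> v s = s}"
            using V sgrp_finite[OF V] by (intro sgrpI) (auto simp: one act sS)
          show "U \<subset> {v \<in> V. \<alpha> v s = s}" using s b U by (auto simp: T_def)
        qed auto
        then show ?thesis by blast
      qed
      then show ?thesis using U b by (auto simp: T_def)
    qed
    finally show ?thesis .
  qed
  with growth show ?case by blast
qed

lemma pgrp_maximal:
  assumes "prime q" "pgrp q V" "sgrp U" "U \<subset> V"
  obtains M where "sgrp M" "U \<subseteq> M" "M \<subset> V" "\<And>M'. \<lbrakk>sgrp M'; M \<subset> M'; M' \<subseteq> V\<rbrakk> \<Longrightarrow> M' = V"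
    "\<And>v u. \<lbrakk>v \<in> V; u \<in> M\<rbrakk> \<Longrightarrow> v * u * inverse v \<in> M"
proof -
  have V: "sgrp V" using assms(2) by (simp add: pgrp_def)
  obtain M where M: "sgrp M" "U \<subseteq> M" "M \<subset> V" "\<And>M'. \<lbrakk>sgrp M'; M \<subset> M'; M' \<subseteq> V\<rbrakk> \<Longrightarrow> M' = V"
    using sgrp_maximal[OF V assms(3,4)] by metis
  obtain b where b: "b \<in> V" "b \<notin> M" "\<And>u. u \<in> M \<Longrightarrow> b * u * inverse b \<in> M"
    using conjunct1[OF pgrp_fix_growth[OF assms(1,2)], rule_format, OF M(1,3)] by blast
  have "normalizer_in V M = V"
  proof (rule M(4))
    show "M \<subset> normalizer_in V M" using b M by (auto simp: normalizer_in_def)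
  qed (use sgrp_normalizer_in[OF V] in \<open>auto simp: normalizer_in_def\<close>)
  then have "v * u * inverse v \<in> M" if "v \<in> V" "u \<in> M" for u v
    using that unfolding normalizer_in_def by blast
  then show thesis using that M by metis
qed

text \<open>The last clause is index two in elementwise form. Among the iterated squares of an
  element outside a maximal subgroup \<open>M\<close> there is some \<open>c\<close> outside
  \<open>M\<close> with \<open>c * c\<close> in \<open>M\<close>; as \<open>M\<close> is normal,
  \<open>M \<union> M c\<close> is a subgroup, and by maximality it is \<open>V\<close>.\<close>

lemma pgrp2_index2:
  assumes "pgrp 2 V" "sgrp U" "U \<subset> V"
  obtains M where "sgrp M" "U \<subseteq> M" "M \<subset> V" "\<And>v u. \<lbrakk>v \<in> V; u \<in> M\<rbrakk> \<Longrightarrow> v * u * inverse v \<in> M"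
    "\<And>x y. \<lbrakk>x \<in> V; y \<in> V; x \<notin> M; y \<notin> M\<rbrakk> \<Longrightarrow> x * y \<in> M"
proof -
  have V: "sgrp V" using assms(1) by (simp add: pgrp_def)
  obtain M where M: "sgrp M" "U \<subseteq> M" "M \<subset> V"
    and max: "\<And>M'. \<lbrakk>sgrp M'; M \<subset> M'; M' \<subseteq> V\<rbrakk> \<Longrightarrow> M' = V"
    and nM: "\<And>v u. \<lbrakk>v \<in> V; u \<in> M\<rbrakk> \<Longrightarrow> v * u * inverse v \<in> M"
    using pgrp_maximal[OF two_is_prime_nat assms] by metis
  obtain b where b: "b \<in> V" "b \<notin> M" using M by blast
  obtain a where a: "b ^ (2 ^ a) = 1" using b assms(1) by (auto simp: pgrp_def)
  define i where "i = (LEAST i. b ^ (2 ^ i) \<in> M)"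
  have i: "b ^ (2 ^ i) \<in> M" unfolding i_def by (rule LeastI[of _ a]) (simp add: a M)
  have "i \<noteq> 0" using b i by (intro notI) simp
  then obtain j where j: "i = Suc j" using not0_implies_Suc by blast
  define c where "c = b ^ (2 ^ j)"
  have c: "c \<in> V" "c \<notin> M" "c * c \<in> M"
  proof -
    show "c \<in> V" using b V by (simp add: c_def)
    show "c \<notin> M" unfolding c_def using j not_less_Least[of j "\<lambda>i. b ^ (2 ^ i) \<in> M"] by (simp add: i_def)
    show "c * c \<in> M" using i by (simp add: j c_def mult_2 flip: power_add)
  qed
  have cc: "m * c * (m' * c) \<in> M" if "m \<in> M" "m' \<in> M" for m m'
  proof -
    have "m * c * (m' * c) = m * (c * m' * inverse c) * (c * c)" by (simp add: grp_simps)
    then show ?thesis using nM[OF c(1) that(2)] that(1) M(1) c(3) by (metis sgrp_mult)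
  qed
  have "M \<union> (\<lambda>m. m * c) ` M = V"
  proof (rule max)
    show "sgrp (M \<union> (\<lambda>m. m * c) ` M)"
    proof (rule sgrpI)
      fix x y assume "x \<in> M \<union> (\<lambda>m. m * c) ` M" "y \<in> M \<union> (\<lambda>m. m * c) ` M"
      moreover have "m * c * m' \<in> (\<lambda>m. m * c) ` M" if "m \<in> M" "m' \<in> M" for m m'
      proof -
        have "m * c * m' = m * (c * m' * inverse c) * c" by (simp add: grp_simps)
        then show ?thesis using nM[OF c(1) that(2)] that(1) M(1) by (metis imageI sgrp_mult)
      qed
      moreover have "m * (m' * c) \<in> (\<lambda>m. m * c) ` M" if "m \<in> M" "m' \<in> M" for m m'
        using that M(1) by (metis imageI sgrp_mult mult.assoc)
      ultimately show "x * y \<in> M \<union> (\<lambda>m. m * c) ` M" using cc M(1) by auto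
    qed (use M sgrp_finite in auto)
    have "c \<in> (\<lambda>m. m * c) ` M" using M(1) by (metis imageI mult_1_left sgrp_one)
    then show "M \<subset> M \<union> (\<lambda>m. m * c) ` M" using c by blast
    show "M \<union> (\<lambda>m. m * c) ` M \<subseteq> V" using M c V by auto
  qed
  then have "x * y \<in> M" if "x \<in> V" "y \<in> V" "x \<notin> M" "y \<notin> M" for x y
    using that cc by blast
  then show thesis using that M nM by metis
qed

subsection \<open>Normal subgroups and homomorphisms\<close>

definition nrm :: "'a::grp set \<Rightarrow> 'a set \<Rightarrow> bool" where
  "nrm N G \<longleftrightarrow> sgrp N \<and> N \<subseteq> G \<and> (\<forall>g\<in>G. \<forall>n\<in>N. g * n * inverse g \<in> N)"

lemma nrmI: "\<lbrakk>sgrp N; N \<subseteq> G; \<And>g n. \<lbrakk>g \<in> G; n \<in> N\<rbrakk> \<Longrightarrow> g * n * inverse g \<in> N\<rbrakk> \<Longrightarrow> nrm N G"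
  by (simp add: nrm_def)

lemma nrm_sgrp: "nrm N G \<Longrightarrow> sgrp N"
  and nrm_subset: "nrm N G \<Longrightarrow> N \<subseteq> G"
  and nrm_conj: "\<lbrakk>nrm N G; g \<in> G; n \<in> N\<rbrakk> \<Longrightarrow> g * n * inverse g \<in> N"
  by (simp_all add: nrm_def)

lemma nrm_conj': "\<lbrakk>nrm N G; sgrp G; g \<in> G; n \<in> N\<rbrakk> \<Longrightarrow> inverse g * n * g \<in> N"
  using nrm_conj[of N G "inverse g" n] by simp

lemma nrm_mono: "\<lbrakk>nrm N G; N \<subseteq> A; A \<subseteq> G\<rbrakk> \<Longrightarrow> nrm N A"
  by (auto simp: nrm_def)

lemma nrm_self: "sgrp G \<Longrightarrow> nrm G G"
  by (rule nrmI) auto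

lemma nrm_gen:
  assumes "sgrp G" "S \<subseteq> G" "\<And>g s. \<lbrakk>g \<in> G; s \<in> S\<rbrakk> \<Longrightarrow> g * s * inverse g \<in> gen S"
  shows "nrm (gen S) G"
proof (rule nrmI)
  show s: "sgrp (gen S)" by (rule sgrp_gen[OF assms(1,2)])
  show "gen S \<subseteq> G" by (rule gen_least[OF assms(1,2)])
  fix g n assume g: "g \<in> G" and "n \<in> gen S"
  from this(2) assms(1,2) show "g * n * inverse g \<in> gen S"
  proof (induction rule: gen_induct)
    case (mult x y)
    have "g * (x * y) * inverse g = (g * x * inverse g) * (g * y * inverse g)" by (simp add: grp_simps)
    then show ?case using mult s by simp
  qed (use s assms(3) g in auto)
qed

definition hm :: "('a::grp \<Rightarrow> 'b::grp) \<Rightarrow> 'a set \<Rightarrow> bool" where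
  "hm \<phi> G \<longleftrightarrow> sgrp G \<and> (\<forall>x\<in>G. \<forall>y\<in>G. \<phi> (x * y) = \<phi> x * \<phi> y)"

lemma hm_mult: "\<lbrakk>hm \<phi> G; x \<in> G; y \<in> G\<rbrakk> \<Longrightarrow> \<phi> (x * y) = \<phi> x * \<phi> y"
  by (simp add: hm_def)

lemma hm_mono: "\<lbrakk>hm \<phi> G; sgrp A; A \<subseteq> G\<rbrakk> \<Longrightarrow> hm \<phi> A"
  by (auto simp: hm_def)

lemma hm_one: assumes "hm \<phi> G" shows "\<phi> 1 = 1"
proof -
  have "\<phi> 1 * 1 = \<phi> 1 * \<phi> 1" using hm_mult[OF assms, of 1 1] assms by (simp add: hm_def)
  then show ?thesis by (metis mult_left_cancel)
qed

lemma hm_inv: assumes "hm \<phi> G" "x \<in> G" shows "\<phi> (inverse x) = inverse (\<phi> x)"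
proof -
  have "\<phi> (inverse x) * \<phi> x = 1"
    using assms hm_mult[OF assms(1), of "inverse x" x] hm_one[OF assms(1)] by (simp add: hm_def)
  then show ?thesis by (metis mult_1_left mult.assoc right_inv mult_1_right)
qed

lemma hm_power: "\<lbrakk>hm \<phi> G; x \<in> G\<rbrakk> \<Longrightarrow> \<phi> (x ^ n) = \<phi> x ^ n"
  by (induction n) (auto simp: hm_one hm_mult hm_def)

lemma hm_image_sgrp: "\<lbrakk>hm \<phi> G; sgrp A; A \<subseteq> G\<rbrakk> \<Longrightarrow> sgrp (\<phi> ` A)"
proof (rule sgrpI)
  assume a: "hm \<phi> G" "sgrp A" "A \<subseteq> G"
  show "1 \<in> \<phi> ` A" using a hm_one[OF a(1)] by (metis imageI sgrp_one)
  fix x y assume "x \<in> \<phi> ` A" "y \<in> \<phi> ` A"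
  then obtain u v where "u \<in> A" "v \<in> A" "x = \<phi> u" "y = \<phi> v" by auto
  then have "x * y = \<phi> (u * v)" "u * v \<in> A" using a hm_mult[OF a(1), of u v] by (simp_all add: subset_iff)
  then show "x * y \<in> \<phi> ` A" by blast
qed (simp add: sgrp_finite)

lemma hm_gen:
  assumes "hm \<phi> G" "S \<subseteq> G" shows "gen (\<phi> ` S) = \<phi> ` gen S"
proof
  have G: "sgrp G" using assms by (simp add: hm_def)
  have s: "sgrp (gen S)" "gen S \<subseteq> G" using sgrp_gen gen_least G assms(2) by blast+
  show "gen (\<phi> ` S) \<subseteq> \<phi> ` gen S"
    by (rule gen_least) (use hm_image_sgrp[OF assms(1) s] gen_incl in auto)
  have s2: "sgrp (gen (\<phi> ` S))"
    by (rule sgrp_gen[OF hm_image_sgrp[OF assms(1) G]]) (use assms in auto)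
  show "\<phi> ` gen S \<subseteq> gen (\<phi> ` S)"
  proof (rule image_subsetI)
    fix x assume "x \<in> gen S"
    from this G assms(2) show "\<phi> x \<in> gen (\<phi> ` S)"
    proof (induction rule: gen_induct)
      case one
      show ?case using s2 hm_one[OF assms(1)] by simp
    next
      case (incl s)
      then show ?case using gen_incl by blast
    next
      case (mult x y)
      then have "x \<in> G" "y \<in> G" using s by auto
      then show ?case using mult s2 hm_mult[OF assms(1)] by simp
    qed
  qed
qed

lemma hm_vimage_sgrp: "\<lbrakk>hm \<phi> G; sgrp B\<rbrakk> \<Longrightarrow> sgrp {g \<in> G. \<phi> g \<in> B}"
  by (rule sgrpI) (auto simp: hm_def sgrp_finite hm_one)

lemma hm_nrm_vimage: assumes "hm \<phi> G" "nrm B (\<phi> ` G)" shows "nrm {g \<in> G. \<phi> g \<in> B} G"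
proof (rule nrmI)
  have G: "sgrp G" using assms by (simp add: hm_def)
  show "sgrp {g \<in> G. \<phi> g \<in> B}" using hm_vimage_sgrp assms nrm_sgrp by blast
  fix g n assume gn: "g \<in> G" "n \<in> {g \<in> G. \<phi> g \<in> B}"
  then have "\<phi> (g * n * inverse g) = \<phi> g * \<phi> n * inverse (\<phi> g)"
    using G hm_mult[OF assms(1)] hm_inv[OF assms(1)] by simp
  then show "g * n * inverse g \<in> {g \<in> G. \<phi> g \<in> B}" using gn G nrm_conj[OF assms(2)] by simp
qed auto

lemma hm_nrm_image: assumes "hm \<phi> G" "nrm N G" shows "nrm (\<phi> ` N) (\<phi> ` G)"
proof (rule nrmI)
  have G: "sgrp G" using assms by (simp add: hm_def)
  show "sgrp (\<phi> ` N)" using hm_image_sgrp assms nrm_sgrp nrm_subset by blast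
  show "\<phi> ` N \<subseteq> \<phi> ` G" using nrm_subset[OF assms(2)] by blast
  fix g n assume "g \<in> \<phi> ` G" "n \<in> \<phi> ` N"
  then obtain u v where uv: "u \<in> G" "v \<in> N" "v \<in> G" "g = \<phi> u" "n = \<phi> v" using nrm_subset[OF assms(2)] by auto
  then have "\<phi> (u * v * inverse u) = g * n * inverse g"
    using G hm_mult[OF assms(1)] hm_inv[OF assms(1)] by simp
  then show "g * n * inverse g \<in> \<phi> ` N" using nrm_conj[OF assms(2) uv(1,2)] by (metis imageI)
qed

lemma hm_eq_iff:
  assumes "hm \<phi> G" "x \<in> G" "y \<in> G" shows "\<phi> x = \<phi> y \<longleftrightarrow> \<phi> (x * inverse y) = 1"
  using assms hm_mult[OF assms(1), of x "inverse y"] hm_inv[OF assms(1,3)] by (simp add: hm_def)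

definition pset :: "'a::grp set \<Rightarrow> 'a set \<Rightarrow> 'a set" where
  "pset A B = (\<lambda>(a, b). a * b) ` (A \<times> B)"

lemma psetI: "\<lbrakk>a \<in> A; b \<in> B\<rbrakk> \<Longrightarrow> a * b \<in> pset A B"
  by (auto simp: pset_def)

lemma psetE: assumes "x \<in> pset A B" obtains a b where "a \<in> A" "b \<in> B" "x = a * b"
  using assms by (auto simp: pset_def)

lemma pset_sgrp:
  assumes "sgrp A" "sgrp B" "\<And>a b. \<lbrakk>a \<in> A; b \<in> B\<rbrakk> \<Longrightarrow> inverse a * b * a \<in> B"
  shows "sgrp (pset A B)"
proof (rule sgrpI)
  show "finite (pset A B)" using assms by (simp add: pset_def sgrp_finite)
  show "1 \<in> pset A B" using psetI[of 1 A 1 B] assms by simp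
  fix x y assume "x \<in> pset A B" "y \<in> pset A B"
  then obtain a b c d where *: "a \<in> A" "b \<in> B" "x = a * b" "c \<in> A" "d \<in> B" "y = c * d"
    by (metis psetE)
  then have "x * y = (a * c) * ((inverse c * b * c) * d)" by (simp add: grp_simps)
  then show "x * y \<in> pset A B" using * assms by (metis psetI sgrp_mult)
qed

lemma pset_superset: "\<lbrakk>sgrp A; sgrp B\<rbrakk> \<Longrightarrow> A \<subseteq> pset A B" "\<lbrakk>sgrp A; sgrp B\<rbrakk> \<Longrightarrow> B \<subseteq> pset A B"
  using psetI[of _ A 1 B] psetI[of 1 A _ B] by auto

lemma pset_least: "\<lbrakk>sgrp C; A \<subseteq> C; B \<subseteq> C\<rbrakk> \<Longrightarrow> pset A B \<subseteq> C"
  by (auto simp: pset_def subset_iff)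

lemma nrm_pset:
  assumes "sgrp G" "nrm A G" "nrm B G" shows "nrm (pset A B) G"
proof (rule nrmI)
  show "sgrp (pset A B)"
    using nrm_subset[OF assms(2)] nrm_conj'[OF assms(3,1)] assms by (intro pset_sgrp) (auto simp: nrm_sgrp)
  show "pset A B \<subseteq> G" using pset_least[OF assms(1)] nrm_subset assms by blast
  fix g n assume g: "g \<in> G" "n \<in> pset A B"
  then obtain a b where ab: "a \<in> A" "b \<in> B" "n = a * b" by (metis psetE)
  have "g * n * inverse g = (g * a * inverse g) * (g * b * inverse g)" by (simp add: ab grp_simps)
  then show "g * n * inverse g \<in> pset A B" using ab g nrm_conj assms by (metis psetI)
qed

lemma pset_nrm_sgrp: "\<lbrakk>sgrp G; sgrp A; A \<subseteq> G; nrm N G\<rbrakk> \<Longrightarrow> sgrp (pset A N)"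
  by (intro pset_sgrp) (auto simp: nrm_sgrp intro: nrm_conj')

subsection \<open>The derived series\<close>

definition comms :: "'a::grp set \<Rightarrow> 'a set" where
  "comms A = (\<lambda>(x, y). x * y * inverse x * inverse y) ` (A \<times> A)"

definition der :: "'a::grp set \<Rightarrow> 'a set" where
  "der A = gen (comms A)"

definition sol :: "'a::grp set \<Rightarrow> bool" where
  "sol A \<longleftrightarrow> (\<exists>n. (der ^^ n) A \<subseteq> {1})"

lemma commsI: "\<lbrakk>x \<in> A; y \<in> A\<rbrakk> \<Longrightarrow> x * y * inverse x * inverse y \<in> comms A"
  by (auto simp: comms_def)

lemma commsE: assumes "c \<in> comms A" obtains x y where "x \<in> A" "y \<in> A" "c = x * y * inverse x * inverse y"
  using assms by (auto simp: comms_def)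

lemma comms_mono: "A \<subseteq> B \<Longrightarrow> comms A \<subseteq> comms B"
  by (auto simp: comms_def)

lemma comms_subset: "sgrp A \<Longrightarrow> comms A \<subseteq> A"
  by (auto simp: comms_def)

lemma der_mono: "A \<subseteq> B \<Longrightarrow> der A \<subseteq> der B"
  unfolding der_def by (intro gen_mono comms_mono)

lemma der_pow_mono: "A \<subseteq> B \<Longrightarrow> (der ^^ n) A \<subseteq> (der ^^ n) B"
  by (induction n) (simp_all add: der_mono)

lemma der_subset: "sgrp A \<Longrightarrow> der A \<subseteq> A"
  unfolding der_def by (intro gen_least comms_subset)

lemma der_sgrp: "sgrp A \<Longrightarrow> sgrp (der A)"
  unfolding der_def using sgrp_gen comms_subset by blast

lemma der_comm: "\<lbrakk>x \<in> A; y \<in> A\<rbrakk> \<Longrightarrow> x * y * inverse x * inverse y \<in> der A"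
  unfolding der_def using commsI gen_incl by blast

lemma der_nrm: assumes "sgrp G" "nrm A G" shows "nrm (der A) G"
  unfolding der_def
proof (rule nrm_gen[OF assms(1)])
  show "comms A \<subseteq> G" using comms_subset nrm_sgrp nrm_subset assms by blast
  fix g s assume g: "g \<in> G" "s \<in> comms A"
  then obtain x y where s: "x \<in> A" "y \<in> A" "s = x * y * inverse x * inverse y" by (metis commsE)
  have "g * s * inverse g = (g * x * inverse g) * (g * y * inverse g) *
     inverse (g * x * inverse g) * inverse (g * y * inverse g)" by (simp add: s grp_simps)
  then show "g * s * inverse g \<in> gen (comms A)"
    using commsI[OF nrm_conj nrm_conj, OF assms(2) g(1) s(1) assms(2) g(1) s(2)] gen_incl by force
qed

lemma der_pow_nrm: "\<lbrakk>sgrp G; nrm A G\<rbrakk> \<Longrightarrow> nrm ((der ^^ n) A) G"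
  by (induction n) (auto intro: der_nrm)

lemma sol_mono: "\<lbrakk>sol B; A \<subseteq> B\<rbrakk> \<Longrightarrow> sol A"
  unfolding sol_def using der_pow_mono by blast

lemma sol_der: assumes "sol (der A)" shows "sol A"
proof -
  obtain n where "(der ^^ n) (der A) \<subseteq> {1}" using assms by (auto simp: sol_def)
  then have "(der ^^ Suc n) A \<subseteq> {1}" by (simp add: funpow_swap1)
  then show ?thesis unfolding sol_def by blast
qed

lemma sol_der_pow: assumes "(der ^^ m) A \<subseteq> N" "sol N" shows "sol A"
proof -
  obtain n where "(der ^^ n) N \<subseteq> {1}" using assms(2) by (auto simp: sol_def)
  then have "(der ^^ (n + m)) A \<subseteq> {1}" using der_pow_mono[OF assms(1), of n] by (auto simp: funpow_add)
  then show ?thesis unfolding sol_def by blast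
qed

lemma sol_trivial [simp]: "sol {1}"
  unfolding sol_def by (rule exI[of _ 0]) simp

lemma sol_abelian: "(\<And>x y. \<lbrakk>x \<in> A; y \<in> A\<rbrakk> \<Longrightarrow> x * y = y * x) \<Longrightarrow> sol A"
proof (rule sol_der)
  assume c: "\<And>x y. \<lbrakk>x \<in> A; y \<in> A\<rbrakk> \<Longrightarrow> x * y = y * x"
  have "comms A \<subseteq> {1}"
  proof
    fix z assume "z \<in> comms A"
    then obtain x y where "x \<in> A" "y \<in> A" "z = x * y * inverse x * inverse y" by (metis commsE)
    then have "z = y * x * inverse x * inverse y" using c by metis
    then show "z \<in> {1}" by (simp add: mult.assoc)
  qed
  then have "der A \<subseteq> {1}" unfolding der_def by (rule gen_least[OF sgrp_trivial])
  then show "sol (der A)" using sol_mono[OF sol_trivial] by blast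
qed

lemma sol_der_proper: assumes "sol G" "sgrp G" "G \<noteq> {1}" shows "der G \<noteq> G"
proof
  assume e: "der G = G"
  have "(der ^^ n) G = G" for n by (induction n) (auto simp: e)
  then have "G \<subseteq> {1}" using assms(1) by (auto simp: sol_def)
  then show False using assms sgrp_one by blast
qed

lemma hm_comms: assumes "hm \<phi> G" "A \<subseteq> G" shows "comms (\<phi> ` A) = \<phi> ` comms A"
proof -
  have "\<phi> (x * y * inverse x * inverse y) = \<phi> x * \<phi> y * inverse (\<phi> x) * inverse (\<phi> y)"
    if "x \<in> A" "y \<in> A" for x y
    using that assms hm_mult[OF assms(1)] hm_inv[OF assms(1)] by (auto simp: hm_def subset_iff)
  then have "(\<lambda>(x, y). x * y * inverse x * inverse y) (map_prod \<phi> \<phi> p)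
      = \<phi> ((\<lambda>(x, y). x * y * inverse x * inverse y) p)" if "p \<in> A \<times> A" for p
    using that by auto
  then show ?thesis
    unfolding comms_def map_prod_surj_on[of \<phi> A "\<phi> ` A" \<phi> A "\<phi> ` A", OF refl refl, symmetric] image_image
    by (rule image_cong[OF refl])
qed

lemma hm_der: assumes "hm \<phi> G" "sgrp A" "A \<subseteq> G" shows "der (\<phi> ` A) = \<phi> ` der A"
  unfolding der_def hm_comms[OF assms(1,3)]
  by (rule hm_gen[OF assms(1)]) (use comms_subset assms in blast)

lemma hm_der_pow: assumes "hm \<phi> G" "sgrp A" "A \<subseteq> G"
  shows "(der ^^ n) (\<phi> ` A) = \<phi> ` (der ^^ n) A \<and> sgrp ((der ^^ n) A) \<and> (der ^^ n) A \<subseteq> G"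
proof (induction n)
  case (Suc n)
  then have "der (\<phi> ` (der ^^ n) A) = \<phi> ` der ((der ^^ n) A)" using hm_der[OF assms(1)] by blast
  moreover have "der ((der ^^ n) A) \<subseteq> (der ^^ n) A" "sgrp (der ((der ^^ n) A))"
    using der_subset der_sgrp Suc by blast+
  ultimately show ?case using Suc by auto
qed (use assms in simp)

lemma sol_image: "\<lbrakk>hm \<phi> G; sgrp A; A \<subseteq> G; sol A\<rbrakk> \<Longrightarrow> sol (\<phi> ` A)"
proof -
  assume a: "hm \<phi> G" "sgrp A" "A \<subseteq> G" "sol A"
  then obtain n where "(der ^^ n) A \<subseteq> {1}" by (auto simp: sol_def)
  then have "(der ^^ n) (\<phi> ` A) \<subseteq> {1}"
    using hm_der_pow[OF a(1-3), of n] hm_one[OF a(1)] by auto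
  then show ?thesis unfolding sol_def by blast
qed

lemma sol_extension:
  assumes "hm \<phi> G" "sol (\<phi> ` G)" "sol N" "\<And>g. \<lbrakk>g \<in> G; \<phi> g = 1\<rbrakk> \<Longrightarrow> g \<in> N" shows "sol G"
proof -
  have G: "sgrp G" using assms by (simp add: hm_def)
  obtain n where "(der ^^ n) (\<phi> ` G) \<subseteq> {1}" using assms(2) by (auto simp: sol_def)
  then have "(der ^^ n) G \<subseteq> N" using hm_der_pow[OF assms(1) G, of n] assms(4) by blast
  then show ?thesis using sol_der_pow assms(3) by blast
qed

text \<open>All commutators lie in a normal subgroup of index two, to which the induction
  applies.\<close>

lemma sol_pgrp2: assumes "pgrp 2 V" shows "sol V"
  using assms
proof (induction "card V" arbitrary: V rule: less_induct)
  case less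
  have V: "sgrp V" using less.prems by (simp add: pgrp_def)
  show ?case
  proof (cases "V = {1}")
    case False
    then have "{1} \<subset> V" using V by auto
    then obtain M where M: "sgrp M" "M \<subset> V" "\<And>v u. \<lbrakk>v \<in> V; u \<in> M\<rbrakk> \<Longrightarrow> v * u * inverse v \<in> M"
      "\<And>x y. \<lbrakk>x \<in> V; y \<in> V; x \<notin> M; y \<notin> M\<rbrakk> \<Longrightarrow> x * y \<in> M"
      using pgrp2_index2[OF less.prems sgrp_trivial] by metis
    have "comms V \<subseteq> M"
    proof
      fix c assume "c \<in> comms V"
      then obtain x y where c: "x \<in> V" "y \<in> V" "c = x * y * inverse x * inverse y" by (metis commsE)
      consider "x \<in> M" | "y \<in> M" | "x \<notin> M" "y \<notin> M" by blast
      then show "c \<in> M"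
      proof cases
        case 1
        then have "x * (y * inverse x * inverse y) \<in> M" using M c by simp
        then show ?thesis by (simp add: c mult.assoc)
      next
        case 2
        then have "(x * y * inverse x) * inverse y \<in> M" using M c by simp
        then show ?thesis by (simp add: c mult.assoc)
      next
        case 3
        then have "(x * y) * inverse (y * x) \<in> M" using M c by simp
        then show ?thesis by (simp add: c grp_simps)
      qed
    qed
    then have d: "der V \<subseteq> M" unfolding der_def by (rule gen_least[OF M(1)])
    have "sol M"
      using less.hyps[of M] psubset_card_mono[OF sgrp_finite[OF V] M(2)] pgrp_subset[OF less.prems M(1)] M(2) by blast
    then show ?thesis using d sol_mono sol_der by blast
  qed simp
qed

subsection \<open>Quotients as permutation groups\<close>

lemma perm_representation:
  fixes \<alpha> :: "'a::grp \<Rightarrow> 's \<Rightarrow> 's"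
  assumes G: "sgrp G" and S: "finite S" and ac: "acts G S \<alpha>"
  obtains \<phi> :: "'a \<Rightarrow> nat perm" where "hm \<phi> G" "\<And>g. g \<in> G \<Longrightarrow> \<phi> g = 1 \<longleftrightarrow> (\<forall>s\<in>S. \<alpha> g s = s)"
proof -
  have cl: "\<And>v s. \<lbrakk>v \<in> G; s \<in> S\<rbrakk> \<Longrightarrow> \<alpha> v s \<in> S" and one: "\<And>s. s \<in> S \<Longrightarrow> \<alpha> 1 s = s"
    and act: "\<And>u v s. \<lbrakk>u \<in> G; v \<in> G; s \<in> S\<rbrakk> \<Longrightarrow> \<alpha> (u * v) s = \<alpha> u (\<alpha> v s)"
    using ac unfolding acts_def by blast+
  obtain e :: "'s \<Rightarrow> nat" where e: "bij_betw e S {0..<card S}" using ex_bij_betw_finite_nat[OF S] by blast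
  then have inj: "inj_on e S" by (simp add: bij_betw_def)
  define F where "F = (\<lambda>g i. if i \<in> e ` S then e (\<alpha> g (inv_into S e i)) else i)"
  have Fe: "F g (e s) = e (\<alpha> g s)" if "s \<in> S" for g s using that inj by (simp add: F_def)
  have Fout: "F g i = i" if "i \<notin> e ` S" for g i using that by (simp add: F_def)
  have FF: "F (g * h) i = F g (F h i)" if "g \<in> G" "h \<in> G" for g h i
    using that Fe Fout act cl by (cases "i \<in> e ` S") auto
  have F1: "F 1 i = i" for i using Fe Fout one by (cases "i \<in> e ` S") auto
  have bij: "bij (F g)" if "g \<in> G" for g
    using FF[of g "inverse g"] FF[of "inverse g" g] that G F1
    by (intro o_bij[of "F (inverse g)"]) (auto simp: fun_eq_iff)
  have fin: "finite {i. F g i \<noteq> i}" for g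
    by (rule finite_subset[of _ "e ` S"]) (use Fout S in auto)
  define \<phi> where "\<phi> = (\<lambda>g. Perm (F g))"
  have ap: "apply (\<phi> g) = F g" if "g \<in> G" for g
    unfolding \<phi>_def by (rule Perm_inverse) (use bij[OF that] fin in simp)
  have "hm \<phi> G"
    unfolding hm_def using G by (auto intro!: perm_eqI simp: apply_times ap FF)
  moreover have "\<phi> g = 1 \<longleftrightarrow> (\<forall>s\<in>S. \<alpha> g s = s)" if g: "g \<in> G" for g
  proof -
    have "\<phi> g = 1 \<longleftrightarrow> (\<forall>i. F g i = i)" by (simp add: perm_eq_iff ap[OF g])
    also have "\<dots> \<longleftrightarrow> (\<forall>s\<in>S. F g (e s) = e s)" using Fout by (metis imageE)
    also have "\<dots> \<longleftrightarrow> (\<forall>s\<in>S. \<alpha> g s = s)" using inj cl[OF g] by (auto simp: Fe inj_on_eq_iff)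
    finally show ?thesis .
  qed
  ultimately show thesis using that by blast
qed

text \<open>The kernel of the action on the cosets of \<open>N\<close> is the intersection of the
  conjugates of \<open>N\<close>, that is \<open>N\<close>. Multiplying from the right by
  \<open>inverse u\<close> makes it a left action.\<close>

lemma quotient_perm:
  fixes G :: "'a::grp set"
  assumes "sgrp G" "nrm N G"
  obtains \<phi> :: "'a \<Rightarrow> nat perm" where "hm \<phi> G" "\<And>g. g \<in> G \<Longrightarrow> \<phi> g = 1 \<longleftrightarrow> g \<in> N"
proof -
  have N: "sgrp N" using nrm_sgrp assms(2) by blast
  define \<beta> where "\<beta> = (\<lambda>u C. (\<lambda>x. x * inverse u) ` C :: 'a set)"
  have sh: "\<beta> u (rcos N b) = rcos N (b * inverse u)" for u b by (simp add: \<beta>_def rcos_mult_eq)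
  have "\<beta> v s \<in> rcoss N G" if "v \<in> G" "s \<in> rcoss N G" for v s
    using rcoss_act[OF assms(1) that(2), of "inverse v"] that assms by (auto simp: \<beta>_def)
  then have "acts G (rcoss N G) \<beta>" by (auto simp: acts_def \<beta>_def image_image grp_simps)
  moreover have "finite (rcoss N G)" by (simp add: finite_rcoss sgrp_finite assms)
  ultimately obtain \<phi> :: "'a \<Rightarrow> nat perm" where \<phi>: "hm \<phi> G"
    "\<And>g. g \<in> G \<Longrightarrow> \<phi> g = 1 \<longleftrightarrow> (\<forall>C\<in>rcoss N G. \<beta> g C = C)"
    using perm_representation[OF assms(1)] by metis
  have "(\<forall>C\<in>rcoss N G. \<beta> g C = C) \<longleftrightarrow> g \<in> N" if g: "g \<in> G" for g
  proof -
    have "(\<forall>C\<in>rcoss N G. \<beta> g C = C) \<longleftrightarrow> (\<forall>b\<in>G. b * g * inverse b \<in> N)"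
      by (simp add: rcoss_def sh rcos_eq_iff[OF N] grp_simps)
    also have "\<dots> \<longleftrightarrow> g \<in> N"
    proof
      assume "\<forall>b\<in>G. b * g * inverse b \<in> N"
      then have "1 * g * inverse 1 \<in> N" using assms(1) sgrp_one by blast
      then show "g \<in> N" by simp
    qed (use nrm_conj[OF assms(2)] in auto)
    finally show ?thesis .
  qed
  with \<phi> show thesis using that by metis
qed

lemma card_image_hm_less:
  assumes "hm \<phi> G" "n \<in> G" "n \<noteq> 1" "\<phi> n = 1" shows "card (\<phi> ` G) < card G"
proof -
  have G: "sgrp G" using assms(1) by (simp add: hm_def)
  have "\<not> inj_on \<phi> G" using assms hm_one[OF assms(1)] G by (metis inj_onD sgrp_one)
  then show ?thesis using card_image_le[of G \<phi>] eq_card_imp_inj_on[of G \<phi>] sgrp_finite[OF G] by force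
qed

subsection \<open>Radicals\<close>

lemma pset_power:
  assumes "sgrp B" "\<And>b. b \<in> B \<Longrightarrow> inverse a * b * a \<in> B" "b \<in> B"
  shows "\<exists>b'\<in>B. (a * b) ^ n = a ^ n * b'"
proof (induction n)
  case 0
  show ?case using assms(1) by (intro bexI[of _ 1]) auto
next
  case (Suc n)
  then obtain b' where b': "b' \<in> B" "(a * b) ^ n = a ^ n * b'" by blast
  have "(a * b) ^ Suc n = a ^ Suc n * ((inverse a * b' * a) * b)"
    unfolding power_Suc2 b' by (simp add: grp_simps)
  then show ?case using assms b' by (metis sgrp_mult)
qed

lemma pgrp2_pset:
  assumes "pgrp 2 A" "pgrp 2 B" "\<And>a b. \<lbrakk>a \<in> A; b \<in> B\<rbrakk> \<Longrightarrow> inverse a * b * a \<in> B"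
  shows "pgrp 2 (pset A B)"
  unfolding pgrp_def
proof (intro conjI ballI)
  have AB: "sgrp A" "sgrp B" using assms by (auto simp: pgrp_def)
  show "sgrp (pset A B)" by (rule pset_sgrp[OF AB assms(3)])
  fix v assume "v \<in> pset A B"
  then obtain a b where v: "a \<in> A" "b \<in> B" "v = a * b" by (metis psetE)
  obtain i where i: "a ^ (2 ^ i) = 1" using v assms(1) by (auto simp: pgrp_def)
  obtain b' where b': "b' \<in> B" "v ^ (2 ^ i) = b'"
    using pset_power[OF AB(2) assms(3)[OF v(1)] v(2), of "2 ^ i"] i v by auto
  obtain j where "b' ^ (2 ^ j) = 1" using b' assms(2) by (auto simp: pgrp_def)
  then have "v ^ (2 ^ (i + j)) = 1" using b' by (simp add: power_add power_mult)
  then show "\<exists>a. v ^ (2 ^ a) = 1" by blast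
qed

lemma odd_cardI:
  assumes "sgrp A" "\<And>x. x \<in> A \<Longrightarrow> \<exists>n. odd n \<and> x ^ n = 1" shows "odd (card A)"
proof
  assume "even (card A)"
  then obtain x where x: "x \<in> A" "x \<noteq> 1" "x ^ 2 = 1" using cauchy[OF assms(1) two_is_prime_nat] by blast
  then obtain n where "odd n" "x ^ n = 1" using assms(2) by blast
  then show False using coprime_powers_eq_one[of x 2 n] x by simp
qed

text \<open>Solvability is carried along with odd order, so that the odd order theorem is never
  invoked.\<close>

definition odd_sol :: "'a::grp set \<Rightarrow> bool" where
  "odd_sol A \<longleftrightarrow> sgrp A \<and> odd (card A) \<and> sol A"

lemma odd_sol_trivial: "odd_sol {1}"
  by (simp add: odd_sol_def)

lemma odd_sol_pset:
  assumes "odd_sol A" "odd_sol B" "\<And>a b. \<lbrakk>a \<in> A; b \<in> B\<rbrakk> \<Longrightarrow> inverse a * b * a \<in> B"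
  shows "odd_sol (pset A B)"
proof -
  have AB: "sgrp A" "sgrp B" using assms by (auto simp: odd_sol_def)
  have P: "sgrp (pset A B)" by (rule pset_sgrp[OF AB assms(3)])
  have "odd (card (pset A B))"
  proof (rule odd_cardI[OF P])
    fix v assume "v \<in> pset A B"
    then obtain a b where v: "a \<in> A" "b \<in> B" "v = a * b" by (metis psetE)
    obtain b' where b': "b' \<in> B" "v ^ card A = b'"
      using pset_power[OF AB(2) assms(3)[OF v(1)] v(2), of "card A"] power_card[OF AB(1) v(1)] v by auto
    then have "v ^ (card A * card B) = 1" using power_card[OF AB(2)] by (simp add: power_mult)
    then show "\<exists>n. odd n \<and> v ^ n = 1" using assms by (metis odd_sol_def even_mult_iff)
  qed
  moreover have "sol (pset A B)"
  proof -
    have "nrm B (pset A B)"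
    proof (rule nrmI)
      fix g n assume "g \<in> pset A B" "n \<in> B"
      then obtain a b where v: "a \<in> A" "b \<in> B" "g = a * b" by (metis psetE)
      then have "inverse (inverse a) * (b * n * inverse b) * inverse a \<in> B"
        using assms(3)[of "inverse a" "b * n * inverse b"] AB \<open>n \<in> B\<close> by simp
      then show "g * n * inverse g \<in> B" by (simp add: v grp_simps)
    qed (use AB pset_superset[OF AB] in auto)
    then obtain \<phi> :: "'a \<Rightarrow> nat perm" where \<phi>: "hm \<phi> (pset A B)"
      "\<And>g. g \<in> pset A B \<Longrightarrow> \<phi> g = 1 \<longleftrightarrow> g \<in> B" using quotient_perm[OF P] by metis
    have "\<phi> ` pset A B \<subseteq> \<phi> ` A"
    proof (rule image_subsetI)
      fix x assume "x \<in> pset A B"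
      then obtain a b where v: "a \<in> A" "b \<in> B" "x = a * b" by (metis psetE)
      moreover have "a \<in> pset A B" "b \<in> pset A B" using v pset_superset AB by blast+
      ultimately have "\<phi> x = \<phi> a" using hm_mult[OF \<phi>(1)] \<phi>(2)[of b] by simp
      then show "\<phi> x \<in> \<phi> ` A" using v by blast
    qed
    moreover have "sol (\<phi> ` A)"
      using sol_image[OF \<phi>(1) AB(1)] pset_superset(1)[OF AB] assms(1) by (auto simp: odd_sol_def)
    ultimately have "sol (\<phi> ` pset A B)" using sol_mono by blast
    then show ?thesis
      using sol_extension[OF \<phi>(1), of B] assms(2) \<phi>(2) by (auto simp: odd_sol_def)
  qed
  ultimately show ?thesis using P by (simp add: odd_sol_def)
qed

lemma hm_image_odd_sol:
  assumes "hm \<phi> G" "inj_on \<phi> G" "A \<subseteq> G" "odd_sol A" shows "odd_sol (\<phi> ` A)"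
proof -
  have "card (\<phi> ` A) = card A" using assms(2,3) by (meson card_image inj_on_subset)
  then show ?thesis
    using assms hm_image_sgrp[OF assms(1) _ assms(3)] sol_image[OF assms(1) _ assms(3)] by (simp add: odd_sol_def)
qed

lemma hm_image_pgrp:
  assumes "hm \<phi> G" "A \<subseteq> G" "pgrp q A" shows "pgrp q (\<phi> ` A)"
  unfolding pgrp_def
proof (intro conjI ballI)
  show "sgrp (\<phi> ` A)" using hm_image_sgrp[OF assms(1)] assms by (auto simp: pgrp_def)
  fix v assume "v \<in> \<phi> ` A"
  then obtain a where a: "a \<in> A" "v = \<phi> a" by blast
  then obtain i where "a ^ (q ^ i) = 1" using assms(3) by (auto simp: pgrp_def)
  then have "v ^ (q ^ i) = 1" using hm_power[OF assms(1), of a "q ^ i"] hm_one[OF assms(1)] a assms(2) by auto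
  then show "\<exists>a. v ^ (q ^ a) = 1" by blast
qed

text \<open>A maximal normal subgroup \<open>R\<close> with \<Phi> absorbs every other one
  \<open>A\<close>, because \<open>R A\<close> has \<Phi> too and so equals
  \<open>R\<close>.\<close>

lemma radical_ex:
  assumes G: "sgrp G" and triv: "\<Phi> {1}"
    and cl: "\<And>A B. \<lbrakk>nrm A G; nrm B G; \<Phi> A; \<Phi> B\<rbrakk> \<Longrightarrow> \<Phi> (pset A B)"
  obtains R where "nrm R G" "\<Phi> R" "\<And>A. \<lbrakk>nrm A G; \<Phi> A\<rbrakk> \<Longrightarrow> A \<subseteq> R"
proof -
  define \<M> where "\<M> = {A. nrm A G \<and> \<Phi> A}"
  have "\<M> \<subseteq> Pow G" using nrm_subset by (auto simp: \<M>_def)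
  then have fin: "finite \<M>" using sgrp_finite[OF G] finite_subset finite_Pow_iff by blast
  have "{1} \<in> \<M>" using triv G by (auto simp: \<M>_def intro!: nrmI)
  then obtain R where R: "R \<in> \<M>" "\<And>A. \<lbrakk>A \<in> \<M>; R \<subseteq> A\<rbrakk> \<Longrightarrow> R = A"
    using finite_has_maximal[OF fin] by blast
  show thesis
  proof (rule that[of R])
    fix A assume A: "nrm A G" "\<Phi> A"
    have s: "sgrp A" "sgrp R" using A R nrm_sgrp by (auto simp: \<M>_def)
    have "pset R A \<in> \<M>" using cl A R nrm_pset[OF G] by (auto simp: \<M>_def)
    then have "R = pset R A" using R(2) pset_superset(1)[OF s(2,1)] by blast
    then show "A \<subseteq> R" using pset_superset(2)[OF s(2,1)] by blast
  qed (use R in \<open>auto simp: \<M>_def\<close>)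
qed

lemma conj_hm: "sgrp G \<Longrightarrow> hm (\<lambda>x. g * x * inverse g) G"
  by (simp add: hm_def grp_simps)

text \<open>The \<Phi>-radical of \<open>M\<close> contains \<open>L\<close>; conjugation by
  elements of \<open>G\<close> induces automorphisms of \<open>M\<close> that preserve \<Phi>, so
  the radical is normal in all of \<open>G\<close>.\<close>

lemma normal_closure_ex:
  assumes G: "sgrp G" and M: "nrm M G" and L: "nrm L M" "\<Phi> L" and triv: "\<Phi> {1}"
    and cl: "\<And>A B. \<lbrakk>nrm A M; nrm B M; \<Phi> A; \<Phi> B\<rbrakk> \<Longrightarrow> \<Phi> (pset A B)"
    and im: "\<And>A g. \<lbrakk>nrm A M; \<Phi> A; g \<in> G\<rbrakk> \<Longrightarrow> \<Phi> ((\<lambda>x. g * x * inverse g) ` A)"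
  obtains N where "nrm N G" "\<Phi> N" "L \<subseteq> N" "N \<subseteq> M"
proof -
  have sM: "sgrp M" using nrm_sgrp M by blast
  obtain R where R: "nrm R M" "\<Phi> R" "\<And>A. \<lbrakk>nrm A M; \<Phi> A\<rbrakk> \<Longrightarrow> A \<subseteq> R"
    using radical_ex[OF sM, of \<Phi>] triv cl by metis
  have "nrm R G"
  proof (rule nrmI)
    show "sgrp R" using R nrm_sgrp by blast
    show "R \<subseteq> G" using R(1) M nrm_subset by blast
    fix g n assume g: "g \<in> G" "n \<in> R"
    define c where "c = (\<lambda>x. g * x * inverse g)"
    have "c ` M = M"
    proof
      show "c ` M \<subseteq> M" using nrm_conj[OF M] g by (auto simp: c_def)
      show "M \<subseteq> c ` M"
      proof
        fix x assume "x \<in> M"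
        then have "inverse g * x * g \<in> M" "x = c (inverse g * x * g)"
          using nrm_conj'[OF M G] g by (auto simp: c_def grp_simps)
        then show "x \<in> c ` M" by blast
      qed
    qed
    then have "nrm (c ` R) M" using hm_nrm_image[OF _ R(1), of c] conj_hm[OF sM] by (simp add: c_def)
    moreover have "\<Phi> (c ` R)" using im[OF R(1,2) g(1)] by (simp add: c_def)
    ultimately show "g * n * inverse g \<in> R" using R(3) g by (force simp: c_def)
  qed
  moreover have "L \<subseteq> R" using R(3) L by blast
  ultimately show thesis using that R nrm_subset by blast
qed

lemma odd_sol_normal_closure:
  assumes "sgrp G" "nrm M G" "nrm L M" "odd_sol L"
  obtains N where "nrm N G" "odd_sol N" "L \<subseteq> N" "N \<subseteq> M"
proof (rule normal_closure_ex[OF assms odd_sol_trivial])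
  have M: "sgrp M" using nrm_sgrp assms(2) by blast
  show "odd_sol (pset A B)" if "nrm A M" "nrm B M" "odd_sol A" "odd_sol B" for A B
    using that odd_sol_pset nrm_conj'[OF that(2) M] nrm_subset[OF that(1)] by blast
  show "odd_sol ((\<lambda>x. g * x * inverse g) ` A)" if "nrm A M" "odd_sol A" "g \<in> G" for A g
    by (rule hm_image_odd_sol[OF conj_hm[OF M]]) (use that nrm_subset in \<open>auto simp: inj_on_def\<close>)
qed

lemma pgrp2_normal_closure:
  assumes "sgrp G" "nrm M G" "nrm L M" "pgrp 2 L"
  obtains N where "nrm N G" "pgrp 2 N" "L \<subseteq> N" "N \<subseteq> M"
proof (rule normal_closure_ex[OF assms(1-3), of "pgrp 2", OF assms(4)])
  have M: "sgrp M" using nrm_sgrp assms(2) by blast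
  show "pgrp 2 {1::'a}" by (simp add: pgrp_def)
  show "pgrp 2 (pset A B)" if "nrm A M" "nrm B M" "pgrp 2 A" "pgrp 2 B" for A B
    using that pgrp2_pset nrm_conj'[OF that(2) M] nrm_subset[OF that(1)] by blast
  show "pgrp 2 ((\<lambda>x. g * x * inverse g) ` A)" if "nrm A M" "pgrp 2 A" "g \<in> G" for A g
    by (rule hm_image_pgrp[OF conj_hm[OF M]]) (use that nrm_subset in auto)
qed (rule that)

lemma pgrp2_radical_ex:
  assumes "sgrp G"
  obtains R where "nrm R G" "pgrp 2 R" "\<And>A. \<lbrakk>nrm A G; pgrp 2 A\<rbrakk> \<Longrightarrow> A \<subseteq> R"
proof (rule radical_ex[OF assms, of "pgrp 2"])
  show "pgrp 2 {1::'a}" by (simp add: pgrp_def)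
  show "pgrp 2 (pset A B)" if "nrm A G" "nrm B G" "pgrp 2 A" "pgrp 2 B" for A B
    using that pgrp2_pset nrm_conj'[OF that(2) assms] nrm_subset[OF that(1)] by blast
qed (rule that)

text \<open>The element \<open>z\<close> is the commutator of \<open>y\<close> and \<open>x\<close>.
  Collecting all \<open>x\<close> on the left of all \<open>y\<close> requires
  \<open>n * (n - 1) div 2\<close> transpositions, each of which leaves one
  \<open>z\<close>.\<close>

lemma power_mult_class2:
  fixes x y z :: "'a::grp"
  assumes yx: "y * x = z * (x * y)" and zx: "x * z = z * x" and zy: "y * z = z * y"
  shows "(x * y) ^ n = z ^ (n * (n - 1) div 2) * (x ^ n * y ^ n)"
proof -
  have pc: "u * z ^ k = z ^ k * u" if "u * z = z * u" for u k
    using power_commuting_commutes[OF that[symmetric], of k] by simp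
  have ynx: "y ^ k * x = z ^ k * (x * y ^ k)" for k
  proof (induction k)
    case (Suc k)
    have "y ^ Suc k * x = y * (z ^ k * (x * y ^ k))" using Suc by (simp add: mult.assoc)
    also have "\<dots> = z ^ k * ((y * x) * y ^ k)" using pc[OF zy] by (metis mult.assoc)
    also have "\<dots> = z ^ Suc k * (x * y ^ Suc k)" unfolding yx power_Suc2[of z] by (simp add: mult.assoc)
    finally show ?case .
  qed simp
  show ?thesis
  proof (induction n)
    case (Suc n)
    have xn: "x ^ n * z ^ n = z ^ n * x ^ n" by (rule pc[OF power_commuting_commutes[OF zx]])
    have t: "Suc n * (Suc n - 1) div 2 = n * (n - 1) div 2 + n"
      by (cases n) (auto simp: algebra_simps)
    have "(x * y) ^ Suc n = z ^ (n * (n - 1) div 2) * (x ^ n * (y ^ n * x) * y)"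
      unfolding power_Suc2 Suc by (simp add: mult.assoc)
    also have "\<dots> = z ^ (n * (n - 1) div 2) * ((x ^ n * z ^ n) * (x * y ^ n * y))"
      unfolding ynx by (simp add: mult.assoc)
    also have "\<dots> = z ^ (n * (n - 1) div 2 + n) * (x ^ n * x * (y ^ n * y))"
      unfolding xn by (simp add: mult.assoc power_add)
    finally show ?case unfolding t by (simp only: power_Suc2)
  qed simp
qed

text \<open>The generalised Fitting argument: for the first derived subgroup \<open>E\<close> of the centraliser
  that is not contained in \<open>N\<close>, a large power map is a homomorphism onto an odd normal subgroup.\<close>

lemma centralizer_2_radical:
  assumes G: "sgrp G" "sol G" and no_odd: "\<And>A. \<lbrakk>nrm A G; odd_sol A\<rbrakk> \<Longrightarrow> A = {1}"
    and N: "nrm N G" "pgrp 2 N" "\<And>A. \<lbrakk>nrm A G; pgrp 2 A\<rbrakk> \<Longrightarrow> A \<subseteq> N"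
    and c: "c \<in> G" "\<And>n. n \<in> N \<Longrightarrow> c * n = n * c"
  shows "c \<in> N"
proof (rule ccontr)
  assume cN: "c \<notin> N"
  define C where "C = {c \<in> G. \<forall>n\<in>N. c * n * inverse c = n}"
  have NG: "N \<subseteq> G" using nrm_subset N by blast
  have C: "nrm C G"
  proof (rule nrmI)
    show "sgrp C"
    proof (rule sgrpI)
      fix x y assume xy: "x \<in> C" "y \<in> C"
      have "x * y * n * inverse (x * y) = n" if "n \<in> N" for n
      proof -
        have "x * y * n * inverse (x * y) = x * (y * n * inverse y) * inverse x" by (simp add: grp_simps)
        then show ?thesis using xy that by (simp add: C_def)
      qed
      then show "x * y \<in> C" using xy G by (simp add: C_def)
    qed (use G in \<open>auto simp: C_def sgrp_finite\<close>)
    show "C \<subseteq> G" by (auto simp: C_def)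
    fix g x assume g: "g \<in> G" "x \<in> C"
    have "g * x * inverse g * n * inverse (g * x * inverse g) = n" if n: "n \<in> N" for n
    proof -
      have m: "inverse g * n * g \<in> N" using nrm_conj'[OF N(1) G(1) g(1) n] .
      have "g * x * inverse g * n * inverse (g * x * inverse g)
          = g * (x * (inverse g * n * g) * inverse x) * inverse g" by (simp add: grp_simps)
      also have "x * (inverse g * n * g) * inverse x = inverse g * n * g" using g m by (simp add: C_def)
      finally show ?thesis by (simp add: grp_simps)
    qed
    then show "g * x * inverse g \<in> C" using g G by (simp add: C_def)
  qed
  have "c * n * inverse c = n" if "n \<in> N" for n using c(2)[OF that] by (simp add: mult.assoc)
  then have "c \<in> C" using c by (simp add: C_def)
  define i where "i = (LEAST i. (der ^^ i) C \<subseteq> N)"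
  obtain k where "(der ^^ k) G \<subseteq> {1}" using G(2) by (auto simp: sol_def)
  then have "(der ^^ k) C \<subseteq> N" using der_pow_mono[OF nrm_subset[OF C], of k] nrm_sgrp[OF N(1)] by auto
  then have iN: "(der ^^ i) C \<subseteq> N" unfolding i_def by (rule LeastI)
  then have "i \<noteq> 0" using \<open>c \<in> C\<close> cN by (intro notI) auto
  then obtain j where j: "i = Suc j" using not0_implies_Suc by blast
  define E where "E = (der ^^ j) C"
  have E: "nrm E G" unfolding E_def by (rule der_pow_nrm[OF G(1) C])
  have EN: "\<not> E \<subseteq> N" unfolding E_def using not_less_Least[of j "\<lambda>i. (der ^^ i) C \<subseteq> N"] by (simp add: i_def[symmetric] j)
  have dE: "der E \<subseteq> N" using iN by (simp add: E_def j)
  have sE: "sgrp E" using E nrm_sgrp by blast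
  have EG: "E \<subseteq> G" using E nrm_subset by blast
  have EC: "E \<subseteq> C"
  proof -
    have "(der ^^ j) C \<subseteq> C" for j using der_subset nrm_sgrp[OF der_pow_nrm[OF G(1) C]] by (induction j) force+
    then show ?thesis by (simp add: E_def)
  qed
  have "card G \<noteq> 0" using G sgrp_finite by (metis card_0_eq empty_iff sgrp_one)
  then obtain b w where bw: "card G = 2 ^ b * w" "odd w"
    using multiplicity_decompose'[of "card G" 2] by (metis not_is_unit_0 odd_one two_is_prime_nat not_prime_unit)
  \<comment> \<open>One factor 2 more than the 2-part \<open>2 ^ b\<close> of the order of
    \<open>G\<close>, so that \<open>m * (m - 1) div 2\<close> is still a multiple of
    \<open>2 ^ b\<close> and kills every commutator \<open>z\<close> in the 2-group
    \<open>N\<close>.\<close>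
  define m where "m = (2::nat) ^ Suc b"
  \<comment> \<open>\<open>E\<close> centralises \<open>N\<close>, which contains the commutators of
    \<open>E\<close>; these are therefore central in \<open>E\<close>, and
    \<open>power_mult_class2\<close> applies.\<close>
  have mult: "(x * y) ^ m = x ^ m * y ^ m" if x: "x \<in> E" and y: "y \<in> E" for x y
  proof -
    define z where "z = y * x * inverse y * inverse x"
    have zN: "z \<in> N" using der_comm[OF y x] dE by (auto simp: z_def)
    have cz: "u * z = z * u" if "u \<in> E" for u
    proof -
      have "u * z * inverse u = z" using that EC zN by (auto simp: C_def)
      then have "u * z * inverse u * u = z * u" by simp
      then show ?thesis by (simp add: mult.assoc)
    qed
    have "y * x = z * (x * y)" by (simp add: z_def grp_simps)
    from power_mult_class2[OF this cz[OF x] cz[OF y]]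
    have f: "(x * y) ^ m = z ^ (m * (m - 1) div 2) * (x ^ m * y ^ m)" .
    obtain a where "z ^ (2 ^ a) = 1" using zN N(2) by (auto simp: pgrp_def)
    then have "(z ^ (2 ^ b)) ^ (2 ^ a) = 1" by (simp flip: power_mult) (simp add: mult.commute[of "2^b"] power_mult)
    moreover have "(z ^ (2 ^ b)) ^ w = 1"
      using power_card[OF G(1), of z] zN NG by (auto simp: bw power_mult)
    ultimately have "z ^ (2 ^ b) = 1" using coprime_powers_eq_one[of "z ^ (2 ^ b)" "2 ^ a" w] bw(2) by simp
    moreover have "m * (m - 1) div 2 = 2 ^ b * (m - 1)" by (simp add: m_def)
    ultimately show ?thesis using f by (simp add: power_mult)
  qed
  have hmm: "hm (\<lambda>x. x ^ m) E" using mult sE by (simp add: hm_def)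
  have "nrm ((\<lambda>x. x ^ m) ` E) G"
  proof (rule nrmI)
    show "sgrp ((\<lambda>x. x ^ m) ` E)" by (rule hm_image_sgrp[OF hmm sE]) simp
    show "(\<lambda>x. x ^ m) ` E \<subseteq> G" using EG G(1) by auto
    fix g n assume "g \<in> G" "n \<in> (\<lambda>x. x ^ m) ` E"
    then obtain x where x: "x \<in> E" "n = x ^ m" "g \<in> G" by auto
    then have "g * n * inverse g = (g * x * inverse g) ^ m" by (simp add: conj_power)
    then show "g * n * inverse g \<in> (\<lambda>x. x ^ m) ` E" using nrm_conj[OF E] x by blast
  qed
  moreover have "odd_sol ((\<lambda>x. x ^ m) ` E)"
    unfolding odd_sol_def
  proof (intro conjI)
    show s: "sgrp ((\<lambda>x. x ^ m) ` E)" by (rule hm_image_sgrp[OF hmm sE]) simp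
    show "odd (card ((\<lambda>x. x ^ m) ` E))"
    proof (rule odd_cardI[OF s])
      fix v assume "v \<in> (\<lambda>x. x ^ m) ` E"
      then obtain x where x: "x \<in> E" "v = x ^ m" by blast
      have "v ^ w = (x ^ card G) ^ 2" by (simp add: x bw m_def flip: power_mult) (simp add: ac_simps)
      then have "v ^ w = 1" using power_card[OF G(1)] x EG by auto
      then show "\<exists>n. odd n \<and> v ^ n = 1" using bw by blast
    qed
    show "sol ((\<lambda>x. x ^ m) ` E)" by (rule sol_mono[OF G(2)]) (use EG G(1) in auto)
  qed
  \<comment> \<open>The image is trivial, so \<open>E\<close> has exponent dividing
    \<open>m\<close>. It is then a normal 2-subgroup not contained in \<open>N\<close>, against the
    maximality of \<open>N\<close>.\<close>
  ultimately have "(\<lambda>x. x ^ m) ` E = {1}" using no_odd by blast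
  then have "x ^ (2 ^ Suc b) = 1" if "x \<in> E" for x using that by (auto simp: m_def)
  then have "pgrp 2 E" using sE unfolding pgrp_def by blast
  then show False using N(3)[OF E] EN by blast
qed

subsection \<open>The Baer--Suzuki theorem for involutions\<close>

text \<open>Since \<open>x\<close> inverts \<open>c = x * y\<close>, the powers of \<open>c\<close>
  and their products with \<open>x\<close> already form a group \<open>D\<close>, which is dihedral:
  its elements are rotations of 2-power order or reflections of order at most 2.\<close>

lemma pgrp2_dihedral:
  assumes G: "sgrp G" "x \<in> G" "y \<in> G" and x: "x * x = 1" and y: "y * y = 1" and xy: "(x * y) ^ (2 ^ a) = (1::'a::grp)"
  shows "pgrp 2 (gen {x, y})"
proof -
  define c where "c = x * y"
  define D where "D = range (\<lambda>i::nat. c ^ i) \<union> range (\<lambda>i::nat. c ^ i * x)"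
  have c: "c ^ (2 ^ a) = 1" "c \<in> G" using xy G by (auto simp: c_def)
  have ix: "inverse x = x" "inverse y = y" using x y by (metis inv_cancel(1) mult_1_right)+
  have xx: "x * (x * z) = z" for z by (simp add: x flip: mult.assoc)
  have xc: "x * c * x = inverse c" by (simp add: c_def ix xx grp_simps)
  have "inverse c * c ^ (2 ^ a) = inverse c" using c by simp
  then have inv_c: "inverse c = c ^ (2 ^ a - 1)" by (metis inv_cancel(1) power_Suc Suc_diff_1 zero_less_power pos2)
  have xci: "x * c ^ i = c ^ ((2 ^ a - 1) * i) * x" for i
  proof -
    have "(x * c * inverse x) ^ i = x * c ^ i * inverse x" by (rule conj_power)
    then have "x * c ^ i * x = inverse c ^ i" using xc ix by simp
    then have "x * c ^ i * x * x = c ^ ((2 ^ a - 1) * i) * x" by (simp add: inv_c power_mult)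
    then show ?thesis by (simp add: mult.assoc x)
  qed
  have D: "sgrp D"
  proof (rule sgrpI)
    show "finite D"
      by (rule finite_subset[of _ G]) (use G c sgrp_finite in \<open>auto simp: D_def\<close>)
    have "1 = c ^ 0" by simp
    then show "1 \<in> D" unfolding D_def by blast
    have 1: "c ^ i * c ^ j \<in> D" "c ^ i * (c ^ j * x) \<in> D" for i j
      unfolding D_def by (auto simp flip: power_add mult.assoc)
    have 2: "c ^ i * x * c ^ j \<in> D" "c ^ i * x * (c ^ j * x) \<in> D" for i j
    proof -
      have "c ^ i * x * c ^ j = c ^ i * (c ^ ((2 ^ a - 1) * j) * x)" using xci by (simp add: mult.assoc)
      then show "c ^ i * x * c ^ j \<in> D" using 1 by metis
      have "c ^ i * x * (c ^ j * x) = c ^ i * (x * c ^ j) * x" by (simp add: mult.assoc)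
      also have "\<dots> = c ^ i * c ^ ((2 ^ a - 1) * j)" unfolding xci by (simp add: mult.assoc x)
      finally show "c ^ i * x * (c ^ j * x) \<in> D" using 1 by metis
    qed
    show "u * v \<in> D" if "u \<in> D" "v \<in> D" for u v
    proof -
      from that obtain i j where "u = c ^ i \<or> u = c ^ i * x" "v = c ^ j \<or> v = c ^ j * x" by (auto simp: D_def)
      then show ?thesis using 1 2 by blast
    qed
  qed
  have "\<exists>k. v ^ (2 ^ k) = 1" if v: "v \<in> D" for v
  proof -
    from v consider i where "v = c ^ i" | i where "v = c ^ i * x" by (auto simp: D_def)
    then show ?thesis
    proof cases
      case 1
      then have "v ^ (2 ^ a) = 1" using c by (simp add: mult.commute[of i] power_mult flip: power_mult[of c i])
      then show ?thesis by blast
    next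
      case 2
      have "v * v = c ^ i * (x * c ^ i * inverse x)" by (simp add: 2 mult.assoc ix)
      also have "x * c ^ i * inverse x = inverse c ^ i" using conj_power[of x c i] xc ix by simp
      finally have "v ^ (2 ^ 1) = 1" by (simp add: power_inverse power2_eq_square)
      then show ?thesis by blast
    qed
  qed
  then have pD: "pgrp 2 D" using D by (simp add: pgrp_def)
  have "c ^ 0 * x = x" "c ^ (2 ^ a - 1) * x = y"
    unfolding inv_c[symmetric] by (simp, simp add: c_def ix inv_mult mult.assoc x)
  moreover have "c ^ i * x \<in> D" for i by (simp add: D_def)
  ultimately have xyD: "{x, y} \<subseteq> D" by (metis insert_subset empty_subsetI)
  show ?thesis by (rule pgrp_subset[OF pD sgrp_gen[OF D xyD] gen_least[OF D xyD]])
qed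

lemma conj_gen:
  assumes "sgrp G" "S \<subseteq> G" "g \<in> G" "\<And>s. s \<in> S \<Longrightarrow> g * s * inverse g \<in> S" "x \<in> gen S"
  shows "g * x * inverse g \<in> gen S"
  using assms(5,1,2)
proof (induction rule: gen_induct)
  case (mult x y)
  have "g * (x * y) * inverse g = (g * x * inverse g) * (g * y * inverse g)" by (simp add: grp_simps)
  then show ?case using mult sgrp_gen[OF assms(1,2)] by simp
qed (use assms gen_incl sgrp_gen[OF assms(1,2)] in auto)

lemma finite_ex_max:
  fixes f :: "'b \<Rightarrow> nat"
  assumes "finite P" "P \<noteq> {}" shows "\<exists>p\<in>P. \<forall>p'\<in>P. f p' \<le> f p"
proof -
  have "Max (f ` P) \<in> f ` P" using assms by (intro Max_in) auto
  then obtain p where "p \<in> P" "f p = Max (f ` P)" by force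
  then show ?thesis using assms by (intro bexI[of _ p]) auto
qed

text \<open>If the claim fails, there are distinct maximal subsets \<open>C\<close>,
  \<open>D\<close> of \<open>T\<close> generating 2-groups; choose them with intersection
  \<open>I\<close> as large as possible. Growth of normalisers gives \<open>x\<close> in
  \<open>C - I\<close> and \<open>y\<close> in \<open>D - I\<close> that normalise \<open>I\<close>.
  The dihedral 2-group generated by \<open>x\<close> and \<open>y\<close> normalises the 2-group
  generated by \<open>I\<close>, so \<open>I\<close>, \<open>x\<close> and \<open>y\<close> lie in
  one maximal subset \<open>E\<close>. It meets both \<open>C\<close> and \<open>D\<close> in more
  than \<open>I\<close>, so \<open>E = C\<close> and \<open>E = D\<close>.\<close>

theorem baer_suzuki_involutions:
  fixes T :: "'a::grp set"
  assumes G: "sgrp G" "T \<subseteq> G" and inv: "\<And>t. t \<in> T \<Longrightarrow> t * t = 1"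
    and nT: "\<And>s t. \<lbrakk>s \<in> T; t \<in> T\<rbrakk> \<Longrightarrow> s * t * inverse s \<in> T"
    and two: "\<And>s t. \<lbrakk>s \<in> T; t \<in> T\<rbrakk> \<Longrightarrow> \<exists>a. (s * t) ^ (2 ^ a) = 1"
  shows "pgrp 2 (gen T)"
proof (rule ccontr)
  assume bad: "\<not> pgrp 2 (gen T)"
  have fT: "finite T" using G sgrp_finite finite_subset by blast
  define \<M> where "\<M> = {D. D \<subseteq> T \<and> pgrp 2 (gen D)}"
  have fM: "finite \<M>" using fT by (auto simp: \<M>_def)
  define mx where "mx = (\<lambda>D. D \<in> \<M> \<and> (\<forall>D'\<in>\<M>. D \<subseteq> D' \<longrightarrow> D = D'))"
  have ext: "\<exists>D. mx D \<and> A \<subseteq> D" if "A \<in> \<M>" for A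
    using finite_has_maximal2[OF fM that] by (auto simp: mx_def)
  have single: "{t} \<in> \<M>" if t: "t \<in> T" for t
  proof -
    have "pgrp 2 (gen {t, t})"
      by (rule pgrp2_dihedral[OF G(1), of _ _ 0]) (use t G inv in auto)
    then show ?thesis using t by (simp add: \<M>_def)
  qed
  have sg: "sgrp (gen D)" if "D \<subseteq> T" for D using sgrp_gen[OF G(1)] that G by blast
  have gG: "gen D \<subseteq> G" if "D \<subseteq> T" for D using gen_least[OF G(1)] that G by blast
  have full: "T \<inter> gen D = D" if "mx D" for D
  proof -
    have D: "D \<subseteq> T" "pgrp 2 (gen D)" using that by (auto simp: mx_def \<M>_def)
    have "gen (T \<inter> gen D) \<subseteq> gen D" by (rule gen_least[OF sg[OF D(1)]]) blast
    then have "pgrp 2 (gen (T \<inter> gen D))" using pgrp_subset[OF D(2) sg] by blast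
    then have "T \<inter> gen D \<in> \<M>" by (simp add: \<M>_def)
    moreover have "D \<subseteq> T \<inter> gen D" using D gen_incl by blast
    ultimately show ?thesis using that by (auto simp: mx_def)
  qed
  have grow: "\<exists>x\<in>D - I. \<forall>i\<in>I. x * i * inverse x \<in> I" if D: "mx D" and I: "I = T \<inter> gen I" "I \<subset> D" for D I
  proof -
    define V where "V = gen D"
    have DT: "D \<subseteq> T" and V: "pgrp 2 V" using D by (auto simp: mx_def \<M>_def V_def)
    have sV: "sgrp V" using V by (simp add: pgrp_def)
    \<comment> \<open>Growth is needed inside \<open>T\<close> and not just in \<open>gen D\<close>.
      So \<open>W\<close> is chosen maximal among the subgroups whose trace on \<open>T\<close> is
      exactly \<open>I\<close>; the larger normaliser of \<open>W\<close> then has a larger trace,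
      and its elements in \<open>T\<close> normalise \<open>I\<close>.\<close>
    define \<W> where "\<W> = {W. sgrp W \<and> W \<subseteq> V \<and> T \<inter> W = I}"
    have fW: "finite \<W>" by (rule finite_subset[of _ "Pow V"]) (use sgrp_finite[OF sV] in \<open>auto simp: \<W>_def\<close>)
    have "gen I \<in> \<W>"
    proof -
      have "gen I \<subseteq> V" unfolding V_def by (rule gen_mono) (use I in blast)
      moreover have "sgrp (gen I)" by (rule sg) (use I DT in blast)
      ultimately show ?thesis using I(1)[symmetric] by (simp add: \<W>_def)
    qed
    then obtain W where W: "W \<in> \<W>" "\<And>W'. \<lbrakk>W' \<in> \<W>; W \<subseteq> W'\<rbrakk> \<Longrightarrow> W = W'"
      using finite_has_maximal2[OF fW] by metis
    have TV: "T \<inter> V = D" using full[OF D] by (simp add: V_def)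
    have sW: "sgrp W" "W \<subset> V" using W(1) TV I by (auto simp: \<W>_def)
    define W' where "W' = normalizer_in V W"
    have sW': "sgrp W'" "W' \<subseteq> V" using sgrp_normalizer_in[OF sV] by (auto simp: W'_def normalizer_in_def)
    obtain b where b: "b \<in> V - W" "\<forall>u\<in>W. b * u * inverse b \<in> W"
      using conjunct1[OF pgrp_fix_growth[OF two_is_prime_nat V], rule_format, OF sW] by blast
    have WW': "W \<subset> W'" using b sW by (auto simp: W'_def normalizer_in_def)
    then have "T \<inter> W' \<noteq> I" using W(2)[of W'] sW' by (auto simp: \<W>_def)
    moreover have "I \<subseteq> T \<inter> W'" using W(1) WW' by (auto simp: \<W>_def)
    ultimately obtain x where x: "x \<in> T" "x \<in> W'" "x \<notin> I" by blast
    have "x * i * inverse x \<in> I" if "i \<in> I" for i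
    proof -
      have "i \<in> W" "i \<in> T" using that W(1) by (auto simp: \<W>_def)
      then have "x * i * inverse x \<in> T \<inter> W" using x nT by (auto simp: W'_def normalizer_in_def)
      then show ?thesis using W(1) unfolding \<W>_def by blast
    qed
    moreover have "x \<in> D" using TV x sW' by blast
    ultimately show ?thesis using x by blast
  qed
  have "T \<noteq> {}"
  proof
    assume "T = {}"
    then have "gen T \<subseteq> {1}" by (intro gen_least) auto
    then have "gen T = {1}" using sg[of T] by force
    then show False using bad by (simp add: pgrp_def)
  qed
  then obtain t0 where t0: "t0 \<in> T" by blast
  obtain A where A: "mx A" "{t0} \<subseteq> A" using ext[OF single[OF t0]] by blast
  have "A \<noteq> T" using A bad by (auto simp: mx_def \<M>_def)
  then obtain t1 where t1: "t1 \<in> T" "t1 \<notin> A" using A by (auto simp: mx_def \<M>_def)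
  obtain B where B: "mx B" "{t1} \<subseteq> B" using ext[OF single[OF t1(1)]] by blast
  define \<P> where "\<P> = {(C, D). mx C \<and> mx D \<and> C \<noteq> D}"
  have "(A, B) \<in> \<P>" using A B t1 by (auto simp: \<P>_def)
  moreover have "finite \<P>" by (rule finite_subset[of _ "\<M> \<times> \<M>"]) (use fM in \<open>auto simp: \<P>_def mx_def\<close>)
  ultimately have "\<exists>p\<in>\<P>. \<forall>p'\<in>\<P>. card (fst p' \<inter> snd p') \<le> card (fst p \<inter> snd p)"
    by (intro finite_ex_max) auto
  then obtain p where p: "p \<in> \<P>" "\<And>p'. p' \<in> \<P> \<Longrightarrow> card (fst p' \<inter> snd p') \<le> card (fst p \<inter> snd p)"
    by blast
  obtain C D where CD: "p = (C, D)" "mx C" "mx D" "C \<noteq> D" using p(1) by (auto simp: \<P>_def)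
  define I where "I = C \<inter> D"
  have CT: "C \<subseteq> T" "D \<subseteq> T" using CD by (auto simp: mx_def \<M>_def)
  have fin: "finite C" "finite D" using CT fT finite_subset by blast+
  have "I \<subset> C" "I \<subset> D" using CD by (auto simp: I_def mx_def)
  have "gen I \<subseteq> gen C" "gen I \<subseteq> gen D" unfolding I_def by (rule gen_mono, simp)+
  then have "T \<inter> gen I \<subseteq> I" using full[OF CD(2)] full[OF CD(3)] by (auto simp: I_def)
  moreover have "I \<subseteq> T \<inter> gen I" using gen_incl[of I] CT by (auto simp: I_def)
  ultimately have II: "I = T \<inter> gen I" by blast
  obtain x where x: "x \<in> C - I" "\<And>i. i \<in> I \<Longrightarrow> x * i * inverse x \<in> I" using grow[OF CD(2) II \<open>I \<subset> C\<close>] by blast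
  obtain y where y: "y \<in> D - I" "\<And>i. i \<in> I \<Longrightarrow> y * i * inverse y \<in> I" using grow[OF CD(3) II \<open>I \<subset> D\<close>] by blast
  have xyG: "x \<in> G" "y \<in> G" "x \<in> T" "y \<in> T" using x y CT G by auto
  have IG: "I \<subseteq> G" "I \<subseteq> T" using CT G by (auto simp: I_def)
  obtain a where a: "(x * y) ^ (2 ^ a) = 1" using two xyG by blast
  define P where "P = gen {x, y}"
  have P: "pgrp 2 P" unfolding P_def by (rule pgrp2_dihedral[OF G(1) xyG(1,2) _ _ a]) (use inv xyG in auto)
  have sP: "sgrp P" using P by (simp add: pgrp_def)
  have "P \<subseteq> normalizer_in G (gen I)"
    unfolding P_def
  proof (rule gen_least[OF sgrp_normalizer_in[OF G(1)]])
    show "{x, y} \<subseteq> normalizer_in G (gen I)"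
      using conj_gen[OF G(1) IG(1) xyG(1) x(2)] conj_gen[OF G(1) IG(1) xyG(2) y(2)] xyG
      by (auto simp: normalizer_in_def)
  qed
  then have nI: "inverse a * b * a \<in> gen I" if "a \<in> P" "b \<in> gen I" for a b
    using sgrp_inv[OF sP that(1)] that(2) by (force simp: normalizer_in_def)
  have pI: "pgrp 2 (gen I)"
    using CD(2) pgrp_subset[of 2 "gen C"] sg[OF IG(2)] \<open>gen I \<subseteq> gen C\<close> by (auto simp: mx_def \<M>_def)
  have Q: "pgrp 2 (pset P (gen I))" by (rule pgrp2_pset[OF P pI nI])
  have sI: "sgrp (gen I)" using pI by (simp add: pgrp_def)
  have "insert x (insert y I) \<subseteq> pset P (gen I)"
    using pset_superset[OF sP sI] gen_incl[of I] gen_incl[of "{x, y}"] by (auto simp: P_def)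
  moreover have "sgrp (pset P (gen I))" using Q by (simp add: pgrp_def)
  ultimately have "gen (insert x (insert y I)) \<subseteq> pset P (gen I)" using gen_least by blast
  moreover have "sgrp (gen (insert x (insert y I)))" by (rule sg) (use xyG IG in auto)
  ultimately have "pgrp 2 (gen (insert x (insert y I)))" using pgrp_subset[OF Q] by blast
  then have "insert x (insert y I) \<in> \<M>" using xyG IG by (simp add: \<M>_def)
  then obtain E where E: "mx E" "insert x (insert y I) \<subseteq> E" using ext by blast
  have "E = C"
  proof (rule ccontr)
    assume "E \<noteq> C"
    then have "(E, C) \<in> \<P>" using E CD by (simp add: \<P>_def)
    from p(2)[OF this] have "card (E \<inter> C) \<le> card I" by (simp add: CD(1) I_def)
    moreover have "insert x I \<subseteq> E \<inter> C" using E x \<open>I \<subset> C\<close> by auto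
    then have "card (insert x I) \<le> card (E \<inter> C)" using fin by (intro card_mono) auto
    moreover have "card (insert x I) = Suc (card I)" using x fin by (intro card_insert_disjoint) (auto simp: I_def)
    ultimately show False by simp
  qed
  moreover have "E = D"
  proof (rule ccontr)
    assume "E \<noteq> D"
    then have "(E, D) \<in> \<P>" using E CD by (simp add: \<P>_def)
    from p(2)[OF this] have "card (E \<inter> D) \<le> card I" by (simp add: CD(1) I_def)
    moreover have "insert y I \<subseteq> E \<inter> D" using E y \<open>I \<subset> D\<close> by auto
    then have "card (insert y I) \<le> card (E \<inter> D)" using fin by (intro card_mono) auto
    moreover have "card (insert y I) = Suc (card I)" using y fin by (intro card_insert_disjoint) (auto simp: I_def)
    ultimately show False by simp
  qed
  ultimately show False using CD(4) by simp
qed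

section \<open>Folders\<close>

text \<open>If \<open>K\<close> belongs to a subloop, \<open>dl H K\<close> belongs to its smallest normal subloop
  whose quotient is an abelian group.\<close>

definition dl :: "'a::grp set \<Rightarrow> 'a set \<Rightarrow> 'a set" where
  "dl H K = K \<inter> gen ((H \<inter> gen K) \<union> comms (gen K))"

definition lsol :: "'a::grp set \<Rightarrow> 'a set \<Rightarrow> bool" where
  "lsol H K \<longleftrightarrow> (\<exists>n. (dl H ^^ n) K \<subseteq> {1})"

lemma dl_subset: "dl H K \<subseteq> K"
  by (simp add: dl_def)

lemma dl_mono: assumes "K \<subseteq> K'" shows "dl H K \<subseteq> dl H K'"
proof -
  have "gen K \<subseteq> gen K'" by (rule gen_mono[OF assms])
  then have "(H \<inter> gen K) \<union> comms (gen K) \<subseteq> (H \<inter> gen K') \<union> comms (gen K')"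
    using comms_mono by blast
  then show ?thesis unfolding dl_def using assms gen_mono by blast
qed

lemma dl_pow_mono: "K \<subseteq> K' \<Longrightarrow> (dl H ^^ n) K \<subseteq> (dl H ^^ n) K'"
  by (induction n) (simp_all add: dl_mono)

lemma dl_pow_subset: "(dl H ^^ n) K \<subseteq> K"
  using dl_subset by (induction n) force+

lemma lsol_mono: "\<lbrakk>lsol H K'; K \<subseteq> K'\<rbrakk> \<Longrightarrow> lsol H K"
  unfolding lsol_def using dl_pow_mono by blast

lemma lsol_dl: assumes "lsol H (dl H K)" shows "lsol H K"
proof -
  obtain n where "(dl H ^^ n) (dl H K) \<subseteq> {1}" using assms by (auto simp: lsol_def)
  then have "(dl H ^^ Suc n) K \<subseteq> {1}" by (simp add: funpow_swap1)
  then show ?thesis unfolding lsol_def by blast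
qed

lemma lsol_trivial: "K \<subseteq> {1} \<Longrightarrow> lsol H K"
  unfolding lsol_def by (rule exI[of _ 0]) simp

lemma lsol_dl_proper: assumes "lsol H K" "\<not> K \<subseteq> {1}" shows "dl H K \<noteq> K"
proof
  assume e: "dl H K = K"
  have "(dl H ^^ n) K = K" for n by (induction n) (auto simp: e)
  then show False using assms by (auto simp: lsol_def)
qed

lemma dl_local: "gen K \<subseteq> L \<Longrightarrow> dl (H \<inter> L) K = dl H K"
  by (simp add: dl_def Int_assoc Int_absorb1)

lemma dl_pow_local: assumes "gen K \<subseteq> L" shows "(dl (H \<inter> L) ^^ n) K = (dl H ^^ n) K"
proof (induction n)
  case (Suc n)
  have "gen ((dl H ^^ n) K) \<subseteq> L" using gen_mono[OF dl_pow_subset] assms by blast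
  then show ?case using Suc dl_local by simp
qed simp

lemma lsol_local: "gen K \<subseteq> L \<Longrightarrow> lsol (H \<inter> L) K \<longleftrightarrow> lsol H K"
  by (simp add: lsol_def dl_pow_local)

lemma hm_dl:
  assumes "hm \<phi> G" "K \<subseteq> G" shows "\<phi> ` dl H K \<subseteq> dl (\<phi> ` H) (\<phi> ` K)"
proof -
  have G: "sgrp G" using assms by (simp add: hm_def)
  have gG: "gen K \<subseteq> G" by (rule gen_least[OF G assms(2)])
  have sub: "(H \<inter> gen K) \<union> comms (gen K) \<subseteq> G" using gG comms_subset[OF sgrp_gen[OF G assms(2)]] by blast
  have "\<phi> ` ((H \<inter> gen K) \<union> comms (gen K)) \<subseteq> (\<phi> ` H \<inter> gen (\<phi> ` K)) \<union> comms (gen (\<phi> ` K))"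
    unfolding hm_gen[OF assms] hm_comms[OF assms(1) gG] by auto
  then have "\<phi> ` gen ((H \<inter> gen K) \<union> comms (gen K)) \<subseteq> gen ((\<phi> ` H \<inter> gen (\<phi> ` K)) \<union> comms (gen (\<phi> ` K)))"
    unfolding hm_gen[OF assms(1) sub, symmetric] by (rule gen_mono)
  then show ?thesis unfolding dl_def by blast
qed

lemma hm_dl_pow:
  assumes "hm \<phi> G" "K \<subseteq> G" shows "\<phi> ` (dl H ^^ n) K \<subseteq> (dl (\<phi> ` H) ^^ n) (\<phi> ` K)"
proof (induction n)
  case (Suc n)
  have "(dl H ^^ n) K \<subseteq> G" using dl_pow_subset assms by blast
  from hm_dl[OF assms(1) this] show ?case using dl_mono[OF Suc] by simp blast
qed simp

lemma lsol_extension: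
  assumes "hm \<phi> G" "K \<subseteq> G" "lsol (\<phi> ` H) (\<phi> ` K)" "lsol H K'" "\<And>k. \<lbrakk>k \<in> K; \<phi> k = 1\<rbrakk> \<Longrightarrow> k \<in> K'"
  shows "lsol H K"
proof -
  obtain n where "(dl (\<phi> ` H) ^^ n) (\<phi> ` K) \<subseteq> {1}" using assms(3) by (auto simp: lsol_def)
  then have "(dl H ^^ n) K \<subseteq> K'" using hm_dl_pow[OF assms(1,2), of n H] assms(5) dl_pow_subset[of n H K] by blast
  moreover obtain m where "(dl H ^^ m) K' \<subseteq> {1}" using assms(4) by (auto simp: lsol_def)
  ultimately have "(dl H ^^ (m + n)) K \<subseteq> {1}"
    using dl_pow_mono[of "(dl H ^^ n) K" K' m H] by (simp add: funpow_add)
  then show ?thesis unfolding lsol_def by blast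
qed

text \<open>\<open>G\<close>, \<open>H\<close> and \<open>K\<close> are the enveloping group, the inner mapping group and the set of right
  multiplications of a loop. That \<open>K\<close> is a transversal to all conjugates of \<open>H\<close> amounts to \<open>fac\<close> and
  \<open>sharp\<close>; the Bol identity is \<open>tw\<close>, the \<open>A\<^sub>r\<close> property is \<open>Ar\<close>.\<close>

locale folder =
  fixes G H K :: "'a::grp set"
  assumes sG: "sgrp G" and sH: "sgrp H" and HG: "H \<subseteq> G" and KG: "K \<subseteq> G" and gK: "gen K = G"
    and oneK: "1 \<in> K"
    and tw: "\<lbrakk>k \<in> K; l \<in> K\<rbrakk> \<Longrightarrow> k * l * k \<in> K"
    and fac: "\<lbrakk>k \<in> K; l \<in> K\<rbrakk> \<Longrightarrow> \<exists>h\<in>H. \<exists>m\<in>K. k * l = h * m"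
    and sharp: "\<lbrakk>k \<in> K; l \<in> K; g \<in> G; g * k * inverse l * inverse g \<in> H\<rbrakk> \<Longrightarrow> k = l"
    and Ar: "\<lbrakk>h \<in> H; k \<in> K\<rbrakk> \<Longrightarrow> h * k * inverse h \<in> K"
begin

lemma powK: "k \<in> K \<Longrightarrow> k ^ n \<in> K"
proof (induction n rule: less_induct)
  case (less n)
  consider "n = 0" | "n = 1" | m where "n = Suc (Suc m)" by (metis One_nat_def not0_implies_Suc)
  then show ?case
  proof cases
    case 3
    then have "k ^ n = k * k ^ m * k" by (simp add: power_commutes mult.assoc)
    then show ?thesis using less 3 tw by simp
  qed (use less oneK in auto)
qed

lemma invK: assumes "k \<in> K" shows "inverse k \<in> K"
proof -
  have c: "card G \<noteq> 0" using sgrp_finite[OF sG] sG by (metis card_0_eq empty_iff sgrp_one)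
  have "k ^ card G = 1" using power_card[OF sG] assms KG by blast
  then have "k * k ^ (card G - 1) = 1" using c by (cases "card G") auto
  then have "inverse k = k ^ (card G - 1)" by (metis inv_cancel(1) mult_1_right)
  then show ?thesis using powK assms by simp
qed

text \<open>The set \<open>H K\<close> is closed under products: \<open>Ar\<close> moves an element
  of \<open>H\<close> to the left past an element of \<open>K\<close>, and \<open>fac\<close>
  rewrites the remaining product of two elements of \<open>K\<close>.\<close>

lemma factor: assumes "g \<in> G" shows "\<exists>h\<in>H. \<exists>m\<in>K. g = h * m"
proof -
  have "g \<in> gen K" using assms gK by simp
  from this sG KG show ?thesis
  proof (induction rule: gen_induct)
    case one
    show ?case using sH oneK by (metis mult_1_left sgrp_one)
  next
    case (incl s)
    then show ?case using sH by (metis mult_1_left sgrp_one)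
  next
    case (mult x y)
    then obtain h m h' m' where *: "h \<in> H" "m \<in> K" "x = h * m" "h' \<in> H" "m' \<in> K" "y = h' * m'" by blast
    have "inverse h' * m * h' \<in> K" using Ar[of "inverse h'" m] * sH by simp
    then obtain h2 m2 where 2: "h2 \<in> H" "m2 \<in> K" "(inverse h' * m * h') * m' = h2 * m2" using fac * by blast
    have "x * y = h * h' * ((inverse h' * m * h') * m')" by (simp add: * grp_simps)
    also have "\<dots> = (h * h' * h2) * m2" unfolding 2(3) by (simp only: mult.assoc)
    finally show ?case using * 2 sH by (metis sgrp_mult)
  qed
qed

lemma sharp1: "\<lbrakk>k \<in> K; l \<in> K; k * inverse l \<in> H\<rbrakk> \<Longrightarrow> k = l"
  using sharp[of k l 1] sG by simp

lemma HK1: "\<lbrakk>k \<in> K; k \<in> H\<rbrakk> \<Longrightarrow> k = 1"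
  using sharp1[of k 1] oneK by simp

lemma inH_K: "\<lbrakk>h \<in> H; k \<in> K; h * k \<in> K\<rbrakk> \<Longrightarrow> h = 1"
  using sharp1[of "h * k" k] by (metis mult.assoc right_inv mult_1_right mult_1_left mult_right_cancel)

text \<open>The induction goes in steps of two, because \<open>tw\<close> only yields palindromic
  products: passing from \<open>m\<close> to \<open>m + 2\<close> surrounds the element
  \<open>inverse k * (k * inverse l) ^ m\<close> of \<open>K\<close> first by \<open>k\<close> and
  then by \<open>inverse l\<close>.\<close>

lemma quotient_power: assumes "k \<in> K" "l \<in> K" shows "\<exists>l'\<in>K. (k * inverse l) ^ j = k * inverse l'"
proof -
  have "inverse k * (k * inverse l) ^ j \<in> K"
  proof (induction j rule: less_induct)
    case (less j)
    consider "j = 0" | "j = 1" | m where "j = Suc (Suc m)" by (metis One_nat_def not0_implies_Suc)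
    then show ?case
    proof cases
      case 3
      have "inverse k * (k * inverse l) ^ j = inverse l * (k * (inverse k * (k * inverse l) ^ m) * k) * inverse l"
        by (simp add: 3 mult.assoc power_commutes)
      moreover have "inverse l * (k * (inverse k * (k * inverse l) ^ m) * k) * inverse l \<in> K"
        using less[of m] 3 by (intro tw invK assms) auto
      ultimately show ?thesis by (simp only:)
    qed (use assms invK in \<open>auto simp: mult.assoc\<close>)
  qed
  then have "inverse (inverse k * (k * inverse l) ^ j) \<in> K" by (rule invK)
  then show ?thesis by (rule bexI[rotated]) (simp add: grp_simps)
qed

text \<open>In the action on the cosets of \<open>H\<close>, a nontrivial power of
  \<open>k * inverse l\<close> fixes no coset. Contradictions are reached later by conjugating such
  a power into \<open>H\<close>.\<close>

lemma semiregular: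
  assumes "k \<in> K" "l \<in> K" "g \<in> G" "g * (k * inverse l) ^ j * inverse g \<in> H" shows "(k * inverse l) ^ j = 1"
proof -
  obtain l' where l': "l' \<in> K" "(k * inverse l) ^ j = k * inverse l'" using quotient_power assms by blast
  then have "k = l'" using sharp[of k l' g] assms by (simp add: mult.assoc)
  then show ?thesis using l' by simp
qed

lemma dl_eq: "dl H K = K \<inter> gen (H \<union> comms G)"
  using HG by (simp add: dl_def gK Int_absorb2)

text \<open>The subgroup \<open>H G'\<close>. It is normal, and \<open>G / dhull\<close> is the
  largest abelian quotient of \<open>G\<close> that kills \<open>H\<close>.\<close>

definition dhull :: "'a set" where "dhull = gen (H \<union> comms G)"

lemma dhull: "sgrp dhull" "H \<subseteq> dhull" "comms G \<subseteq> dhull" "dhull \<subseteq> G"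
proof -
  have "H \<union> comms G \<subseteq> G" using HG comms_subset[OF sG] by blast
  then show "sgrp dhull" "H \<subseteq> dhull" "comms G \<subseteq> dhull" "dhull \<subseteq> G"
    using sgrp_gen[OF sG, of "H \<union> comms G"] gen_least[OF sG, of "H \<union> comms G"] gen_incl[of "H \<union> comms G"]
    by (simp_all add: dhull_def)
qed

lemma nrm_comms: assumes "sgrp M" "comms G \<subseteq> M" "M \<subseteq> G" shows "nrm M G"
proof (rule nrmI)
  fix g n assume "g \<in> G" "n \<in> M"
  then have "g * n * inverse g * inverse n \<in> M" using commsI[of g G n] assms by blast
  then have "(g * n * inverse g * inverse n) * n \<in> M" using \<open>n \<in> M\<close> assms(1) by (rule sgrp_mult[rotated])
  then show "g * n * inverse g \<in> M" by (simp add: mult.assoc)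
qed (use assms in auto)

lemma dl_hull: "dl H K = K \<inter> dhull"
  by (simp add: dl_eq dhull_def)

lemma subfolder_factor:
  assumes "sgrp A" "H \<subseteq> A" "A \<subseteq> G" "a \<in> A" shows "\<exists>h\<in>H. \<exists>m\<in>K \<inter> A. a = h * m"
proof -
  obtain h m where hm: "h \<in> H" "m \<in> K" "a = h * m" using factor assms by blast
  then have "m = inverse h * a" by simp
  moreover have "inverse h \<in> A" using hm assms(1,2) by (simp add: subset_iff)
  ultimately have "m \<in> A" using assms by simp
  then show ?thesis using hm by blast
qed

lemma subfolder:
  assumes A: "sgrp A" "H \<subseteq> A" "A \<subseteq> G"
  shows "folder (gen (K \<inter> A)) (H \<inter> gen (K \<inter> A)) (K \<inter> A)"
proof -
  have KA: "K \<inter> A \<subseteq> A" by blast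
  have L: "sgrp (gen (K \<inter> A))" "gen (K \<inter> A) \<subseteq> A" using sgrp_gen[OF A(1) KA] gen_least[OF A(1) KA] by auto
  have kL: "k \<in> gen (K \<inter> A)" if "k \<in> K" "k \<in> A" for k using that gen_incl by blast
  show ?thesis
  proof
    fix k l assume k: "k \<in> K \<inter> A" and l: "l \<in> K \<inter> A"
    show "k * l * k \<in> K \<inter> A" using k l tw A by auto
    have "k * l \<in> A" using k l A by auto
    then obtain h m where hm: "h \<in> H" "m \<in> K \<inter> A" "k * l = h * m" using subfolder_factor[OF A] by blast
    have "h = k * l * inverse m" using hm by (simp add: mult.assoc)
    moreover have "k \<in> gen (K \<inter> A)" "l \<in> gen (K \<inter> A)" "m \<in> gen (K \<inter> A)" using k l hm kL by auto
    ultimately have "h \<in> gen (K \<inter> A)" by (simp only:) (simp add: L)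
    then show "\<exists>h\<in>H \<inter> gen (K \<inter> A). \<exists>m\<in>K \<inter> A. k * l = h * m" using hm by blast
    fix g assume "g \<in> gen (K \<inter> A)" "g * k * inverse l * inverse g \<in> H \<inter> gen (K \<inter> A)"
    then show "k = l" using sharp[of k l g] k l L A by blast
  next
    fix h k assume "h \<in> H \<inter> gen (K \<inter> A)" "k \<in> K \<inter> A"
    then show "h * k * inverse h \<in> K \<inter> A" using Ar L A by auto
  qed (use L gen_incl[of "K \<inter> A"] oneK A sH sgrp_Int[OF sH L(1)] in auto)
qed

text \<open>\<open>H\<close> normalises \<open>K \<inter> A\<close> by \<open>Ar\<close>, and
  \<open>A = H (K \<inter> A)\<close>.\<close>

lemma subfolder_nrm:
  assumes A: "sgrp A" "H \<subseteq> A" "A \<subseteq> G" shows "nrm (gen (K \<inter> A)) A"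
proof (rule nrm_gen[OF A(1)])
  have KA: "K \<inter> A \<subseteq> A" by blast
  have L: "sgrp (gen (K \<inter> A))" "gen (K \<inter> A) \<subseteq> A" using sgrp_gen[OF A(1) KA] gen_least[OF A(1) KA] by auto
  fix g s assume "g \<in> A" "s \<in> K \<inter> A"
  moreover then obtain h m where hm: "h \<in> H" "m \<in> K \<inter> A" "g = h * m" using subfolder_factor[OF A] by blast
  moreover have "h * m * inverse h \<in> K \<inter> A" "h * s * inverse h \<in> K \<inter> A" using calculation Ar A by auto
  then have "h * m * inverse h \<in> gen (K \<inter> A)" "h * s * inverse h \<in> gen (K \<inter> A)" using gen_incl by blast+
  then have "(h * m * inverse h) * (h * s * inverse h) * inverse (h * m * inverse h) \<in> gen (K \<inter> A)"
    using L(1) by (simp only: sgrp_mult sgrp_inv)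
  ultimately show "g * s * inverse g \<in> gen (K \<inter> A)" by (simp add: grp_simps)
qed blast

lemma subfolder_lsol:
  assumes "sgrp A" "H \<subseteq> A" "A \<subseteq> G"
  shows "lsol (H \<inter> gen (K \<inter> A)) (K \<inter> A) \<longleftrightarrow> lsol H (K \<inter> A)"
  by (rule lsol_local) simp

text \<open>As \<open>A = H (K \<inter> A)\<close>, the group \<open>gen (K \<inter> A)\<close> is
  transitive on the cosets of \<open>H\<close> in \<open>A\<close>. If it is a 2-group, the index of
  \<open>H\<close> in \<open>A\<close> is therefore a power of 2.\<close>

lemma index_dvd:
  assumes "sgrp A" "H \<subseteq> A" "A \<subseteq> G" shows "card (rcoss H A) dvd card (gen (K \<inter> A))"
proof (rule card_rcoss_dvd[OF sH])
  interpret S: folder "gen (K \<inter> A)" "H \<inter> gen (K \<inter> A)" "K \<inter> A" by (rule subfolder[OF assms])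
  show "sgrp (gen (K \<inter> A))" by (rule S.sG)
  show "gen (K \<inter> A) \<subseteq> A" by (rule gen_least[OF assms(1)]) blast
  show "\<exists>a\<in>H. \<exists>l\<in>gen (K \<inter> A). b = a * l" if b: "b \<in> A" for b
  proof -
    from b obtain h m where "h \<in> H" "m \<in> K \<inter> A" "b = h * m" using subfolder_factor[OF assms] by blast
    then show "\<exists>a\<in>H. \<exists>l\<in>gen (K \<inter> A). b = a * l" using S.KG by blast
  qed
qed

lemma K_trivial: "K \<subseteq> {1} \<Longrightarrow> G = {1}"
  using gen_least[of "{1}" K] gK sgrp_one[OF sG] by auto

text \<open>All folder axioms except \<open>sharp\<close> pass to an arbitrary homomorphic image;
  this is the one that has to be assumed.\<close>

definition sharp_hm :: "('a \<Rightarrow> 'b::grp) \<Rightarrow> bool" where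
  "sharp_hm \<phi> \<longleftrightarrow> hm \<phi> G \<and> (\<forall>g\<in>G. \<forall>k\<in>K. \<forall>l\<in>K. \<phi> (g * k * inverse l * inverse g) \<in> \<phi> ` H \<longrightarrow> \<phi> k = \<phi> l)"

lemma image_folder:
  assumes "sharp_hm \<phi>" shows "folder (\<phi> ` G) (\<phi> ` H) (\<phi> ` K)"
proof -
  have h: "hm \<phi> G" using assms by (simp add: sharp_hm_def)
  note m = hm_mult[OF h] and i = hm_inv[OF h]
  have K: "k \<in> G" if "k \<in> K" for k using that KG by blast
  have H: "k \<in> G" if "k \<in> H" for k using that HG by blast
  show ?thesis
  proof
    show "sgrp (\<phi> ` G)" "sgrp (\<phi> ` H)" using hm_image_sgrp[OF h] sG sH HG by auto
    show "gen (\<phi> ` K) = \<phi> ` G" using hm_gen[OF h KG] gK by simp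
    show "1 \<in> \<phi> ` K" using hm_one[OF h] oneK by (metis imageI)
    fix k l assume "k \<in> \<phi> ` K" "l \<in> \<phi> ` K"
    then obtain a b where ab: "a \<in> K" "b \<in> K" "k = \<phi> a" "l = \<phi> b" by blast
    have "k * l * k = \<phi> (a * b * a)" using ab K sG by (simp add: m)
    then show "k * l * k \<in> \<phi> ` K" using tw ab by blast
    obtain h' n where "h' \<in> H" "n \<in> K" "a * b = h' * n" using fac ab by blast
    then have "\<phi> a * \<phi> b = \<phi> h' * \<phi> n" "h' \<in> H" "n \<in> K" using m[of a b] m[of h' n] ab K H by auto
    then show "\<exists>h\<in>\<phi> ` H. \<exists>m\<in>\<phi> ` K. k * l = h * m" using ab by blast
    fix g assume "g \<in> \<phi> ` G" and gh: "g * k * inverse l * inverse g \<in> \<phi> ` H"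
    then obtain c where c: "c \<in> G" "g = \<phi> c" by blast
    have "\<phi> (c * a * inverse b * inverse c) = g * k * inverse l * inverse g"
      using c ab K sG by (simp add: m i)
    then have "\<phi> (c * a * inverse b * inverse c) \<in> \<phi> ` H" using gh by simp
    then have "\<phi> a = \<phi> b" using assms c(1) ab(1,2) unfolding sharp_hm_def by blast
    then show "k = l" using ab by simp
  next
    fix h' k assume "h' \<in> \<phi> ` H" "k \<in> \<phi> ` K"
    then obtain a b where ab: "a \<in> H" "b \<in> K" "h' = \<phi> a" "k = \<phi> b" by blast
    have "h' * k * inverse h' = \<phi> (a * b * inverse a)" using ab K H sG by (simp add: m i)
    then show "h' * k * inverse h' \<in> \<phi> ` K" using Ar ab by blast
  qed (use HG KG in auto)
qed

text \<open>Unlike its converse \<open>hm_dl\<close>, this needs sharpness. An element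
  \<open>k\<close> of \<open>K\<close> sent into the image of \<open>dhull\<close> need not lie in
  \<open>dhull\<close>, but the \<open>K\<close>-factor \<open>x\<close> of a preimage in
  \<open>dhull\<close> does, and sharpness gives \<open>\<phi> k = \<phi> x\<close>.\<close>

lemma image_dl: assumes "sharp_hm \<phi>" shows "dl (\<phi> ` H) (\<phi> ` K) \<subseteq> \<phi> ` dl H K"
proof
  have h: "hm \<phi> G" using assms by (simp add: sharp_hm_def)
  interpret I: folder "\<phi> ` G" "\<phi> ` H" "\<phi> ` K" by (rule image_folder[OF assms])
  fix y assume y: "y \<in> dl (\<phi> ` H) (\<phi> ` K)"
  then obtain k where k: "k \<in> K" "y = \<phi> k" by (auto simp: dl_def)
  have "\<phi> ` H \<union> comms (\<phi> ` G) = \<phi> ` (H \<union> comms G)" using hm_comms[OF h, of G] by auto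
  moreover have "H \<union> comms G \<subseteq> G" using HG comms_subset[OF sG] by blast
  ultimately have "y \<in> \<phi> ` dhull" using y hm_gen[OF h, of "H \<union> comms G"] by (simp add: I.dl_eq dhull_def)
  then obtain m where m: "m \<in> dhull" "\<phi> k = \<phi> m" using k by auto
  then have "m \<in> G" using dhull(4) by blast
  then obtain a x where ax: "a \<in> H" "x \<in> K" "m = a * x" using factor by blast
  then have "x = inverse a * m" by simp
  moreover have "inverse a \<in> dhull" using ax dhull(1,2) by (simp add: subset_iff)
  ultimately have x: "x \<in> dhull" using m dhull(1) by simp
  have "\<phi> k = \<phi> a * \<phi> x" using m ax hm_mult[OF h, of a x] HG KG by auto
  then have "\<phi> k * inverse (\<phi> x) \<in> \<phi> ` H" using ax by (simp add: mult.assoc)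
  then have "\<phi> k = \<phi> x" using I.sharp1 k ax by blast
  then show "y \<in> \<phi> ` dl H K" using k x ax by (simp add: dl_hull)
qed

end

lemma (in folder) image_dl_pow:
  assumes "sharp_hm \<phi>" shows "(dl (\<phi> ` H) ^^ n) (\<phi> ` K) \<subseteq> \<phi> ` (dl H ^^ n) K"
proof -
  have "folder G H K" by unfold_locales
  then show ?thesis using assms
  proof (induction n arbitrary: G H K)
    case (Suc n)
    interpret F: folder G H K by (rule Suc.prems(1))
    have h: "hm \<phi> G" using Suc.prems by (simp add: F.sharp_hm_def)
    interpret I: folder "\<phi> ` G" "\<phi> ` H" "\<phi> ` K" by (rule F.image_folder[OF Suc.prems(2)])
    define K1 where "K1 = dl H K"
    define L where "L = gen K1"
    have K1: "K1 = K \<inter> F.dhull" by (simp add: K1_def F.dl_hull)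
    interpret S: folder L "H \<inter> L" K1
      unfolding L_def K1 by (rule F.subfolder[OF F.dhull(1,2,4)])
    have LG: "L \<subseteq> G" unfolding L_def by (rule gen_least[OF F.sG]) (use F.KG K1 in auto)
    have hL: "hm \<phi> L" by (rule hm_mono[OF h S.sG LG])
    \<comment> \<open>The induction hypothesis concerns the subfolder with inner group
      \<open>H \<inter> L\<close>. To compare its \<open>dl\<close> in the image with the global
      one, \<phi> must commute with this intersection: the \<open>K\<close>-factor of an element of
      \<open>L\<close> that is sent into the image of \<open>H\<close> goes to 1.\<close>
    have HL: "\<phi> ` (H \<inter> L) = \<phi> ` H \<inter> \<phi> ` L"
    proof
      show "\<phi> ` H \<inter> \<phi> ` L \<subseteq> \<phi> ` (H \<inter> L)"
      proof
        fix y assume y: "y \<in> \<phi> ` H \<inter> \<phi> ` L"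
        then obtain g where g: "g \<in> L" "y = \<phi> g" by blast
        obtain a x where ax: "a \<in> H \<inter> L" "x \<in> K1" "g = a * x" using S.factor g by blast
        have "y = \<phi> a * \<phi> x" using g ax hm_mult[OF h, of a x] LG S.KG by auto
        then have "\<phi> x = inverse (\<phi> a) * y" by simp
        then have "\<phi> x \<in> \<phi> ` H" using I.sH ax y by auto
        then have "\<phi> x = 1" using I.HK1 ax K1 by blast
        then show "y \<in> \<phi> ` (H \<inter> L)" using \<open>y = \<phi> a * \<phi> x\<close> ax by simp
      qed
    qed blast
    have "S.sharp_hm \<phi>"
      unfolding S.sharp_hm_def
    proof (intro conjI ballI impI)
      fix g k l assume "g \<in> L" "k \<in> K1" "l \<in> K1" "\<phi> (g * k * inverse l * inverse g) \<in> \<phi> ` (H \<inter> L)"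
      then show "\<phi> k = \<phi> l" using Suc.prems(2) LG K1 unfolding F.sharp_hm_def by blast
    qed (rule hL)
    from Suc.IH[OF S.folder_axioms this]
    have "(dl (\<phi> ` H \<inter> \<phi> ` L) ^^ n) (\<phi> ` K1) \<subseteq> \<phi> ` (dl (H \<inter> L) ^^ n) K1" by (simp add: HL)
    moreover have "(dl (\<phi> ` H \<inter> \<phi> ` L) ^^ n) (\<phi> ` K1) = (dl (\<phi> ` H) ^^ n) (\<phi> ` K1)"
      by (rule dl_pow_local) (use hm_gen[OF hL S.KG] L_def in simp)
    moreover have "(dl (H \<inter> L) ^^ n) K1 = (dl H ^^ n) K1" by (rule dl_pow_local) (simp add: L_def)
    ultimately have "(dl (\<phi> ` H) ^^ n) (\<phi> ` K1) \<subseteq> \<phi> ` (dl H ^^ n) K1" by simp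
    moreover have "(dl (\<phi> ` H) ^^ n) (dl (\<phi> ` H) (\<phi> ` K)) \<subseteq> (dl (\<phi> ` H) ^^ n) (\<phi> ` K1)"
      unfolding K1_def by (rule dl_pow_mono[OF F.image_dl[OF Suc.prems(2)]])
    ultimately show ?case by (simp add: funpow_swap1 K1_def)
  qed simp
qed

lemma (in folder) image_lsol: assumes "sharp_hm \<phi>" "lsol H K" shows "lsol (\<phi> ` H) (\<phi> ` K)"
proof -
  obtain n where "(dl H ^^ n) K \<subseteq> {1}" using assms(2) by (auto simp: lsol_def)
  moreover have "\<phi> 1 = 1" using assms(1) hm_one by (auto simp: sharp_hm_def)
  ultimately have "(dl (\<phi> ` H) ^^ n) (\<phi> ` K) \<subseteq> {1}" using image_dl_pow[OF assms(1), of n] by blast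
  then show ?thesis unfolding lsol_def by blast
qed

lemma card_two_part:
  assumes "sgrp (G::'a::grp set)"
  obtains b w where "card G = 2 ^ b * w" "odd w"
proof -
  have "card G \<noteq> 0" using assms sgrp_finite by (metis card_0_eq empty_iff sgrp_one)
  then show thesis
    using multiplicity_decompose'[of "card G" 2] that by (metis not_is_unit_0 odd_one two_is_prime_nat not_prime_unit)
qed

lemma (in folder) quotient_folder:
  assumes N: "nrm N G"
    and sharpN: "\<And>g k l. \<lbrakk>g \<in> G; k \<in> K; l \<in> K; g * k * inverse l * inverse g \<in> pset H N\<rbrakk> \<Longrightarrow> k * inverse l \<in> N"
  obtains \<phi> :: "'a \<Rightarrow> nat perm" where "sharp_hm \<phi>" "\<And>g. g \<in> G \<Longrightarrow> \<phi> g = 1 \<longleftrightarrow> g \<in> N"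
proof -
  have inG: "k \<in> G" if "k \<in> K \<or> k \<in> H" for k using that KG HG by auto
  obtain \<phi> :: "'a \<Rightarrow> nat perm" where \<phi>: "hm \<phi> G" "\<And>g. g \<in> G \<Longrightarrow> \<phi> g = 1 \<longleftrightarrow> g \<in> N"
    using quotient_perm[OF sG N] by metis
  note eq = hm_eq_iff[OF \<phi>(1)]
  have sh: "sharp_hm \<phi>"
    unfolding sharp_hm_def
  proof (intro conjI ballI impI)
    fix g k l assume g: "g \<in> G" and k: "k \<in> K" and l: "l \<in> K" and i: "\<phi> (g * k * inverse l * inverse g) \<in> \<phi> ` H"
    define x where "x = g * k * inverse l * inverse g"
    have x: "x \<in> G" using g k l inG sG by (simp add: x_def)
    obtain h where h: "h \<in> H" "\<phi> x = \<phi> h" using i by (auto simp: x_def)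
    have "\<phi> (inverse h * x) = 1" using h hm_mult[OF \<phi>(1), of "inverse h" x] hm_inv[OF \<phi>(1), of h] x inG sG by simp
    then have "inverse h * x \<in> N" using \<phi>(2) h x inG sG by simp
    then have "h * (inverse h * x) \<in> pset H N" using h by (intro psetI)
    then have "k * inverse l \<in> N" using sharpN[OF g k l] by (simp add: x_def)
    then show "\<phi> k = \<phi> l" using eq[of k l] \<phi>(2)[of "k * inverse l"] k l inG sG by simp
  qed (rule \<phi>(1))
  then show thesis using that \<phi>(2) by blast
qed

section \<open>Folders with an inverting automorphism\<close>

text \<open>These are folders of Bruck loops: \<tau> preserves \<open>H\<close> and
  \<open>K\<close>, so it induces a loop automorphism, and this automorphism is inversion.\<close>

locale bruck = folder +
  fixes \<tau> :: "'a \<Rightarrow> 'a"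
  assumes hm\<tau>: "hm \<tau> G" and \<tau>K: "k \<in> K \<Longrightarrow> \<tau> k = inverse k" and \<tau>H: "h \<in> H \<Longrightarrow> \<tau> h = h"
begin

lemma \<tau>_mult: "\<lbrakk>x \<in> G; y \<in> G\<rbrakk> \<Longrightarrow> \<tau> (x * y) = \<tau> x * \<tau> y"
  by (rule hm_mult[OF hm\<tau>])

lemma \<tau>_inv: "x \<in> G \<Longrightarrow> \<tau> (inverse x) = inverse (\<tau> x)"
  by (rule hm_inv[OF hm\<tau>])

lemma inG: "k \<in> K \<Longrightarrow> k \<in> G" "h \<in> H \<Longrightarrow> h \<in> G"
  using KG HG by auto

lemma \<tau>_hk: "\<lbrakk>h \<in> H; k \<in> K\<rbrakk> \<Longrightarrow> \<tau> (h * k) = h * inverse k"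
  by (simp add: \<tau>_mult inG \<tau>K \<tau>H)

lemma \<tau>G: assumes "g \<in> G" shows "\<tau> g \<in> G"
proof -
  obtain h m where "h \<in> H" "m \<in> K" "g = h * m" using factor assms by blast
  then show ?thesis using sG inG by (simp add: \<tau>_hk)
qed

lemma \<tau>\<tau>: assumes "g \<in> G" shows "\<tau> (\<tau> g) = g"
proof -
  obtain h m where "h \<in> H" "m \<in> K" "g = h * m" using factor assms by blast
  then show ?thesis by (simp add: \<tau>_hk invK)
qed

lemma inj_\<tau>: "inj_on \<tau> G"
  by (rule inj_on_inverseI[of _ \<tau>]) (rule \<tau>\<tau>)

lemma image_\<tau>: "\<tau> ` G = G"
  using \<tau>G \<tau>\<tau> by force

text \<open>The twisted conjugation action of \<open>G\<close> on \<open>K\<close>. For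
  \<open>g = h * m\<close> it is \<open>k \<mapsto> m * k * m\<close> followed by conjugation with
  \<open>h\<close>. In \<open>g * k * inverse l * inverse g\<close> the twists cancel, so conjugates
  of \<open>k * inverse l\<close> are again of this form.\<close>

lemma twist: assumes "g \<in> G" "k \<in> K" shows "g * k * inverse (\<tau> g) \<in> K"
proof -
  obtain h m where hm: "h \<in> H" "m \<in> K" "g = h * m" using factor assms by blast
  have "g * k * inverse (\<tau> g) = h * (m * k * m) * inverse h" by (simp add: hm \<tau>_hk grp_simps)
  then show ?thesis using Ar tw hm assms by simp
qed

lemma subbruck:
  assumes A: "sgrp A" "H \<subseteq> A" "A \<subseteq> G"
  shows "bruck (gen (K \<inter> A)) (H \<inter> gen (K \<inter> A)) (K \<inter> A) \<tau>"
proof -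
  interpret S: folder "gen (K \<inter> A)" "H \<inter> gen (K \<inter> A)" "K \<inter> A" by (rule subfolder[OF A])
  have "gen (K \<inter> A) \<subseteq> G" by (rule gen_least[OF sG]) (use KG in auto)
  then show ?thesis
    by unfold_locales (use hm_mono[OF hm\<tau> S.sG] \<tau>K \<tau>H in auto)
qed

lemma quotient_bruck:
  assumes N: "nrm N G" "\<tau> ` N \<subseteq> N"
    and sharpN: "\<And>g k l. \<lbrakk>g \<in> G; k \<in> K; l \<in> K; g * k * inverse l * inverse g \<in> pset H N\<rbrakk> \<Longrightarrow> k * inverse l \<in> N"
  obtains \<phi> :: "'a \<Rightarrow> nat perm" and \<tau>' where "sharp_hm \<phi>" "\<And>g. g \<in> G \<Longrightarrow> \<phi> g = 1 \<longleftrightarrow> g \<in> N"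
    "bruck (\<phi> ` G) (\<phi> ` H) (\<phi> ` K) \<tau>'"
proof -
  obtain \<phi> :: "'a \<Rightarrow> nat perm" where sh: "sharp_hm \<phi>" and ker: "\<And>g. g \<in> G \<Longrightarrow> \<phi> g = 1 \<longleftrightarrow> g \<in> N"
  proof (rule quotient_folder[OF N(1)])
    show "k * inverse l \<in> N" if "g \<in> G" "k \<in> K" "l \<in> K" "g * k * inverse l * inverse g \<in> pset H N" for g k l
      by (rule sharpN[OF that])
  qed blast
  have \<phi>: "hm \<phi> G" "\<And>g. g \<in> G \<Longrightarrow> \<phi> g = 1 \<longleftrightarrow> g \<in> N" using sh ker by (auto simp: sharp_hm_def)
  note eq = hm_eq_iff[OF \<phi>(1)]
  interpret I: folder "\<phi> ` G" "\<phi> ` H" "\<phi> ` K" by (rule image_folder[OF sh])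
  define \<tau>' where "\<tau>' = (\<lambda>y. \<phi> (\<tau> (inv_into G \<phi> y)))"
  have \<tau>': "\<tau>' (\<phi> g) = \<phi> (\<tau> g)" if g: "g \<in> G" for g
  proof -
    define g' where "g' = inv_into G \<phi> (\<phi> g)"
    have g': "g' \<in> G" "\<phi> g' = \<phi> g" using g by (auto simp: g'_def inv_into_into f_inv_into_f)
    then have "g' * inverse g \<in> N" using eq \<phi>(2)[of "g' * inverse g"] g sG by simp
    then have "\<tau> (g' * inverse g) \<in> N" using N by blast
    then have "\<phi> (\<tau> g' * inverse (\<tau> g)) = 1"
      using \<phi>(2)[of "\<tau> g' * inverse (\<tau> g)"] g g' sG \<tau>G by (simp add: \<tau>_mult \<tau>_inv)
    then have "\<phi> (\<tau> g') = \<phi> (\<tau> g)" using eq g g' \<tau>G by simp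
    then show ?thesis by (simp add: \<tau>'_def g'_def)
  qed
  have "bruck (\<phi> ` G) (\<phi> ` H) (\<phi> ` K) \<tau>'"
  proof unfold_locales
    show "hm \<tau>' (\<phi> ` G)"
      unfolding hm_def
    proof (intro conjI ballI)
      fix x y assume "x \<in> \<phi> ` G" "y \<in> \<phi> ` G"
      then obtain u v where uv: "u \<in> G" "v \<in> G" "x = \<phi> u" "y = \<phi> v" by blast
      have "\<tau>' (\<phi> (u * v)) = \<phi> (\<tau> u * \<tau> v)" using uv sG by (simp add: \<tau>' \<tau>_mult)
      then show "\<tau>' (x * y) = \<tau>' x * \<tau>' y" using uv hm_mult[OF \<phi>(1)] \<tau>G by (simp add: \<tau>')
    qed (rule I.sG)
  qed (use inG hm_inv[OF \<phi>(1)] in \<open>auto simp: \<tau>' \<tau>K \<tau>H\<close>)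
  then show thesis using that sh \<phi>(2) by blast
qed

subsection \<open>Odd normal subgroups\<close>

text \<open>The map \<open>a \<mapsto> \<tau> (a * x)\<close> induces an involution on the cosets of
  \<open>H\<close> in \<open>H N\<close>, whose number is odd. A fixed coset \<open>H a\<close> puts
  \<open>a * x * inverse (\<tau> a)\<close> into \<open>H \<inter> K\<close>, so it is 1 and
  \<open>x = inverse a * \<tau> a\<close>. Only the \<open>N\<close>-factor \<open>n\<close> of
  \<open>a\<close> survives here, whence \<open>x = inverse n * \<tau> n\<close>.\<close>

lemma odd_block:
  assumes N: "nrm N G" "odd (card N)" "\<tau> ` N \<subseteq> N" and x: "x \<in> K" "x \<in> pset H N"
  shows "x \<in> N"
proof -
  define A where "A = pset H N"
  have sN: "sgrp N" and NG: "N \<subseteq> G" using nrm_sgrp[OF N(1)] nrm_subset[OF N(1)] by auto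
  have A: "sgrp A" "A \<subseteq> G" "H \<subseteq> A"
    using pset_nrm_sgrp[OF sG sH HG N(1)] pset_least[OF sG HG NG] pset_superset[OF sH sN] by (auto simp: A_def)
  have \<tau>A: "\<tau> a \<in> A" if "a \<in> A" for a
  proof -
    obtain h n where hn: "h \<in> H" "n \<in> N" "a = h * n" using \<open>a \<in> A\<close> unfolding A_def by (metis psetE)
    then have "\<tau> a = h * \<tau> n" using NG inG by (auto simp: \<tau>_mult \<tau>H)
    then show ?thesis using hn N(3) psetI[of h H "\<tau> n" N] by (auto simp: A_def)
  qed
  define f where "f = (\<lambda>C. (\<lambda>y. \<tau> (y * x)) ` C)"
  have fr: "f (rcos H a) = rcos H (\<tau> (a * x))" if a: "a \<in> A" for a
  proof -
    have "\<tau> (h * a * x) = h * \<tau> (a * x)" if "h \<in> H" for h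
      using that a x A inG sG \<tau>_mult[of h "a * x"] by (auto simp: mult.assoc \<tau>H)
    then show ?thesis by (simp add: f_def rcos_def image_image cong: image_cong)
  qed
  have fin: "finite (rcoss H A)" by (simp add: finite_rcoss sgrp_finite A)
  have "card (rcoss H A) dvd card N"
    by (rule card_rcoss_dvd[OF sH sN]) (use pset_superset[OF sH sN] in \<open>auto simp: A_def elim!: psetE\<close>)
  then have odd: "odd (card (rcoss H A))" using N(2) by (metis dvd_trans)
  have xA: "x \<in> A" "x \<in> G" using x inG by (auto simp: A_def)
  obtain C where C: "C \<in> rcoss H A" "f C = C"
  proof (rule involution_odd_fixpoint[OF fin odd])
    fix C assume "C \<in> rcoss H A"
    then obtain a where a: "a \<in> A" "C = rcos H a" by (auto simp: rcoss_def)
    have ax: "\<tau> (a * x) \<in> A" using \<tau>A a xA A by simp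
    then show "f C \<in> rcoss H A" using a by (simp add: fr rcoss_def)
    have "\<tau> (\<tau> (a * x) * x) = a * x * inverse x"
      using a xA A sG \<tau>\<tau>[of "a * x"] \<tau>G[of "a * x"] \<tau>_mult[of "\<tau> (a * x)" x] \<tau>K[OF x(1)] by auto
    then show "f (f C) = C" using a ax by (simp add: fr mult.assoc)
  qed
  then obtain a where a: "a \<in> A" "rcos H (\<tau> (a * x)) = rcos H a" by (auto simp: rcoss_def fr)
  have aG: "a \<in> G" using a A by blast
  have "a * inverse (\<tau> (a * x)) = a * x * inverse (\<tau> a)"
    using aG xA by (simp add: \<tau>_mult \<tau>K[OF x(1)] grp_simps)
  moreover have "a * inverse (\<tau> (a * x)) \<in> H" using a(2) rcos_eq_iff[OF sH] by blast
  ultimately have "a * x * inverse (\<tau> a) = 1" using HK1[OF twist[OF aG x(1)]] by metis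
  then have e: "x = inverse a * \<tau> a" by (metis mult_inv_eq_one inv_cancel(1) mult.assoc)
  obtain h n where hn: "h \<in> H" "n \<in> N" "a = h * n" using a(1) unfolding A_def by (metis psetE)
  then have "x = inverse n * \<tau> n" using NG inG by (auto simp: e \<tau>_mult \<tau>H grp_simps)
  moreover have "\<tau> n \<in> N" using N(3) hn by blast
  ultimately show ?thesis using sN hn by simp
qed

text \<open>Writing \<open>n = h * x\<close>, invariance under \<tau> means
  \<open>x = inverse x\<close>, while \<open>x\<close> lies in the odd group \<open>N\<close> by
  \<open>odd_block\<close>.\<close>

lemma odd_fixed:
  assumes N: "nrm N G" "odd (card N)" "\<tau> ` N \<subseteq> N" and n: "n \<in> N" "\<tau> n = n"
  shows "n \<in> H"
proof -
  have sN: "sgrp N" and NG: "N \<subseteq> G" using nrm_sgrp[OF N(1)] nrm_subset[OF N(1)] by auto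
  obtain h x where hx: "h \<in> H" "x \<in> K" "n = h * x" using factor n NG by blast
  have "x = inverse h * n" by (simp add: hx)
  then have "x \<in> pset H N" using psetI[of "inverse h" H n N] hx n sH by simp
  then have "x \<in> N" using odd_block[OF N hx(2)] by blast
  then have "x ^ card N = 1" using power_card sN by blast
  moreover have "inverse x = x" using n(2) hx by (simp add: \<tau>_hk)
  then have "x ^ 2 = 1" by (metis power2_eq_square right_inv)
  ultimately have "x = 1" using coprime_powers_eq_one[of x 2 "card N"] N(2) by simp
  then show ?thesis using hx by simp
qed

text \<open>The 2-part \<open>c\<close> of \<open>k\<close> still inverts \<open>h\<close> modulo
  \<open>N\<close>, so \<open>d = c * c\<close> acts on the coset \<open>h N\<close> by conjugation.
  This coset is odd and \<open>d\<close> is a 2-element, hence \<open>d\<close> fixes an odd number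
  of its elements, and \<tau> fixes one of these, \<open>h'\<close>, which lies in \<open>H\<close>
  by \<open>odd_fixed\<close>. Its conjugate \<open>h2\<close> under \<open>c\<close> is shown to be
  in \<open>H\<close> as well. Now conjugating \<open>c\<close> by \<open>inverse h'\<close> gives
  \<open>(inverse h' * h2) * c\<close>, an element of \<open>K\<close>, which forces
  \<open>h2 = h'\<close>. Modulo \<open>N\<close>, \<open>h\<close> thus equals its inverse and has
  odd order.\<close>

lemma odd_inverted:
  assumes N: "nrm N G" "odd (card N)" "\<tau> ` N \<subseteq> N"
    and \<phi>: "hm \<phi> G" "\<And>g. g \<in> G \<Longrightarrow> \<phi> g = 1 \<longleftrightarrow> g \<in> N"
    and k: "k \<in> K" and h: "h \<in> H" and j: "odd j" "\<phi> h ^ j = 1" and inv: "\<phi> k * \<phi> h = inverse (\<phi> h) * \<phi> k"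
  shows "\<phi> h = (1::'b::grp)"
proof -
  have sN: "sgrp N" and NG: "N \<subseteq> G" using nrm_sgrp[OF N(1)] nrm_subset[OF N(1)] by auto
  note m = hm_mult[OF \<phi>(1)] and i = hm_inv[OF \<phi>(1)]
  obtain b w where bw: "card G = 2 ^ b * w" "odd w" using card_two_part[OF sG] .
  define c where "c = k ^ w"
  have cK: "c \<in> K" and cG: "c \<in> G" using powK k inG by (auto simp: c_def)
  have hG: "h \<in> G" and kG: "k \<in> G" using h k inG by auto
  have c2: "c ^ (2 ^ b) = 1" using power_card[OF sG kG] by (simp add: c_def bw mult.commute flip: power_mult)
  have cinv: "\<phi> c * \<phi> h = inverse (\<phi> h) * \<phi> c"
  proof -
    obtain v where w: "w = 2 * v + 1" using bw(2) by (metis oddE)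
    have "\<phi> k * inverse (\<phi> h) = \<phi> h * \<phi> k"
    proof -
      have "\<phi> h * (\<phi> k * \<phi> h) * inverse (\<phi> h) = \<phi> h * (inverse (\<phi> h) * \<phi> k) * inverse (\<phi> h)" by (simp only: inv)
      then show ?thesis by (simp add: mult.assoc)
    qed
    then have "(\<phi> k * \<phi> k) * inverse (\<phi> h) = \<phi> k * \<phi> h * \<phi> k" by (simp add: mult.assoc)
    also have "\<dots> = inverse (\<phi> h) * (\<phi> k * \<phi> k)" unfolding inv by (simp add: mult.assoc)
    finally have "(\<phi> k * \<phi> k) ^ v * inverse (\<phi> h) = inverse (\<phi> h) * (\<phi> k * \<phi> k) ^ v"
      by (rule power_commuting_commutes)
    moreover have "\<phi> c = \<phi> k ^ w" by (simp add: c_def hm_power[OF \<phi>(1) kG])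
    then have "\<phi> c = (\<phi> k * \<phi> k) ^ v * \<phi> k"
      unfolding w power_add power_mult power2_eq_square by simp
    ultimately show ?thesis using inv by (metis mult.assoc)
  qed
  define S where "S = {x \<in> G. \<phi> x = \<phi> h}"
  have hinv: "inverse h * x \<in> N" if "x \<in> S" for x
  proof -
    have "\<phi> (inverse h * x) = 1" using that hG sG m i by (simp add: S_def)
    then show ?thesis using \<phi>(2) that hG sG by (simp add: S_def)
  qed
  have hN: "h * n \<in> S" if "n \<in> N" for n
  proof -
    have "n \<in> G" using that NG by blast
    then show ?thesis using that hG sG m \<phi>(2)[of n] by (simp add: S_def)
  qed
  have "S = (\<lambda>n. h * n) ` N"
  proof
    show "S \<subseteq> (\<lambda>n. h * n) ` N"
    proof
      fix x assume "x \<in> S"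
      then have "inverse h * x \<in> N" "x = h * (inverse h * x)" using hinv by auto
      then show "x \<in> (\<lambda>n. h * n) ` N" by blast
    qed
  qed (use hN in auto)
  then have cS: "card S = card N" by (simp add: card_image inj_on_def)
  have fS: "finite S" using sgrp_finite[OF sG] by (simp add: S_def)
  define d where "d = c * c"
  have dG: "d \<in> G" using cG sG by (simp add: d_def)
  have \<phi>d: "\<phi> d * \<phi> h * inverse (\<phi> d) = \<phi> h"
  proof -
    have "\<phi> c * inverse (\<phi> h) = \<phi> h * \<phi> c"
    proof -
      have "\<phi> h * (\<phi> c * \<phi> h) * inverse (\<phi> h) = \<phi> h * (inverse (\<phi> h) * \<phi> c) * inverse (\<phi> h)" by (simp only: cinv)
      then show ?thesis by (simp add: mult.assoc)
    qed
    then have "\<phi> c * (\<phi> c * \<phi> h) = \<phi> h * (\<phi> c * \<phi> c)" unfolding cinv by (metis mult.assoc)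
    then have "\<phi> d * \<phi> h = \<phi> h * \<phi> d" using cG by (simp add: d_def m mult.assoc)
    then show ?thesis by (simp add: mult.assoc)
  qed
  define f where "f = (\<lambda>x. d * x * inverse d)"
  define F where "F = {x \<in> S. f x = x}"
  have "card S mod 2 = card F mod 2"
    unfolding F_def
  proof (rule card_fixpoints_prime_power[OF two_is_prime_nat fS])
    show "f x \<in> S" if "x \<in> S" for x
      using that dG sG m i \<phi>d by (simp add: S_def f_def)
    have "(f ^^ n) x = d ^ n * x * inverse (d ^ n)" for n x
      by (induction n) (simp_all add: f_def grp_simps power_commutes)
    moreover have "d ^ (2 ^ b) = 1"
    proof -
      have "d = c ^ 2" by (simp add: d_def power2_eq_square)
      then have "d ^ (2 ^ b) = (c ^ (2 ^ b)) ^ 2" by (simp flip: power_mult) (simp add: mult.commute)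
      then show ?thesis using c2 by simp
    qed
    ultimately show "(f ^^ (2 ^ b)) x = x" for x by simp
  qed
  then have oF: "odd (card F)" using cS N(2) by presburger
  have fF: "finite F" using fS by (simp add: F_def)
  have \<tau>d: "\<tau> d = inverse d" using cK cG by (simp add: d_def \<tau>_mult \<tau>K grp_simps)
  obtain h' where h': "h' \<in> F" "\<tau> h' = h'"
  proof (rule involution_odd_fixpoint[OF fF oF])
    fix x assume x: "x \<in> F"
    have xG: "x \<in> G" using x by (simp add: F_def S_def)
    show "\<tau> (\<tau> x) = x" by (rule \<tau>\<tau>[OF xG])
    have "inverse h * x \<in> N" using hinv x by (simp add: F_def)
    then have "\<tau> (inverse h * x) \<in> N" using N(3) by blast
    then have "inverse h * \<tau> x \<in> N" using xG hG sG h by (simp add: \<tau>_mult \<tau>_inv \<tau>H)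
    then have "\<tau> x \<in> S" using hN[of "inverse h * \<tau> x"] by simp
    moreover have "f (\<tau> x) = \<tau> x"
    proof -
      have "d * x * inverse d = x" using x by (simp add: F_def f_def)
      then have "d * x * inverse d * d = x * d" by simp
      then have "d * x = x * d" by (simp add: mult.assoc)
      then have "\<tau> (d * x) = \<tau> (x * d)" by simp
      then have "inverse d * \<tau> x = \<tau> x * inverse d" using dG xG by (simp add: \<tau>_mult \<tau>d)
      then have "d * (\<tau> x * inverse d) = d * (inverse d * \<tau> x)" by simp
      then show ?thesis by (simp add: f_def mult.assoc)
    qed
    ultimately show "\<tau> x \<in> F" by (simp add: F_def)
  qed
  have h'G: "h' \<in> G" and \<phi>h': "\<phi> h' = \<phi> h" and "f h' = h'" using h' by (auto simp: F_def S_def)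
  have comm: "d * h' = h' * d"
  proof -
    have "d * h' * inverse d * d = h' * d" using \<open>f h' = h'\<close> by (simp add: f_def)
    then show ?thesis by (simp add: mult.assoc)
  qed
  have h'H: "h' \<in> H"
  proof -
    have "\<tau> (inverse h * h') = inverse h * h'" using h'G hG sG h h' by (simp add: \<tau>_mult \<tau>_inv \<tau>H)
    then have "inverse h * h' \<in> H" using odd_fixed[OF N] hinv h' by (simp add: F_def)
    then have "h * (inverse h * h') \<in> H" using h sH by (simp only: sgrp_mult)
    then show ?thesis by simp
  qed
  \<comment> \<open>Because \<open>c * c\<close> commutes with \<open>h'\<close>, conjugating
    \<open>h'\<close> by \<open>c\<close> or by \<open>inverse c\<close> gives the same element;
    \<tau> exchanges the two descriptions, so \<open>h2\<close> is fixed by \<tau>.\<close>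
  define h2 where "h2 = inverse c * h' * c"
  have h2': "h2 = c * h' * inverse c"
  proof -
    have "c * h' * inverse c = inverse c * (d * h') * inverse c" by (simp add: d_def mult.assoc)
    also have "\<dots> = h2" unfolding comm by (simp add: d_def h2_def mult.assoc)
    finally show ?thesis by simp
  qed
  have h2G: "h2 \<in> G" using h'G cG sG by (simp add: h2_def)
  have \<tau>h2: "\<tau> h2 = h2"
  proof -
    have "\<tau> h2 = c * h' * inverse c" using h'G cG sG h' cK by (simp add: h2_def \<tau>_mult \<tau>_inv \<tau>K)
    then show ?thesis using h2' by simp
  qed
  have \<phi>h2: "\<phi> h2 = inverse (\<phi> h)"
  proof -
    have "\<phi> h2 = \<phi> c * \<phi> h * inverse (\<phi> c)" unfolding h2' using h'G cG sG by (simp add: m i \<phi>h')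
    then show ?thesis unfolding cinv by (simp add: mult.assoc)
  qed
  have h2H: "h2 \<in> H"
  proof -
    have "\<phi> (h * h2) = 1" using h2G hG sG by (simp add: m \<phi>h2)
    then have "h * h2 \<in> N" using \<phi>(2) h2G hG sG by simp
    moreover have "\<tau> (h * h2) = h * h2" using h2G hG h by (simp add: \<tau>_mult \<tau>h2 \<tau>H)
    ultimately have "h * h2 \<in> H" using odd_fixed[OF N] by blast
    then have "inverse h * (h * h2) \<in> H" using h sH by (simp only: sgrp_mult sgrp_inv)
    then show ?thesis by simp
  qed
  have "inverse h' * c * inverse (inverse h') \<in> K" by (rule Ar) (use h'H sH cK in simp_all)
  moreover have "inverse h' * c * inverse (inverse h') = (inverse h' * h2) * c" by (simp add: h2' mult.assoc)
  ultimately have "(inverse h' * h2) * c \<in> K" by simp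
  then have "inverse h' * h2 = 1" using inH_K[of "inverse h' * h2" c] h'H h2H sH cK by simp
  then have "h2 = h'" by (metis inv_cancel(2) mult_1_right)
  then have "inverse (\<phi> h) = \<phi> h" using \<phi>h2 \<phi>h' by simp
  then have "\<phi> h ^ 2 = 1" by (metis power2_eq_square right_inv)
  then show ?thesis using coprime_powers_eq_one[of "\<phi> h" 2 j] j by simp
qed

text \<open>By \<open>twist\<close>, \<open>u = g * k * inverse l * inverse g\<close> equals
  \<open>k1 * inverse l1\<close> with \<open>k1\<close>, \<open>l1\<close> in \<open>K\<close>.
  Modulo \<open>N\<close> it equals some \<open>h\<close> in \<open>H\<close>; applying \<tau> shows
  that \<open>inverse k1 * l1\<close> equals \<open>h\<close> too, so \<open>k1\<close> inverts
  \<open>h\<close>. By \<open>odd_inverted\<close> the odd part of \<open>h\<close> vanishes, and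
  \<open>u\<close> has 2-power order modulo \<open>N\<close>. Then \<open>u ^ card N\<close> is a
  2-element of \<open>H N\<close>, in which \<open>H\<close> has odd index; it can be conjugated
  into \<open>H\<close> and is 1 by \<open>semiregular\<close>. So \<open>u\<close> modulo
  \<open>N\<close> has odd order as well.\<close>

lemma odd_sharp:
  assumes N: "nrm N G" "odd (card N)" "\<tau> ` N \<subseteq> N"
    and g: "g \<in> G" "k \<in> K" "l \<in> K" "g * k * inverse l * inverse g \<in> pset H N"
  shows "k * inverse l \<in> N"
proof -
  have sN: "sgrp N" and NG: "N \<subseteq> G" using nrm_sgrp[OF N(1)] nrm_subset[OF N(1)] by auto
  obtain \<phi> :: "'a \<Rightarrow> nat perm" where \<phi>: "hm \<phi> G" "\<And>g. g \<in> G \<Longrightarrow> \<phi> g = 1 \<longleftrightarrow> g \<in> N"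
    using quotient_perm[OF sG N(1)] by metis
  note m = hm_mult[OF \<phi>(1)] and i = hm_inv[OF \<phi>(1)]
  define k1 where "k1 = g * k * inverse (\<tau> g)"
  define l1 where "l1 = g * l * inverse (\<tau> g)"
  define u where "u = k1 * inverse l1"
  have K1: "k1 \<in> K" "l1 \<in> K" using twist g by (auto simp: k1_def l1_def)
  have u: "u = g * k * inverse l * inverse g" by (simp add: u_def k1_def l1_def grp_simps)
  then obtain h n where hn: "h \<in> H" "n \<in> N" "u = h * n" using g(4) by (metis psetE)
  have uG: "u \<in> G" using K1 inG sG by (simp add: u_def)
  have hG: "h \<in> G" "n \<in> G" "\<tau> n \<in> N" using hn inG NG N(3) by auto
  have \<phi>u: "\<phi> u = \<phi> h" using hn hG m \<phi>(2)[of n] by simp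
  have "\<tau> u = h * \<tau> n" using hn hG by (simp add: \<tau>_mult \<tau>H)
  then have "\<phi> (\<tau> u) = \<phi> h" using hG m \<phi>(2)[of "\<tau> n"] NG by (simp add: subset_iff)
  moreover have "\<tau> u = inverse k1 * l1" using K1 inG sG by (simp add: u_def \<tau>_mult \<tau>_inv \<tau>K)
  ultimately have e1: "inverse (\<phi> k1) * \<phi> l1 = \<phi> h" using K1 inG sG by (simp add: m i)
  have e2: "\<phi> k1 * inverse (\<phi> l1) = \<phi> h" using \<phi>u K1 inG sG by (simp add: u_def m i)
  have inv: "\<phi> k1 * \<phi> h = inverse (\<phi> h) * \<phi> k1"
  proof -
    have "inverse (\<phi> h) * \<phi> k1 = \<phi> l1" unfolding e2[symmetric] by (simp add: grp_simps)
    then show ?thesis unfolding e1[symmetric] by simp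
  qed
  obtain b w where bw: "card G = 2 ^ b * w" "odd w" using card_two_part[OF sG] .
  have "\<phi> (h ^ 2 ^ b) = 1"
  proof (rule odd_inverted[OF N \<phi> K1(1) _ bw(2)])
    show "h ^ 2 ^ b \<in> H" using hn sH by simp
    have "\<phi> h ^ card G = 1" using power_card[OF sG hG(1)] hm_power[OF \<phi>(1) hG(1), of "card G"] hm_one[OF \<phi>(1)] by simp
    then show "\<phi> (h ^ 2 ^ b) ^ w = 1" using hm_power[OF \<phi>(1) hG(1)] by (simp add: bw power_mult)
    have "\<phi> k1 * \<phi> h ^ i = inverse (\<phi> h) ^ i * \<phi> k1" for i
    proof (induction i)
      case (Suc i)
      have "\<phi> k1 * \<phi> h ^ Suc i = (\<phi> k1 * \<phi> h ^ i) * \<phi> h" by (simp only: power_Suc2 mult.assoc)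
      also have "\<dots> = inverse (\<phi> h) ^ i * (\<phi> k1 * \<phi> h)" unfolding Suc by (simp only: mult.assoc)
      also have "\<dots> = inverse (\<phi> h) ^ Suc i * \<phi> k1" unfolding inv power_Suc2 by (simp only: mult.assoc)
      finally show ?case .
    qed simp
    then show "\<phi> k1 * \<phi> (h ^ 2 ^ b) = inverse (\<phi> (h ^ 2 ^ b)) * \<phi> k1"
      using hm_power[OF \<phi>(1) hG(1)] by (simp add: power_inverse)
  qed
  then have ub: "\<phi> u ^ 2 ^ b = 1" using hm_power[OF \<phi>(1) hG(1)] \<phi>u by simp
  then have "\<phi> (u ^ 2 ^ b) = 1" using hm_power[OF \<phi>(1) uG, of "2 ^ b"] by simp
  then have "u ^ 2 ^ b \<in> N" using \<phi>(2)[of "u ^ 2 ^ b"] uG sG by simp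
  then have "(u ^ 2 ^ b) ^ card N = 1" using power_card sN by blast
  then have "(u ^ card N) ^ (2 ^ b) = 1" by (simp add: mult.commute flip: power_mult)
  moreover define A where "A = pset H N"
  have A: "sgrp A" "A \<subseteq> G" using pset_nrm_sgrp[OF sG sH HG N(1)] pset_least[OF sG HG NG] by (auto simp: A_def)
  moreover have "u ^ card N \<in> A" using u g(4) A by (simp add: A_def)
  moreover have "card (rcoss H A) dvd card N"
    by (rule card_rcoss_dvd[OF sH sN]) (use pset_superset[OF sH sN] in \<open>auto simp: A_def elim!: psetE\<close>)
  then have "\<not> 2 dvd card (rcoss H A)" using N(2) by (metis dvd_trans)
  ultimately obtain x where x: "x \<in> A" "x * u ^ card N * inverse x \<in> H"
    using conj_into[OF sH, of A "u ^ card N" 2 b] two_is_prime_nat by metis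
  then have "u ^ card N = 1" using semiregular[OF K1, of x "card N"] A by (auto simp: u_def)
  then have "\<phi> u ^ card N = 1" using hm_power[OF \<phi>(1) uG] hm_one[OF \<phi>(1)] by metis
  then have "\<phi> u = 1" using coprime_powers_eq_one[OF ub] N(2) by simp
  then have "u \<in> N" using \<phi>(2) uG by blast
  then have "inverse g * u * g \<in> N" using nrm_conj'[OF N(1) sG g(1)] by blast
  then show ?thesis by (simp add: u mult.assoc)
qed

end

section \<open>Prime power parts of elements, and 2-nilpotent groups\<close>

lemma prime_order_power:
  assumes "(v::'a::grp) \<noteq> 1" "v ^ n = 1" "n > 0"
  shows "\<exists>q j. prime q \<and> q dvd n \<and> v ^ j \<noteq> 1 \<and> (v ^ j) ^ q = 1"
  using assms(2,3)
proof (induction n rule: less_induct)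
  case (less n)
  have "n \<noteq> 1" using less assms(1) by auto
  then obtain q where q: "prime q" "q dvd n" using prime_factor_nat by blast
  then obtain m where m: "n = m * q" by (metis dvd_def mult.commute)
  show ?case
  proof (cases "v ^ m = 1")
    case True
    have "m > 0" "m < n" using m less.prems(2) prime_gt_1_nat[OF q(1)] by auto
    then obtain p j where "prime p" "p dvd m" "v ^ j \<noteq> 1" "(v ^ j) ^ p = 1" using less.IH True by blast
    then show ?thesis using m by (metis dvd_mult2)
  next
    case False
    then show ?thesis using q less.prems(1) by (metis m power_mult)
  qed
qed

lemma bezout_power:
  assumes "coprime m n" "m > 0" obtains a b where "(x::'a::grp) ^ (m * a) = x ^ (n * b) * x"
proof -
  obtain a b where "m * a = n * b + gcd m n" using bezout_nat[of m n] assms(2) by auto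
  then have "m * a = Suc (n * b)" using assms(1) by simp
  then have "x ^ (m * a) = x ^ (n * b) * x" by (simp only: power_Suc2)
  then show thesis using that by blast
qed

lemma coprime_power_mem:
  assumes "sgrp M" "x ^ m \<in> M" "x ^ n \<in> M" "coprime m n" "m > 0" shows "(x::'a::grp) \<in> M"
proof -
  obtain a b where "x ^ (m * a) = x ^ (n * b) * x" using bezout_power[OF assms(4,5)] by blast
  then have "x = inverse ((x ^ n) ^ b) * (x ^ m) ^ a" by (simp add: power_mult)
  also have "\<dots> \<in> M" using assms by simp
  finally show ?thesis .
qed

text \<open>An element is a product of powers of itself of prime power order; if all of these were
  in \<open>M\<close>, so would be the element.\<close>

lemma prime_power_part_notin:
  assumes M: "sgrp M" and "(x::'a::grp) \<notin> M" "x ^ n = 1" "n > 0"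
  shows "\<exists>q f j. prime q \<and> q dvd n \<and> x ^ j \<notin> M \<and> (x ^ j) ^ (q ^ f) = 1"
  using assms(2-)
proof (induction n arbitrary: x rule: less_induct)
  case (less n)
  have "n \<noteq> 1" using less M by auto
  then obtain q where q: "prime q" "q dvd n" using prime_factor_nat by blast
  then have "\<not> is_unit q" using not_prime_unit by blast
  then obtain m where m: "n = q ^ multiplicity q n * m" "\<not> q dvd m"
    using multiplicity_decompose'[of n q] less.prems(3) by blast
  define f where "f = multiplicity q n"
  have "f \<noteq> 0" using m q by (intro notI) (simp add: f_def)
  have n: "n = q ^ f * m" using m f_def by simp
  have m0: "m > 0" using n less.prems(3) by (metis gr0I mult_0_right)
  have "1 < q ^ f" using one_less_power[OF prime_gt_1_nat[OF q(1)], of f] \<open>f \<noteq> 0\<close> by blast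
  then have "m < n" using n m0 by simp
  show ?case
  proof (cases "x ^ m \<in> M")
    case False
    have "(x ^ m) ^ (q ^ f) = 1" using less.prems(2) n by (simp add: mult.commute flip: power_mult)
    then show ?thesis using q False by blast
  next
    case True
    show ?thesis
    proof (cases "x ^ (q ^ f) \<in> M")
      case True
      have "coprime m (q ^ f)" using m(2) q(1) by (metis coprime_commute prime_imp_coprime coprime_power_right_iff)
      then show ?thesis using coprime_power_mem[OF M \<open>x ^ m \<in> M\<close> True _ m0] less.prems by blast
    next
      case False
      have "(x ^ (q ^ f)) ^ m = 1" using less.prems(2) n by (simp flip: power_mult)
      then obtain p e j where "prime p" "p dvd m" "(x ^ (q ^ f)) ^ j \<notin> M" "((x ^ (q ^ f)) ^ j) ^ (p ^ e) = 1"
        using less.IH[OF \<open>m < n\<close> False _ m0] by blast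
      then show ?thesis by (metis n dvd_mult power_mult)
    qed
  qed
qed

text \<open>The cosets of \<open>M\<close> correspond to the elements of the image of
  \<open>G\<close> under a homomorphism with kernel \<open>M\<close>, and this image is a
  2-group.\<close>

lemma quotient_prime_dvd:
  assumes "sgrp G" "nrm M G" "\<And>g. g \<in> G \<Longrightarrow> \<exists>a. g ^ (2 ^ a) \<in> M" "prime q" "q dvd card (rcoss M G)"
  shows "q = 2"
proof -
  obtain \<phi> :: "'a \<Rightarrow> nat perm" where \<phi>: "hm \<phi> G" "\<And>g. g \<in> G \<Longrightarrow> \<phi> g = 1 \<longleftrightarrow> g \<in> M"
    using quotient_perm[OF assms(1,2)] by metis
  have "rcos M b = rcos M c \<longleftrightarrow> \<phi> b = \<phi> c" if "b \<in> G" "c \<in> G" for b c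
    using that hm_eq_iff[OF \<phi>(1), of c b] \<phi>(2)[of "c * inverse b"] rcos_eq_iff[OF nrm_sgrp[OF assms(2)], of b c] assms(1)
    by auto
  then have "bij_betw (\<lambda>C. \<phi> (SOME b. b \<in> G \<and> rcos M b = C)) (rcoss M G) (\<phi> ` G)"
  proof -
    assume e: "\<And>b c. \<lbrakk>b \<in> G; c \<in> G\<rbrakk> \<Longrightarrow> rcos M b = rcos M c \<longleftrightarrow> \<phi> b = \<phi> c"
    have s: "(SOME b. b \<in> G \<and> rcos M b = rcos M c) \<in> G \<and> rcos M (SOME b. b \<in> G \<and> rcos M b = rcos M c) = rcos M c"
      if "c \<in> G" for c
      by (rule someI[of _ c]) (simp add: that)
    have v: "\<phi> (SOME b. b \<in> G \<and> rcos M b = rcos M c) = \<phi> c" if "c \<in> G" for c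
      using e[of "SOME b. b \<in> G \<and> rcos M b = rcos M c" c] s[OF that] that by blast
    show ?thesis
      unfolding bij_betw_def rcoss_def image_image
    proof
      show "inj_on (\<lambda>C. \<phi> (SOME b. b \<in> G \<and> rcos M b = C)) (rcos M ` G)"
      proof (rule inj_onI)
        fix B C assume "B \<in> rcos M ` G" "C \<in> rcos M ` G"
          and eq: "\<phi> (SOME b. b \<in> G \<and> rcos M b = B) = \<phi> (SOME b. b \<in> G \<and> rcos M b = C)"
        then obtain b c where bc: "b \<in> G" "c \<in> G" "B = rcos M b" "C = rcos M c" by blast
        then have "\<phi> b = \<phi> c" using eq v by simp
        then show "B = C" using e bc by simp
      qed
      show "(\<lambda>x. \<phi> (SOME b. b \<in> G \<and> rcos M b = rcos M x)) ` G = \<phi> ` G"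
        by (rule image_cong) (simp_all add: v)
    qed
  qed
  then have c: "card (rcoss M G) = card (\<phi> ` G)" by (rule bij_betw_same_card)
  have "\<exists>a. \<phi> g ^ (2 ^ a) = 1" if g: "g \<in> G" for g
  proof -
    obtain a where "g ^ (2 ^ a) \<in> M" using assms(3)[OF g] by blast
    then have "\<phi> (g ^ (2 ^ a)) = 1" using \<phi>(2) g assms(1) by simp
    then show ?thesis using hm_power[OF \<phi>(1) g] by metis
  qed
  then have "pgrp 2 (\<phi> ` G)"
    using hm_image_sgrp[OF \<phi>(1) assms(1)] by (auto simp: pgrp_def)
  then show ?thesis using pgrp_prime_dvd two_is_prime_nat assms(4,5) c by metis
qed

text \<open>The existence of a normal 2-complement, with solvability of the complement
  included.\<close>

definition two_nilpotent :: "'a::grp set \<Rightarrow> bool" where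
  "two_nilpotent G \<longleftrightarrow> (\<exists>N. nrm N G \<and> odd_sol N \<and> (\<forall>g\<in>G. \<exists>a. g ^ (2 ^ a) \<in> N))"

lemma two_nilpotent_pgrp2: "pgrp 2 G \<Longrightarrow> two_nilpotent G"
  unfolding two_nilpotent_def
  by (rule exI[of _ "{1}"]) (auto simp: pgrp_def odd_sol_trivial intro: nrmI)

lemma two_nilpotent_sol:
  assumes "sgrp G" "two_nilpotent G" shows "sol G"
proof -
  obtain N where N: "nrm N G" "odd_sol N" "\<And>g. g \<in> G \<Longrightarrow> \<exists>a. g ^ (2 ^ a) \<in> N"
    using assms(2) by (auto simp: two_nilpotent_def)
  obtain \<phi> :: "'a \<Rightarrow> nat perm" where \<phi>: "hm \<phi> G" "\<And>g. g \<in> G \<Longrightarrow> \<phi> g = 1 \<longleftrightarrow> g \<in> N"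
    using quotient_perm[OF assms(1) N(1)] by metis
  have "\<exists>a. \<phi> g ^ (2 ^ a) = 1" if g: "g \<in> G" for g
  proof -
    obtain a where "g ^ (2 ^ a) \<in> N" using N(3)[OF g] by blast
    then have "\<phi> (g ^ (2 ^ a)) = 1" using \<phi>(2) g assms(1) by simp
    then show ?thesis using hm_power[OF \<phi>(1) g] by metis
  qed
  then have "pgrp 2 (\<phi> ` G)"
    using hm_image_sgrp[OF \<phi>(1) assms(1)] by (auto simp: pgrp_def)
  then show ?thesis
    using sol_extension[OF \<phi>(1) sol_pgrp2, of N] N(2) \<phi>(2) by (auto simp: odd_sol_def)
qed

lemma two_nilpotent_extension:
  assumes \<phi>: "hm \<phi> G" "\<And>g. \<lbrakk>g \<in> G; \<phi> g = 1\<rbrakk> \<Longrightarrow> g \<in> N" and N: "odd_sol N" and t: "two_nilpotent (\<phi> ` G)"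
  shows "two_nilpotent G"
proof -
  have G: "sgrp G" using \<phi>(1) by (simp add: hm_def)
  obtain B where B: "nrm B (\<phi> ` G)" "odd_sol B" "\<And>g. g \<in> \<phi> ` G \<Longrightarrow> \<exists>a. g ^ (2 ^ a) \<in> B"
    using t by (auto simp: two_nilpotent_def)
  define A where "A = {g \<in> G. \<phi> g \<in> B}"
  have A: "nrm A G" unfolding A_def by (rule hm_nrm_vimage[OF \<phi>(1) B(1)])
  have sA: "sgrp A" using A nrm_sgrp by blast
  have "odd (card A)"
  proof (rule odd_cardI[OF sA])
    fix x assume x: "x \<in> A"
    then have "\<phi> x ^ card B = 1" using power_card B(2) by (auto simp: A_def odd_sol_def)
    then have "\<phi> (x ^ card B) = 1" using hm_power[OF \<phi>(1)] x by (simp add: A_def)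
    then have "x ^ card B \<in> N" using \<phi>(2) x G by (simp add: A_def)
    then have "x ^ (card B * card N) = 1" using power_card N by (auto simp: odd_sol_def power_mult)
    then show "\<exists>n. odd n \<and> x ^ n = 1" using B(2) N by (metis odd_sol_def even_mult_iff)
  qed
  moreover have "sol A"
  proof (rule sol_extension[of \<phi> A N])
    show "hm \<phi> A" by (rule hm_mono[OF \<phi>(1) sA]) (auto simp: A_def)
    have "\<phi> ` A \<subseteq> B" by (auto simp: A_def)
    then show "sol (\<phi> ` A)" using B(2) sol_mono by (auto simp: odd_sol_def)
    show "sol N" using N by (simp add: odd_sol_def)
    show "g \<in> N" if "g \<in> A" "\<phi> g = 1" for g using that \<phi>(2) by (simp add: A_def)
  qed
  ultimately have "odd_sol A" using sA by (simp add: odd_sol_def)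
  moreover have "\<exists>a. g ^ (2 ^ a) \<in> A" if g: "g \<in> G" for g
  proof -
    obtain a where "\<phi> g ^ (2 ^ a) \<in> B" using B(3) g by blast
    then have "\<phi> (g ^ (2 ^ a)) \<in> B" using hm_power[OF \<phi>(1) g] by simp
    then show ?thesis using g G by (auto simp: A_def)
  qed
  ultimately show ?thesis using A unfolding two_nilpotent_def by blast
qed

text \<open>The odd part of a 2-nilpotent group consists of its elements of odd order, hence is characteristic.\<close>

lemma two_nilpotent_odd_part:
  assumes M: "sgrp M" "nrm L M" and t: "two_nilpotent L"
  obtains N where "nrm N M" "N \<subseteq> L" "odd_sol N" "\<And>g. g \<in> L \<Longrightarrow> \<exists>a. g ^ (2 ^ a) \<in> N"
proof -
  obtain N where N: "nrm N L" "odd_sol N" "\<And>g. g \<in> L \<Longrightarrow> \<exists>a. g ^ (2 ^ a) \<in> N"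
    using t by (auto simp: two_nilpotent_def)
  have sN: "sgrp N" using N nrm_sgrp by blast
  have "nrm N M"
  proof (rule nrmI[OF sN])
    show "N \<subseteq> M" using nrm_subset[OF N(1)] nrm_subset[OF M(2)] by blast
    fix g n assume gn: "g \<in> M" "n \<in> N"
    define y where "y = g * n * inverse g"
    have y: "y \<in> L" using nrm_conj[OF M(2)] gn nrm_subset[OF N(1)] by (auto simp: y_def)
    obtain a where a: "y ^ (2 ^ a) \<in> N" using N(3)[OF y] by blast
    have "y ^ card N = 1" unfolding y_def conj_power using power_card[OF sN gn(2)] by simp
    then have "y ^ card N \<in> N" using sN by simp
    moreover have "coprime (2 ^ a) (card N)" using N(2) by (simp add: odd_sol_def)
    ultimately have "y \<in> N" using coprime_power_mem[OF sN a] by simp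
    then show "g * n * inverse g \<in> N" by (simp add: y_def)
  qed
  then show thesis using that nrm_subset[OF N(1)] N by blast
qed

context bruck
begin

text \<open>The elements \<open>k \<tau>\<close> of the extension of \<open>G\<close> by \<open>\<tau>\<close> form a normal set of involutions
  with products \<open>(k \<tau>) (l \<tau>) = k l\<^sup>-\<^sup>1\<close>. The extension is realised by permutations of \<open>G\<close>.\<close>

lemma two_group:
  assumes two: "\<And>k l. \<lbrakk>k \<in> K; l \<in> K\<rbrakk> \<Longrightarrow> \<exists>a. (k * inverse l) ^ (2 ^ a) = 1"
  shows "pgrp 2 G"
proof -
  \<comment> \<open>The Boolean \<open>e\<close> is the exponent of \<tau>: \<open>F a e\<close>
    applies \<tau> if \<open>e\<close> holds, multiplies by \<open>a\<close> on the left, and is the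
    identity off \<open>G\<close>. Hence exponents add as \<open>e \<noteq> f\<close>.\<close>
  define F where "F = (\<lambda>a e x. if x \<in> G then (if e then a * \<tau> x else a * x) else x)"
  define P where "P = (\<lambda>a e. Perm (F a e))"
  have FF: "F a e (F b f x) = F (a * (if e then \<tau> b else b)) (e \<noteq> f) x" if "a \<in> G" "b \<in> G" for a b e f x
    using that sG \<tau>G \<tau>\<tau> by (auto simp: F_def \<tau>_mult mult.assoc)
  have F1: "F 1 False x = x" for x by (simp add: F_def)
  have bij: "bij (F a e)" if a: "a \<in> G" for a e
  proof -
    define a' where "a' = (if e then \<tau> (inverse a) else inverse a)"
    have "a' \<in> G" using a sG \<tau>G by (simp add: a'_def)
    moreover have "a * (if e then \<tau> a' else a') = 1" "a' * (if e then \<tau> a else a) = 1"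
      using a sG \<tau>\<tau> \<tau>G by (auto simp: a'_def \<tau>_inv)
    ultimately show ?thesis
      using FF[of a a' e e] FF[of a' a e e] a F1 by (intro o_bij[of "F a' e"]) (auto simp: fun_eq_iff)
  qed
  have fin: "finite {x. F a e x \<noteq> x}" for a e
    by (rule finite_subset[of _ G]) (auto simp: F_def sgrp_finite[OF sG])
  have ap: "apply (P a e) = F a e" if "a \<in> G" for a e
    unfolding P_def by (rule Perm_inverse) (use bij[OF that] fin in simp)
  have PP: "P a e * P b f = P (a * (if e then \<tau> b else b)) (e \<noteq> f)" if "a \<in> G" "b \<in> G" for a b e f
    by (rule perm_eqI) (use that sG \<tau>G in \<open>simp add: apply_times ap FF\<close>)
  have P1: "P 1 False = 1" by (rule perm_eqI) (use sG in \<open>simp add: ap F1\<close>)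
  have Pinj: "P a False = 1 \<Longrightarrow> a = 1" if "a \<in> G" for a
  proof -
    assume "P a False = 1"
    then have "F a False 1 = 1" using ap[OF that] by (metis apply_one id_apply)
    then show ?thesis using sG by (simp add: F_def)
  qed
  define \<Gamma> where "\<Gamma> = (\<lambda>(a, e). P a e) ` (G \<times> (UNIV :: bool set))"
  have \<Gamma>: "sgrp \<Gamma>"
  proof (rule sgrpI)
    show "finite \<Gamma>" by (simp add: \<Gamma>_def sgrp_finite[OF sG])
    show "1 \<in> \<Gamma>" unfolding \<Gamma>_def by (rule image_eqI[of _ _ "(1, False)"]) (use P1 sG in auto)
    fix x y assume "x \<in> \<Gamma>" "y \<in> \<Gamma>"
    then obtain a e b f where ab: "a \<in> G" "b \<in> G" "x = P a e" "y = P b f" by (auto simp: \<Gamma>_def)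
    then have "x * y = P (a * (if e then \<tau> b else b)) (e \<noteq> f)" by (simp add: PP)
    moreover have "a * (if e then \<tau> b else b) \<in> G" using ab sG \<tau>G by simp
    ultimately show "x * y \<in> \<Gamma>" unfolding \<Gamma>_def by auto
  qed
  define T where "T = (\<lambda>k. P k True) ` K"
  have prod: "P k True * P l True = P (k * inverse l) False" if "k \<in> K" "l \<in> K" for k l
    using that inG by (simp add: PP \<tau>K)
  have inv: "t * t = 1" if "t \<in> T" for t using that P1 by (auto simp: T_def prod)
  have T\<Gamma>: "T \<subseteq> \<Gamma>" using inG by (auto simp: T_def \<Gamma>_def)
  have "pgrp 2 (gen T)"
  proof (rule baer_suzuki_involutions[OF \<Gamma> T\<Gamma> inv])
    fix s t assume "s \<in> T" "t \<in> T"
    then obtain k l where kl: "k \<in> K" "l \<in> K" "s = P k True" "t = P l True" by (auto simp: T_def)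
    have klG: "k * inverse l \<in> G" using kl inG sG by simp
    have "inverse s = s" using inv[OF \<open>s \<in> T\<close>] by (metis inv_cancel(1) mult_1_right)
    then have "s * t * inverse s = P (k * inverse l * k) True"
      using kl prod PP[OF klG inG(1)[OF kl(1)], of False True] by simp
    moreover have "k * inverse l * k \<in> K" using tw invK kl by blast
    ultimately show "s * t * inverse s \<in> T" by (simp add: T_def)
    have pw: "(P (k * inverse l) False) ^ n = P ((k * inverse l) ^ n) False" for n
      using klG sG by (induction n) (simp_all add: P1 PP)
    obtain a where "(k * inverse l) ^ (2 ^ a) = 1" using two kl by blast
    then have "(s * t) ^ (2 ^ a) = 1" using kl by (simp add: prod pw P1)
    then show "\<exists>a. (s * t) ^ (2 ^ a) = 1" by blast
  qed
  then have sT: "sgrp (gen T)" and pT: "\<And>v. v \<in> gen T \<Longrightarrow> \<exists>a. v ^ (2 ^ a) = 1" by (auto simp: pgrp_def)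
  define Lm where "Lm = (\<lambda>a. P a False)"
  have hl: "hm Lm G" using sG by (simp add: hm_def Lm_def PP)
  have "Lm ` K \<subseteq> gen T"
  proof
    fix x assume "x \<in> Lm ` K"
    then obtain k where k: "k \<in> K" "x = P k False" by (auto simp: Lm_def)
    then have "x = P k True * P 1 True" using prod[of k 1] oneK by simp
    moreover have "P k True \<in> gen T" "P 1 True \<in> gen T" using k oneK gen_incl[of T] by (auto simp: T_def)
    ultimately show "x \<in> gen T" using sT by simp
  qed
  then have sub: "Lm ` G \<subseteq> gen T" using hm_gen[OF hl KG] gen_least[OF sT] gK by metis
  have "\<exists>a. g ^ (2 ^ a) = 1" if g: "g \<in> G" for g
  proof -
    obtain a where "Lm g ^ (2 ^ a) = 1" using pT sub g by blast
    then have "Lm (g ^ (2 ^ a)) = 1" using hm_power[OF hl g] by simp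
    then show ?thesis using Pinj[of "g ^ (2 ^ a)"] g sG by (auto simp: Lm_def)
  qed
  then show ?thesis using sG by (simp add: pgrp_def)
qed

text \<open>If some \<open>k * inverse l\<close> were not a 2-element, one of its powers would have
  odd prime order \<open>q\<close>. As \<open>q\<close> divides neither index, that power can be
  conjugated first into \<open>A\<close> and then into \<open>H\<close>, against
  \<open>semiregular\<close>. So \<open>two_group\<close> applies.\<close>

lemma index_two_group:
  assumes A: "sgrp A" "H \<subseteq> A" "A \<subseteq> G"
    and q1: "\<And>q. \<lbrakk>prime q; q dvd card (rcoss H A)\<rbrakk> \<Longrightarrow> q = 2"
    and q2: "\<And>q. \<lbrakk>prime q; q dvd card (rcoss A G)\<rbrakk> \<Longrightarrow> q = 2"
  shows "pgrp 2 G"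
proof (rule two_group, rule ccontr)
  fix k l assume kl: "k \<in> K" "l \<in> K" and n: "\<nexists>a. (k * inverse l) ^ (2 ^ a) = 1"
  define u where "u = k * inverse l"
  have uG: "u \<in> G" using kl inG sG by (simp add: u_def)
  obtain b w where bw: "card G = 2 ^ b * w" "odd w" using card_two_part[OF sG] .
  have "u ^ (2 ^ b) \<noteq> 1" using n by (auto simp: u_def)
  moreover have "(u ^ (2 ^ b)) ^ w = 1" using power_card[OF sG uG] by (simp add: bw power_mult)
  ultimately obtain q j where q: "prime q" "q dvd w" "(u ^ (2 ^ b)) ^ j \<noteq> 1" "((u ^ (2 ^ b)) ^ j) ^ q = 1"
    using prime_order_power[of "u ^ (2 ^ b)" w] bw(2) by (metis odd_pos)
  have q2': "q \<noteq> 2" using q bw(2) by auto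
  define v where "v = u ^ (2 ^ b * j)"
  have v: "v \<in> G" "v \<noteq> 1" "v ^ q = 1" using q uG sG by (simp_all add: v_def power_mult)
  obtain x where x: "x \<in> G" "x * v * inverse x \<in> A"
    using conj_into[OF A(1) sG v(1), of q 1] v(3) q(1) q2 q2' by auto
  have "(x * v * inverse x) ^ (q ^ 1) = 1" using v(3) by (simp add: conj_power)
  then obtain y where y: "y \<in> A" "y * (x * v * inverse x) * inverse y \<in> H"
    using conj_into[OF sH A(1) x(2) _ q(1)] q1 q2' q(1) by metis
  have "y * x \<in> G" using x y A sG by auto
  moreover have "(y * x) * v * inverse (y * x) \<in> H" using y by (simp add: grp_simps)
  ultimately have "v = 1" using semiregular[OF kl, of "y * x" "2 ^ b * j"] by (simp add: v_def u_def)
  then show False using v by simp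
qed

lemma odd_normal_closure_\<tau>:
  assumes "nrm A G" "odd_sol A" "A \<noteq> {1}"
  obtains N where "nrm N G" "odd_sol N" "N \<noteq> {1}" "\<tau> ` N \<subseteq> N"
proof -
  define N where "N = pset A (\<tau> ` A)"
  have AG: "A \<subseteq> G" and sA: "sgrp A" using nrm_subset[OF assms(1)] nrm_sgrp[OF assms(1)] by auto
  have \<tau>A: "nrm (\<tau> ` A) G" using hm_nrm_image[OF hm\<tau> assms(1)] by (simp add: image_\<tau>)
  have s\<tau>A: "sgrp (\<tau> ` A)" using nrm_sgrp[OF \<tau>A] .
  have N: "nrm N G" unfolding N_def by (rule nrm_pset[OF sG assms(1) \<tau>A])
  moreover have "odd_sol N"
    unfolding N_def
    by (rule odd_sol_pset[OF assms(2) hm_image_odd_sol[OF hm\<tau> inj_\<tau> AG assms(2)]])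
       (use nrm_conj'[OF \<tau>A sG] AG in blast)
  moreover have "A \<subseteq> N" unfolding N_def by (rule pset_superset(1)[OF sA s\<tau>A])
  then have "N \<noteq> {1}" using assms(3) sA sgrp_one by blast
  moreover have "\<tau> ` N \<subseteq> N"
  proof
    fix y assume "y \<in> \<tau> ` N"
    then obtain a b where ab: "a \<in> A" "b \<in> A" "y = \<tau> (a * \<tau> b)" by (auto simp: N_def elim!: psetE)
    then have "a \<in> G" "b \<in> G" using AG by auto
    then have "y = \<tau> a * b" using ab \<tau>G \<tau>\<tau> by (simp add: \<tau>_mult)
    moreover have "\<tau> a \<in> N" "b \<in> N" using ab pset_superset[OF sA s\<tau>A] by (auto simp: N_def)
    ultimately show "y \<in> N" using nrm_sgrp[OF N] by simp
  qed
  ultimately show thesis using that by blast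
qed

text \<open>Since \<open>\<tau>\<close> acts trivially on \<open>R / \<Phi>(R)\<close>, where \<open>\<Phi>(R)\<close> is the Frattini subgroup, so does
  \<open>c\<^sup>2 = c \<tau>(c)\<^sup>-\<^sup>1\<close>, and therefore \<open>c\<close>.\<close>

lemma odd_element_centralizes:
  assumes R: "nrm R G" "pgrp 2 R" "\<tau> ` R \<subseteq> R"
    and gen: "\<And>n. n \<in> R \<Longrightarrow> \<exists>h\<in>H. \<exists>x\<in>gen (K \<inter> R). n = h * x"
    and c: "c \<in> K" "c ^ (q ^ f) = 1" "prime q" "q \<noteq> 2"
    and n: "n \<in> R"
  shows "c * n = n * c"
proof -
  have sR: "sgrp R" and RG: "R \<subseteq> G" using nrm_sgrp[OF R(1)] nrm_subset[OF R(1)] by auto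
  have cG: "c \<in> G" using c inG by blast
  define \<A> where "\<A> = {A. sgrp A \<and> A \<subset> R \<and> (\<forall>v\<in>R. \<forall>u\<in>A. v * u * inverse v \<in> A) \<and>
    (\<forall>x\<in>R. \<forall>y\<in>R. x \<notin> A \<longrightarrow> y \<notin> A \<longrightarrow> x * y \<in> A)}"
  \<comment> \<open>\<A> consists of the normal subgroups of index two in \<open>R\<close>. For
    \<open>R = {1}\<close> it is empty, and the condition \<open>n \<in> R\<close> keeps \<Phi>
    inside \<open>R\<close>.\<close>
  define \<Phi> where "\<Phi> = {n \<in> R. \<forall>A\<in>\<A>. n \<in> A}"
  have conjA: "{x \<in> R. g * x * inverse g \<in> A} \<in> \<A>" if g: "g \<in> G" and A: "A \<in> \<A>" for g A
  proof -
    have A': "sgrp A" "A \<subset> R" "\<And>v u. \<lbrakk>v \<in> R; u \<in> A\<rbrakk> \<Longrightarrow> v * u * inverse v \<in> A"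
      "\<And>x y. \<lbrakk>x \<in> R; y \<in> R; x \<notin> A; y \<notin> A\<rbrakk> \<Longrightarrow> x * y \<in> A"
      using A unfolding \<A>_def by blast+
    have cj: "g * x * inverse g \<in> R" if "x \<in> R" for x using nrm_conj[OF R(1) g that] .
    have mm: "g * (x * y) * inverse g = (g * x * inverse g) * (g * y * inverse g)" for x y by (simp add: grp_simps)
    define A2 where "A2 = {x \<in> R. g * x * inverse g \<in> A}"
    have "A2 \<in> \<A>"
      unfolding \<A>_def
    proof (intro CollectI conjI ballI impI)
      show "sgrp A2"
        using sR A'(1) sgrp_finite[OF sR] unfolding A2_def by (intro sgrpI) (auto simp: mm)
      obtain r where r: "r \<in> R" "r \<notin> A" using A' by blast
      have "inverse g * r * g \<in> R" using nrm_conj'[OF R(1) sG g r(1)] .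
      moreover have "g * (inverse g * r * g) * inverse g = r" by (simp add: mult.assoc)
      ultimately show "A2 \<subset> R" using r unfolding A2_def by force
    next
      fix v u assume vu: "v \<in> R" "u \<in> A2"
      have "g * (v * u * inverse v) * inverse g
          = (g * v * inverse g) * (g * u * inverse g) * inverse (g * v * inverse g)" by (simp add: grp_simps)
      then show "v * u * inverse v \<in> A2"
        using vu A'(3)[OF cj] sR by (simp add: A2_def)
    next
      fix x y assume "x \<in> R" "y \<in> R" "x \<notin> A2" "y \<notin> A2"
      then show "x * y \<in> A2" using A'(4)[OF cj cj] sR by (simp add: mm A2_def)
    qed
    then show ?thesis by (simp add: A2_def)
  qed
  have s\<Phi>: "sgrp \<Phi>"
    by (rule sgrpI) (use sR sgrp_finite[OF sR] in \<open>auto simp: \<Phi>_def \<A>_def\<close>)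
  have n\<Phi>: "nrm \<Phi> G"
  proof (rule nrmI[OF s\<Phi>])
    show "\<Phi> \<subseteq> G" using RG by (auto simp: \<Phi>_def)
    fix g n assume g: "g \<in> G" "n \<in> \<Phi>"
    then have "g * n * inverse g \<in> A" if "A \<in> \<A>" for A using conjA[OF g(1) that] by (auto simp: \<Phi>_def)
    then show "g * n * inverse g \<in> \<Phi>" using nrm_conj[OF R(1) g(1)] g(2) by (simp add: \<Phi>_def)
  qed
  \<comment> \<open>Modulo a subgroup \<open>A\<close> of index two, an element of
    \<open>K \<inter> R\<close> is congruent to its inverse, which is its image under \<tau>;
    elements of \<open>H\<close> are fixed by \<tau> anyway.\<close>
  have \<tau>\<Phi>: "\<tau> n * inverse n \<in> \<Phi>" if n: "n \<in> R" for n
    unfolding \<Phi>_def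
  proof (intro CollectI conjI ballI)
    show "\<tau> n * inverse n \<in> R" using R(3) n sR by auto
    fix A assume A: "A \<in> \<A>"
    then have A': "sgrp A" "A \<subset> R" "\<And>v u. \<lbrakk>v \<in> R; u \<in> A\<rbrakk> \<Longrightarrow> v * u * inverse v \<in> A"
      "\<And>x y. \<lbrakk>x \<in> R; y \<in> R; x \<notin> A; y \<notin> A\<rbrakk> \<Longrightarrow> x * y \<in> A"
      unfolding \<A>_def by blast+
    have gR: "gen (K \<inter> R) \<subseteq> R" by (rule gen_least[OF sR]) blast
    have gx: "\<tau> x * inverse x \<in> A" if "x \<in> gen (K \<inter> R)" for x
      using that sR Int_lower2[of K R]
    proof (induction rule: gen_induct)
      case one
      show ?case using hm_one[OF hm\<tau>] A'(1) by simp
    next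
      case (incl s)
      then have s: "s \<in> R" "inverse s \<in> R" "\<tau> s = inverse s" using sR by (auto simp: \<tau>K)
      show ?case
      proof (cases "s \<in> A")
        case True
        then show ?thesis using A'(1) s by simp
      next
        case False
        then have "inverse s \<notin> A" using sgrp_inv[OF A'(1), of "inverse s"] by auto
        then show ?thesis using A'(4)[of "inverse s" "inverse s"] s by simp
      qed
    next
      case (mult x y)
      have xy: "x \<in> R" "y \<in> R" "\<tau> x \<in> R" "x \<in> G" "y \<in> G" using mult(1,2) gR R(3) RG by auto
      have "\<tau> (x * y) * inverse (x * y) = (\<tau> x * (\<tau> y * inverse y) * inverse (\<tau> x)) * (\<tau> x * inverse x)"
        using xy by (simp add: \<tau>_mult grp_simps)
      then show ?case using A'(3)[OF xy(3) mult(4)] mult(3) A'(1) by simp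
    qed
    obtain h x where hx: "h \<in> H" "x \<in> gen (K \<inter> R)" "n = h * x" using gen[OF n] by blast
    have xR: "x \<in> R" "x \<in> G" using hx gR RG by auto
    have "h = n * inverse x" using hx by (simp add: mult.assoc)
    then have hR: "h \<in> R" using n xR sR by simp
    have "\<tau> n * inverse n = h * (\<tau> x * inverse x) * inverse h" using hx xR inG by (simp add: \<tau>_mult \<tau>H grp_simps)
    then show "\<tau> n * inverse n \<in> A" using A'(3)[OF hR gx[OF hx(2)]] by simp
  qed
  obtain \<psi> :: "'a \<Rightarrow> nat perm" where \<psi>: "hm \<psi> G" "\<And>g. g \<in> G \<Longrightarrow> \<psi> g = 1 \<longleftrightarrow> g \<in> \<Phi>"
    using quotient_perm[OF sG n\<Phi>] by metis
  note m = hm_mult[OF \<psi>(1)] and i = hm_inv[OF \<psi>(1)]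
  have \<psi>\<tau>: "\<psi> (\<tau> n) = \<psi> n" if "n \<in> R" for n
    using hm_eq_iff[OF \<psi>(1), of "\<tau> n" n] \<psi>(2)[of "\<tau> n * inverse n"] \<tau>\<Phi>[OF that] that RG \<tau>G sG by auto
  have comm: "\<psi> c * \<psi> n = \<psi> n * \<psi> c" if nR: "n \<in> R" for n
  proof -
    have nG: "n \<in> G" using nR RG by blast
    have n'R: "inverse c * n * c \<in> R" using nrm_conj'[OF R(1) sG cG nR] .
    have "inverse (\<psi> c) * \<psi> n * \<psi> c = \<psi> (inverse c * n * c)" using nG cG sG by (simp add: m i)
    also have "\<dots> = \<psi> (\<tau> (inverse c * n * c))" using \<psi>\<tau>[OF n'R] by simp
    also have "\<tau> (inverse c * n * c) = c * \<tau> n * inverse c" using nG cG sG c(1) by (simp add: \<tau>_mult \<tau>_inv \<tau>K)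
    also have "\<psi> \<dots> = \<psi> c * \<psi> n * inverse (\<psi> c)" using nG cG sG \<tau>G \<psi>\<tau>[OF nR] by (simp add: m i)
    finally have "\<psi> c * (inverse (\<psi> c) * \<psi> n * \<psi> c) * \<psi> c = \<psi> c * (\<psi> c * \<psi> n * inverse (\<psi> c)) * \<psi> c" by simp
    then have "(\<psi> c * \<psi> c) * \<psi> n = \<psi> n * (\<psi> c * \<psi> c)" by (simp add: mult.assoc)
    then have sq: "(\<psi> c ^ 2) ^ j * \<psi> n = \<psi> n * (\<psi> c ^ 2) ^ j" for j
      unfolding power2_eq_square by (rule power_commuting_commutes)
    have "odd (q ^ f)" using c(3,4) by (simp add: prime_odd_nat prime_ge_2_nat order.not_eq_order_implies_strict)
    then have "coprime 2 (q ^ f)" by simp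
    then obtain a b where "\<psi> c ^ (2 * a) = \<psi> c ^ (q ^ f * b) * \<psi> c"
      using bezout_power[of 2 "q ^ f" "\<psi> c"] by auto
    moreover have "\<psi> c ^ (q ^ f) = 1" using hm_power[OF \<psi>(1) cG, of "q ^ f"] c(2) hm_one[OF \<psi>(1)] by simp
    ultimately have "(\<psi> c ^ 2) ^ a = \<psi> c" by (simp add: power_mult)
    then show ?thesis using sq[of a] by simp
  qed
  define C where "C = {y \<in> R. c * y * inverse c = y}"
  have sC: "sgrp C"
  proof (rule sgrpI)
    fix x y assume "x \<in> C" "y \<in> C"
    moreover have "c * (x * y) * inverse c = (c * x * inverse c) * (c * y * inverse c)" by (simp add: grp_simps)
    ultimately show "x * y \<in> C" using sR by (simp add: C_def)
  qed (use sR sgrp_finite[OF sR] in \<open>auto simp: C_def\<close>)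
  \<comment> \<open>The passage from \<open>R / \<Phi>\<close> to \<open>R\<close>: a proper
    \<open>C\<close> lies in some \<open>A\<close> of index two. For \<open>n\<close> outside
    \<open>A\<close> the coset \<open>n \<Phi>\<close> is invariant under \<open>c\<close> and has
    2-power size, so \<open>c\<close>, of order a power of \<open>q\<close>, fixes a point of it.
    That point lies in \<open>C\<close>, hence in \<open>A\<close>, and so would \<open>n\<close>,
    since \<Phi> is contained in \<open>A\<close>.\<close>
  have "C = R"
  proof (rule ccontr)
    assume "C \<noteq> R"
    then have "C \<subset> R" by (auto simp: C_def)
    then obtain A where A: "sgrp A" "C \<subseteq> A" "A \<subset> R" "\<And>v u. \<lbrakk>v \<in> R; u \<in> A\<rbrakk> \<Longrightarrow> v * u * inverse v \<in> A"
      "\<And>x y. \<lbrakk>x \<in> R; y \<in> R; x \<notin> A; y \<notin> A\<rbrakk> \<Longrightarrow> x * y \<in> A"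
      using pgrp2_index2[OF R(2) sC] by metis
    then have AA: "A \<in> \<A>" unfolding \<A>_def by blast
    obtain n where n: "n \<in> R" "n \<notin> A" using A(3) by blast
    have nG: "n \<in> G" using n RG by blast
    define S where "S = (\<lambda>z. n * z) ` \<Phi>"
    have \<Phi>R: "\<Phi> \<subseteq> R" by (auto simp: \<Phi>_def)
    have fS: "finite S" using sgrp_finite[OF s\<Phi>] by (simp add: S_def)
    have "card S = card \<Phi>" by (simp add: S_def card_image inj_on_def)
    moreover have "\<not> q dvd card \<Phi>"
      using pgrp_prime_dvd[OF pgrp_subset[OF R(2) s\<Phi> \<Phi>R] two_is_prime_nat c(3)] c(4) by blast
    ultimately have nq: "\<not> q dvd card S" by simp
    define g where "g = (\<lambda>y. c * y * inverse c)"
    have "card S mod q = card {y \<in> S. g y = y} mod q"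
    proof (rule card_fixpoints_prime_power[OF c(3) fS])
      have "(g ^^ k) y = c ^ k * y * inverse (c ^ k)" for k y
        by (induction k) (simp_all add: g_def grp_simps power_commutes)
      then show "(g ^^ (q ^ f)) y = y" for y using c(2) by simp
      fix y assume "y \<in> S"
      then obtain z where z: "z \<in> \<Phi>" "y = n * z" by (auto simp: S_def)
      have zG: "z \<in> G" using z \<Phi>R RG by blast
      have "\<psi> (inverse n * (c * y * inverse c)) = 1"
        using nG cG zG sG comm[OF n(1)] \<psi>(2)[OF zG] z by (simp add: m i mult.assoc)
           (metis inv_cancel(1) mult.assoc right_inv comm[OF n(1)] mult_1_right)
      then have "inverse n * g y \<in> \<Phi>" using \<psi>(2) nG cG zG sG z by (simp add: g_def)
      then have "n * (inverse n * g y) \<in> S" unfolding S_def by (rule imageI)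
      then show "g y \<in> S" by simp
    qed
    then have "{y \<in> S. g y = y} \<noteq> {}" using nq by (metis card.empty mod_0 dvd_eq_mod_eq_0)
    then obtain z where z: "z \<in> \<Phi>" "g (n * z) = n * z" by (auto simp: S_def)
    have "n * z \<in> C" using z n \<Phi>R sR by (auto simp: C_def g_def)
    then have "n * z \<in> A" using A by blast
    moreover have "z \<in> A" using z AA by (auto simp: \<Phi>_def)
    ultimately have "n * z * inverse z \<in> A" using A(1) by (simp only: sgrp_mult sgrp_inv)
    then show False using n by (simp add: mult.assoc)
  qed
  then have "c * n * inverse c = n" using n by (auto simp: C_def)
  then have "c * n * inverse c * c = n * c" by simp
  then show ?thesis by (simp add: mult.assoc)
qed

end

lemma card_pos: "sgrp A \<Longrightarrow> card A > 0"
  using sgrp_finite sgrp_one by (metis card_gt_0_iff empty_iff)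

lemma card_rcoss_mult:
  assumes "sgrp A" "sgrp B" "sgrp C" "A \<subseteq> B" "B \<subseteq> C"
  shows "card (rcoss A C) = card (rcoss B C) * card (rcoss A B)"
proof -
  have "card (rcoss A C) * card A = card C" "card (rcoss B C) * card B = card C" "card (rcoss A B) * card A = card B"
    using lagrange_rcoss assms by blast+
  then have "card (rcoss A C) * card A = (card (rcoss B C) * card (rcoss A B)) * card A"
    by (simp add: mult.assoc)
  then show ?thesis using card_pos[OF assms(1)] by simp
qed

context folder
begin

lemma card_K: assumes A: "sgrp A" "H \<subseteq> A" "A \<subseteq> G" shows "card (K \<inter> A) = card (rcoss H A)"
proof -
  have "bij_betw (rcos H) (K \<inter> A) (rcoss H A)"
    unfolding bij_betw_def
  proof
    show "inj_on (rcos H) (K \<inter> A)"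
    proof (rule inj_onI)
      fix k l assume "k \<in> K \<inter> A" "l \<in> K \<inter> A" "rcos H k = rcos H l"
      then show "k = l" using rcos_eq_iff[OF sH, of k l] sharp1[of l k] by simp
    qed
    have "rcoss H A = rcoss H (K \<inter> A)" using rcoss_eq[OF sH] subfolder_factor[OF A] by blast
    then show "rcos H ` (K \<inter> A) = rcoss H A" by (simp add: rcoss_def)
  qed
  then show ?thesis by (rule bij_betw_same_card)
qed

lemma dhull_proper: assumes "lsol H K" "\<not> K \<subseteq> {1}" shows "dhull \<noteq> G"
proof
  assume "dhull = G"
  then have "dl H K = K" using dl_hull KG by auto
  then show False using lsol_dl_proper[OF assms] by simp
qed

end

section \<open>Solvable loops have 2-nilpotent enveloping groups\<close>

context bruck
begin

lemma odd_quotient: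
  assumes N: "nrm N G" "odd_sol N" "N \<noteq> {1}" "\<tau> ` N \<subseteq> N"
  obtains \<phi> :: "'a \<Rightarrow> nat perm" and \<tau>' where "sharp_hm \<phi>" "\<And>g. g \<in> G \<Longrightarrow> \<phi> g = 1 \<longleftrightarrow> g \<in> N"
    "bruck (\<phi> ` G) (\<phi> ` H) (\<phi> ` K) \<tau>'" "card (\<phi> ` G) < card G"
proof -
  have o: "odd (card N)" using N(2) by (simp add: odd_sol_def)
  obtain \<phi> :: "'a \<Rightarrow> nat perm" and \<tau>' where \<phi>: "sharp_hm \<phi>" "\<And>g. g \<in> G \<Longrightarrow> \<phi> g = 1 \<longleftrightarrow> g \<in> N"
    "bruck (\<phi> ` G) (\<phi> ` H) (\<phi> ` K) \<tau>'"
  proof (rule quotient_bruck[OF N(1,4)])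
    show "k * inverse l \<in> N" if "g \<in> G" "k \<in> K" "l \<in> K" "g * k * inverse l * inverse g \<in> pset H N" for g k l
      by (rule odd_sharp[OF N(1) o N(4) that])
  qed blast
  obtain n where n: "n \<in> N" "n \<noteq> 1" using N(3) nrm_sgrp[OF N(1)] sgrp_one by blast
  have nG: "n \<in> G" using n nrm_subset[OF N(1)] by blast
  have "hm \<phi> G" using \<phi>(1) by (simp add: sharp_hm_def)
  then have "card (\<phi> ` G) < card G" using card_image_hm_less nG n \<phi>(2) by blast
  then show thesis using that \<phi> by blast
qed

text \<open>The normal 2-complement of \<open>gen (K \<inter> M)\<close> is normal in
  \<open>M\<close>, which is normal in \<open>G\<close>; it therefore lies in an odd solvable normal
  subgroup of \<open>G\<close>, and these are trivial.\<close>

lemma subbruck_two_group: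
  assumes M: "sgrp M" "H \<subseteq> M" "M \<subseteq> G" "comms G \<subseteq> M" and t: "two_nilpotent (gen (K \<inter> M))"
    and no_odd: "\<And>A. \<lbrakk>nrm A G; odd_sol A\<rbrakk> \<Longrightarrow> A = {1}"
  shows "pgrp 2 (gen (K \<inter> M))"
proof -
  interpret S: folder "gen (K \<inter> M)" "H \<inter> gen (K \<inter> M)" "K \<inter> M" by (rule subfolder[OF M(1-3)])
  obtain N where N: "nrm N M" "N \<subseteq> gen (K \<inter> M)" "odd_sol N" "\<And>g. g \<in> gen (K \<inter> M) \<Longrightarrow> \<exists>a. g ^ (2 ^ a) \<in> N"
    using two_nilpotent_odd_part[OF M(1) subfolder_nrm[OF M(1-3)] t] by metis
  obtain N' where "nrm N' G" "odd_sol N'" "N \<subseteq> N'"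
    using odd_sol_normal_closure[OF sG nrm_comms[OF M(1,4,3)] N(1,3)] by metis
  then have "N \<subseteq> {1}" using no_odd by blast
  then show ?thesis using N(4) S.sG by (fastforce simp: pgrp_def)
qed

text \<open>\<open>G / M\<close> is nontrivial of odd order. The 2-group
  \<open>gen (K \<inter> M)\<close> is normal in \<open>M\<close> and so lies in the 2-radical
  \<open>R\<close>. As \<open>M = H (K \<inter> M)\<close>, \<tau> is trivial on
  \<open>M / R\<close>; comparing conjugation by \<open>k\<close> and by \<open>inverse k\<close>,
  \<open>k ^ 2\<close> centralises \<open>M / R\<close>, and so does \<open>k\<close>, of odd order
  modulo \<open>R\<close>. Hence \<open>M / R\<close> is central and \<open>G\<close> is solvable. A
  suitable power of an element of \<open>K\<close> outside \<open>M\<close> has odd prime power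
  order, stays outside \<open>M\<close> and centralises \<open>R\<close>, although the centraliser
  of \<open>R\<close> lies in \<open>R\<close> and \<open>R\<close> in \<open>M\<close>.\<close>

lemma odd_index_contradiction:
  assumes M: "sgrp M" "H \<subseteq> M" "M \<subseteq> G" "comms G \<subseteq> M" "M \<noteq> G"
    and odd: "\<And>g. g \<in> G \<Longrightarrow> \<exists>j. odd j \<and> g ^ j \<in> M"
    and L: "pgrp 2 (gen (K \<inter> M))"
    and no_odd: "\<And>A. \<lbrakk>nrm A G; odd_sol A\<rbrakk> \<Longrightarrow> A = {1}"
  shows False
proof -
  obtain R where R: "nrm R G" "pgrp 2 R" "\<And>A. \<lbrakk>nrm A G; pgrp 2 A\<rbrakk> \<Longrightarrow> A \<subseteq> R"
    using pgrp2_radical_ex[OF sG] by metis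
  have sR: "sgrp R" and RG: "R \<subseteq> G" using nrm_sgrp[OF R(1)] nrm_subset[OF R(1)] by auto
  have MG: "nrm M G" by (rule nrm_comms[OF M(1,4,3)])
  have LR: "gen (K \<inter> M) \<subseteq> R"
    using pgrp2_normal_closure[OF sG MG subfolder_nrm[OF M(1-3)] L] R(3) by (metis subset_trans)
  have RM: "R \<subseteq> M"
  proof
    fix r assume r: "r \<in> R"
    then obtain j where j: "odd j" "r ^ j \<in> M" using odd RG by blast
    obtain a where "r ^ (2 ^ a) = 1" using r R(2) by (auto simp: pgrp_def)
    then have "r ^ (2 ^ a) \<in> M" using M(1) by simp
    then show "r \<in> M" using coprime_power_mem[OF M(1) _ j(2)] j(1) by simp
  qed
  have \<tau>R: "\<tau> ` R \<subseteq> R"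
  proof (rule R(3))
    show "nrm (\<tau> ` R) G" using hm_nrm_image[OF hm\<tau> R(1)] by (simp add: image_\<tau>)
    show "pgrp 2 (\<tau> ` R)" by (rule hm_image_pgrp[OF hm\<tau> RG R(2)])
  qed
  obtain \<phi> :: "'a \<Rightarrow> nat perm" where \<phi>: "hm \<phi> G" "\<And>g. g \<in> G \<Longrightarrow> \<phi> g = 1 \<longleftrightarrow> g \<in> R"
    using quotient_perm[OF sG R(1)] by metis
  note m = hm_mult[OF \<phi>(1)] and i = hm_inv[OF \<phi>(1)]
  have \<phi>R: "\<phi> r = 1" if "r \<in> R" for r using that \<phi>(2) RG by blast
  have \<phi>\<tau>: "\<phi> (\<tau> x) = \<phi> x" if "x \<in> M" for x
  proof -
    obtain h l where hl: "h \<in> H" "l \<in> K \<inter> M" "x = h * l" using subfolder_factor[OF M(1-3) \<open>x \<in> M\<close>] by blast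
    have lR: "l \<in> R" using hl LR gen_incl[of "K \<inter> M"] by blast
    then have "\<tau> l \<in> R" using \<tau>R by blast
    then show ?thesis using hl lR inG \<tau>G by (simp add: \<tau>_mult m \<tau>H \<phi>R)
  qed
  have cK: "\<phi> k * \<phi> x = \<phi> x * \<phi> k" if k: "k \<in> K" and x: "x \<in> M" for k x
  proof -
    have xG: "x \<in> G" and kG: "k \<in> G" using x k M inG by auto
    have xM: "inverse k * x * k \<in> M" by (rule nrm_conj'[OF MG sG kG x])
    have "inverse (\<phi> k) * \<phi> x * \<phi> k = \<phi> (inverse k * x * k)" using xG kG sG by (simp add: m i)
    also have "\<dots> = \<phi> (\<tau> (inverse k * x * k))" using \<phi>\<tau>[OF xM] by simp
    also have "\<tau> (inverse k * x * k) = k * \<tau> x * inverse k" using xG kG sG k by (simp add: \<tau>_mult \<tau>_inv \<tau>K)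
    also have "\<phi> \<dots> = \<phi> k * \<phi> x * inverse (\<phi> k)" using xG kG sG \<tau>G \<phi>\<tau>[OF x] by (simp add: m i)
    finally have "\<phi> k * (inverse (\<phi> k) * \<phi> x * \<phi> k) * \<phi> k = \<phi> k * (\<phi> k * \<phi> x * inverse (\<phi> k)) * \<phi> k" by simp
    then have "(\<phi> k * \<phi> k) * \<phi> x = \<phi> x * (\<phi> k * \<phi> k)" by (simp add: mult.assoc)
    then have sq: "(\<phi> k ^ 2) ^ a * \<phi> x = \<phi> x * (\<phi> k ^ 2) ^ a" for a
      unfolding power2_eq_square by (rule power_commuting_commutes)
    obtain j where j: "odd j" "k ^ j \<in> M" using odd[OF kG] by blast
    have "k ^ j \<in> R" using j(2) powK[OF k] LR gen_incl[of "K \<inter> M"] by blast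
    then have kj: "\<phi> k ^ j = 1" using \<phi>R hm_power[OF \<phi>(1) kG] by metis
    have "coprime 2 j" using j(1) by simp
    then obtain a b where "\<phi> k ^ (2 * a) = \<phi> k ^ (j * b) * \<phi> k" using bezout_power[of 2 j "\<phi> k"] by auto
    then have "(\<phi> k ^ 2) ^ a = \<phi> k" by (simp add: power_mult kj)
    then show ?thesis using sq[of a] by simp
  qed
  have central: "\<phi> g * \<phi> x = \<phi> x * \<phi> g" if x: "x \<in> M" and g: "g \<in> G" for g x
  proof -
    have xG: "x \<in> G" using x M by blast
    have "g \<in> gen K" using g gK by simp
    from this sG KG show ?thesis
    proof (induction rule: gen_induct)
      case one
      show ?case by (simp add: hm_one[OF \<phi>(1)])
    next
      case (incl s)
      then show ?case using cK x by blast
    next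
      case (mult y z)
      then have "y \<in> G" "z \<in> G" using gK by auto
      then have "\<phi> (y * z) * \<phi> x = \<phi> y * (\<phi> z * \<phi> x)" by (simp add: m mult.assoc)
      also have "\<dots> = (\<phi> y * \<phi> x) * \<phi> z" unfolding mult.IH(2) by (simp only: mult.assoc)
      also have "\<dots> = (\<phi> x * \<phi> y) * \<phi> z" by (simp only: mult.IH(1))
      also have "\<dots> = \<phi> x * \<phi> (y * z)" using \<open>y \<in> G\<close> \<open>z \<in> G\<close> by (simp add: m mult.assoc)
      finally show ?case .
    qed
  qed
  have sol: "sol G"
  proof (rule sol_extension[OF \<phi>(1) _ sol_pgrp2[OF R(2)]])
    show "sol (\<phi> ` G)"
    proof (rule sol_der)
      have "der (\<phi> ` G) = \<phi> ` der G" by (rule hm_der[OF \<phi>(1) sG]) simp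
      also have "der G \<subseteq> M" unfolding der_def by (rule gen_least[OF M(1,4)])
      finally have d: "der (\<phi> ` G) \<subseteq> \<phi> ` M" by blast
      have "sol (\<phi> ` M)"
      proof (rule sol_abelian)
        fix u v assume "u \<in> \<phi> ` M" "v \<in> \<phi> ` M"
        then obtain x y where "x \<in> M" "y \<in> M" "u = \<phi> x" "v = \<phi> y" by blast
        then show "u * v = v * u" using central[of y x] M(3) by blast
      qed
      then show "sol (der (\<phi> ` G))" using sol_mono d by blast
    qed
  qed (use \<phi>(2) in blast)
  have "\<not> K \<subseteq> M" using gen_least[OF M(1)] gK M(3,5) by blast
  then obtain k where k: "k \<in> K" "k \<notin> M" by blast
  have kG: "k \<in> G" using k inG by blast
  obtain b w where bw: "card G = 2 ^ b * w" "odd w" using card_two_part[OF sG] .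
  define y where "y = k ^ (2 ^ b)"
  obtain j where j: "odd j" "k ^ j \<in> M" using odd[OF kG] by blast
  have "y \<notin> M"
  proof
    assume "y \<in> M"
    then have "k \<in> M" using coprime_power_mem[OF M(1), of k "2 ^ b" j] j by (simp add: y_def)
    then show False using k by blast
  qed
  moreover have "y ^ w = 1" using power_card[OF sG kG] by (simp add: y_def bw power_mult)
  ultimately obtain q f e where q: "prime q" "q dvd w" "y ^ e \<notin> M" "(y ^ e) ^ (q ^ f) = 1"
    using prime_power_part_notin[OF M(1), of y w] bw(2) by (metis odd_pos)
  have "q \<noteq> 2" using q(2) bw(2) by auto
  define c where "c = y ^ e"
  have c: "c \<in> K" "c \<in> G" "c ^ (q ^ f) = 1" "c \<notin> M" using powK k q sG kG by (auto simp: c_def y_def)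
  have "c \<in> R"
  proof (rule centralizer_2_radical[OF sG sol no_odd R c(2)])
    fix n assume n: "n \<in> R"
    have "\<exists>h\<in>H. \<exists>x\<in>gen (K \<inter> R). n = h * x" if "n \<in> R" for n
    proof -
      have nM: "n \<in> M" using that RM by blast
      obtain h l where hl: "h \<in> H" "l \<in> K \<inter> M" "n = h * l" using subfolder_factor[OF M(1-3) nM] by blast
      have "l \<in> R" using hl LR gen_incl[of "K \<inter> M"] by blast
      then have "l \<in> gen (K \<inter> R)" using hl gen_incl[of "K \<inter> R"] by blast
      then show ?thesis using hl by blast
    qed
    then show "c * n = n * c"
      using odd_element_centralizes[OF R(1,2) \<tau>R _ c(1,3) q(1) \<open>q \<noteq> 2\<close> n] by blast
  qed
  then show False using RM c by blast
qed

end

text \<open>A nontrivial odd solvable normal subgroup is divided out. Without one, let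
  \<open>M / dhull\<close> be the 2-part of the abelian group \<open>G / dhull\<close>. If
  \<open>M\<close> is proper, \<open>odd_index_contradiction\<close> applies. Otherwise the index of
  \<open>dhull\<close> in \<open>G\<close> is a power of 2, and so is that of \<open>H\<close> in
  \<open>dhull\<close>, since \<open>gen (K \<inter> dhull)\<close> is a 2-group by induction;
  \<open>index_two_group\<close> finishes.\<close>

theorem bruck_lsol_two_nilpotent:
  fixes G H K :: "nat perm set"
  assumes "bruck G H K \<tau>" "lsol H K" shows "two_nilpotent G"
  using assms
proof (induction "card G" arbitrary: G H K \<tau> rule: less_induct)
  case less
  interpret bruck G H K \<tau> by (rule less.prems(1))
  show ?case
  proof (cases "\<exists>A. nrm A G \<and> odd_sol A \<and> A \<noteq> {1}")
    case True
    then obtain N where N: "nrm N G" "odd_sol N" "N \<noteq> {1}" "\<tau> ` N \<subseteq> N" using odd_normal_closure_\<tau> by metis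
    obtain \<phi> :: "nat perm \<Rightarrow> nat perm" and \<tau>' where \<phi>: "sharp_hm \<phi>" "\<And>g. g \<in> G \<Longrightarrow> \<phi> g = 1 \<longleftrightarrow> g \<in> N"
      "bruck (\<phi> ` G) (\<phi> ` H) (\<phi> ` K) \<tau>'" "card (\<phi> ` G) < card G"
      using odd_quotient[OF N] by metis
    have "two_nilpotent (\<phi> ` G)" by (rule less.hyps[OF \<phi>(4,3) image_lsol[OF \<phi>(1) less.prems(2)]])
    then show ?thesis using two_nilpotent_extension[of \<phi> G N] \<phi>(1,2) N(2) by (auto simp: sharp_hm_def)
  next
    case False
    then have no_odd: "\<And>A. \<lbrakk>nrm A G; odd_sol A\<rbrakk> \<Longrightarrow> A = {1}" by blast
    show ?thesis
    proof (cases "K \<subseteq> {1}")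
      case True
      then show ?thesis using K_trivial two_nilpotent_pgrp2[of G] by (simp add: pgrp_def)
    next
      case ne: False
      have dG: "dhull \<noteq> G" by (rule dhull_proper[OF less.prems(2) ne])
      have sub: "pgrp 2 (gen (K \<inter> M))" if M: "sgrp M" "H \<subseteq> M" "M \<subseteq> G" "comms G \<subseteq> M" "M \<noteq> G" for M
      proof -
        have "gen (K \<inter> M) \<subseteq> M" by (rule gen_least[OF M(1)]) blast
        then have "gen (K \<inter> M) \<subset> G" using M(3,5) by blast
        then have c: "card (gen (K \<inter> M)) < card G" using psubset_card_mono sgrp_finite[OF sG] by blast
        have "lsol H (K \<inter> M)" by (rule lsol_mono[OF less.prems(2)]) blast
        then have "two_nilpotent (gen (K \<inter> M))"
          using less.hyps[OF c subbruck[OF M(1-3)]] subfolder_lsol[OF M(1-3)] by blast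
        then show ?thesis by (rule subbruck_two_group[OF M(1-4) _ no_odd])
      qed
      have nD: "nrm dhull G" by (rule nrm_comms[OF dhull(1,3,4)])
      obtain \<phi> :: "nat perm \<Rightarrow> nat perm" where \<phi>: "hm \<phi> G" "\<And>g. g \<in> G \<Longrightarrow> \<phi> g = 1 \<longleftrightarrow> g \<in> dhull"
        using quotient_perm[OF sG nD] by metis
      have ab: "\<phi> y * \<phi> x = \<phi> x * \<phi> y" if "x \<in> G" "y \<in> G" for x y
      proof -
        have "y * x * inverse y * inverse x \<in> dhull" using commsI[OF that(2,1)] dhull(3) by blast
        then have "\<phi> (y * x * inverse (x * y)) = 1" using \<phi>(2) that sG by (simp add: grp_simps)
        then have "\<phi> (y * x) = \<phi> (x * y)" using hm_eq_iff[OF \<phi>(1)] that sG by simp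
        then show ?thesis using hm_mult[OF \<phi>(1)] that by simp
      qed
      define M where "M = {g \<in> G. \<exists>a. g ^ (2 ^ a) \<in> dhull}"
      have M: "sgrp M" "H \<subseteq> M" "M \<subseteq> G" "comms G \<subseteq> M"
      proof -
        have dM: "dhull \<subseteq> M"
        proof
          fix x assume "x \<in> dhull"
          then have "x \<in> G" "x ^ (2 ^ 0) \<in> dhull" using dhull by auto
          then show "x \<in> M" unfolding M_def by blast
        qed
        then show "H \<subseteq> M" "comms G \<subseteq> M" "M \<subseteq> G" using dhull by (auto simp: M_def)
        show "sgrp M"
        proof (rule sgrpI)
          show "finite M" using sgrp_finite[OF sG] by (simp add: M_def)
          show "1 \<in> M" using dM dhull(1) by auto
          fix x y assume "x \<in> M" "y \<in> M"
          then obtain a b where xy: "x \<in> G" "y \<in> G" "x ^ (2 ^ a) \<in> dhull" "y ^ (2 ^ b) \<in> dhull" by (auto simp: M_def)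
          define n where "n = (2::nat) ^ (a + b)"
          have "(x ^ (2 ^ a)) ^ (2 ^ b) \<in> dhull" "(y ^ (2 ^ b)) ^ (2 ^ a) \<in> dhull" using xy dhull(1) by auto
          then have xn: "x ^ n \<in> dhull" "y ^ n \<in> dhull"
            by (simp_all add: n_def power_add mult.commute flip: power_mult)
          have "\<phi> ((x * y) ^ n) = (\<phi> x * \<phi> y) ^ n" using hm_power[OF \<phi>(1)] hm_mult[OF \<phi>(1)] xy sG by simp
          also have "\<dots> = \<phi> x ^ n * \<phi> y ^ n"
            using power_mult_class2[of "\<phi> y" "\<phi> x" 1 n] ab xy by simp
          also have "\<dots> = 1" using hm_power[OF \<phi>(1)] \<phi>(2) xn xy sG dhull(4) by (metis mult_1_left subsetD)
          finally have "(x * y) ^ n \<in> dhull" using \<phi>(2) xy sG by simp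
          then show "x * y \<in> M" using xy sG by (auto simp: M_def n_def)
        qed
      qed
      show ?thesis
      proof (cases "M = G")
        case False
        have "\<exists>j. odd j \<and> g ^ j \<in> M" if g: "g \<in> G" for g
        proof -
          obtain b w where bw: "card G = 2 ^ b * w" "odd w" using card_two_part[OF sG] .
          have "(g ^ w) ^ (2 ^ b) = 1" using power_card[OF sG g] by (simp add: bw mult.commute flip: power_mult)
          then have "(g ^ w) ^ (2 ^ b) \<in> dhull" using dhull(1) by simp
          moreover have "g ^ w \<in> G" using g sG by simp
          ultimately have "g ^ w \<in> M" unfolding M_def by blast
          then show ?thesis using bw by blast
        qed
        then have False using odd_index_contradiction[OF M False _ sub[OF M False] no_odd] by blast
        then show ?thesis ..
      next
        case True
        note d = dhull(1,2,4,3) dG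
        have "pgrp 2 G"
        proof (rule index_two_group[OF d(1-3)])
          show "q = 2" if "prime q" "q dvd card (rcoss H dhull)" for q
            using pgrp_prime_dvd[OF sub[OF d] two_is_prime_nat that(1)] that(2) index_dvd[OF d(1-3)] dvd_trans by blast
          show "q = 2" if "prime q" "q dvd card (rcoss dhull G)" for q
            using quotient_prime_dvd[OF sG nD _ that] True by (auto simp: M_def)
        qed
        then show ?thesis by (rule two_nilpotent_pgrp2)
      qed
    qed
  qed
qed

section \<open>Solvable enveloping groups come from solvable loops\<close>

context bruck
begin

text \<open>The counting argument: \<open>k \<tau>\<close> permutes the odd number of cosets of \<open>A\<close>, hence fixes one of them,
  and on average it fixes just one. So every \<open>k \<tau>\<close> with \<open>k \<in> A\<close> has no fixed points on \<open>W / C\<close>,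
  hence inverts it.\<close>

lemma odd_block_system:
  assumes A: "sgrp A" "H \<subseteq> A" "A \<subseteq> G" and C: "nrm C G" and W: "nrm W G" and CW: "C \<subseteq> W"
    and WA: "W \<inter> A = C" and \<tau>W: "\<tau> ` W \<subseteq> W" and AW: "\<And>g. g \<in> G \<Longrightarrow> \<exists>a\<in>A. \<exists>w\<in>W. g = a * w"
    and ab: "\<And>x y. \<lbrakk>x \<in> W; y \<in> W\<rbrakk> \<Longrightarrow> x * y * inverse x * inverse y \<in> C"
    and odd: "odd (card (rcoss A G))"
  shows "comms G \<subseteq> A"
proof -
  have sC: "sgrp C" and CG: "C \<subseteq> G" and sW: "sgrp W" and WG: "W \<subseteq> G"
    using nrm_sgrp[OF C] nrm_subset[OF C] nrm_sgrp[OF W] nrm_subset[OF W] by auto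
  have CA: "C \<subseteq> A" using WA by blast
  have \<tau>A: "\<tau> a \<in> A" if "a \<in> A" for a
  proof -
    obtain h k where hk: "h \<in> H" "k \<in> K \<inter> A" "a = h * k" using subfolder_factor[OF A \<open>a \<in> A\<close>] by blast
    then show ?thesis using A by (auto simp: \<tau>_hk)
  qed
  have fixpt: "\<exists>w\<in>W. w * k * inverse (\<tau> w) \<in> A" if k: "k \<in> K" for k
  proof -
    have kG: "k \<in> G" using k inG by blast
    define f where "f = (\<lambda>C. (\<lambda>y. \<tau> (y * k)) ` C)"
    have fr: "f (rcos A g) = rcos A (\<tau> (g * k))" if g: "g \<in> G" for g
    proof -
      have e: "\<tau> (a * g * k) = \<tau> a * \<tau> (g * k)" if "a \<in> A" for a
        using that g kG A sG \<tau>_mult[of a "g * k"] by (auto simp: mult.assoc)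
      have "\<tau> ` A = A"
      proof
        show "A \<subseteq> \<tau> ` A"
        proof
          fix a assume "a \<in> A"
          then have "a = \<tau> (\<tau> a)" "\<tau> a \<in> A" using \<tau>\<tau> A(3) \<tau>A by auto
          then show "a \<in> \<tau> ` A" by blast
        qed
      qed (use \<tau>A in blast)
      then have "rcos A (\<tau> (g * k)) = (\<lambda>a. \<tau> a * \<tau> (g * k)) ` A" unfolding rcos_def using image_image[of "\<lambda>a. a * \<tau> (g * k)" \<tau> A] by simp
      then show ?thesis by (simp add: f_def rcos_def image_image e cong: image_cong)
    qed
    have fin: "finite (rcoss A G)" by (simp add: finite_rcoss sgrp_finite sG)
    obtain D where D: "D \<in> rcoss A G" "f D = D"
    proof (rule involution_odd_fixpoint[OF fin odd])
      fix D assume "D \<in> rcoss A G"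
      then obtain g where g: "g \<in> G" "D = rcos A g" by (auto simp: rcoss_def)
      have gk: "\<tau> (g * k) \<in> G" using g kG sG \<tau>G by simp
      then show "f D \<in> rcoss A G" using g by (simp add: fr rcoss_def)
      have "\<tau> (\<tau> (g * k) * k) = g * k * inverse k"
        using gk g kG sG \<tau>\<tau>[of "g * k"] \<tau>_mult[of "\<tau> (g * k)" k] \<tau>K[OF k] by auto
      then show "f (f D) = D" using g gk by (simp add: fr mult.assoc)
    qed
    then obtain g where g: "g \<in> G" "rcos A (\<tau> (g * k)) = rcos A g" by (auto simp: rcoss_def fr)
    obtain a w where aw: "a \<in> A" "w \<in> W" "g = a * w" using AW g by blast
    have wG: "w \<in> G" "a \<in> G" using aw WG A by auto
    have "g * inverse (\<tau> (g * k)) \<in> A" using g(2) rcos_eq_iff[OF A(1)] by blast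
    moreover have "g * inverse (\<tau> (g * k)) = g * k * inverse (\<tau> g)"
      using g kG by (simp add: \<tau>_mult \<tau>K[OF k] grp_simps)
    moreover have "inverse a * (g * k * inverse (\<tau> g)) * \<tau> a = w * k * inverse (\<tau> w)"
      using wG by (simp add: aw(3) \<tau>_mult grp_simps)
    ultimately show ?thesis using aw A(1) \<tau>A[OF aw(1)] by (metis sgrp_mult sgrp_inv)
  qed
  define rep where "rep = (\<lambda>D::'a set. SOME w. w \<in> W \<and> rcos C w = D)"
  have rep: "rep D \<in> W" "rcos C (rep D) = D" if "D \<in> rcoss C W" for D
    using that someI_ex[of "\<lambda>w. w \<in> W \<and> rcos C w = D"] by (auto simp: rcoss_def rep_def)
  have move: "\<exists>k'\<in>K \<inter> A. k = inverse (rep (rcos C w)) * k' * \<tau> (rep (rcos C w))"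
    if k: "k \<in> K" and w: "w \<in> W" "w * k * inverse (\<tau> w) \<in> A" for k w
  proof -
    define t where "t = rep (rcos C w)"
    have D: "rcos C w \<in> rcoss C W" using w by (simp add: rcoss_def)
    have t: "t \<in> W" "rcos C t = rcos C w" using rep[OF D] by (auto simp: t_def)
    have tG: "t \<in> G" "w \<in> G" "k \<in> G" using t w WG k inG by auto
    define c where "c = t * inverse w"
    have c: "c \<in> A" "c \<in> G" using t(2) rcos_eq_iff[OF sC, of w t] CA CG by (auto simp: c_def)
    have "c * (w * k * inverse (\<tau> w)) * inverse (\<tau> c) = t * k * inverse (\<tau> t)"
      using tG sG by (simp add: c_def \<tau>_mult \<tau>_inv grp_simps)
    then have "t * k * inverse (\<tau> t) \<in> A" using c w(2) A(1) \<tau>A[OF c(1)] by (metis sgrp_mult sgrp_inv)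
    moreover have "t * k * inverse (\<tau> t) \<in> K" by (rule twist[OF tG(1) k])
    moreover have "k = inverse t * (t * k * inverse (\<tau> t)) * \<tau> t" by (simp add: mult.assoc)
    ultimately show ?thesis unfolding t_def by blast
  qed
  \<comment> \<open>By \<open>fixpt\<close> each \<open>k\<close> in \<open>K\<close> is
    \<open>inverse w * k' * \<tau> w\<close> with \<open>k'\<close> in \<open>K \<inter> A\<close>,
    where \<open>w\<close> may be replaced by the chosen representative of \<open>C w\<close>. The
    pairs of such a coset and such a \<open>k'\<close> are as many as the elements of
    \<open>K\<close>, so this surjection is injective. For \<open>k\<close> in \<open>A\<close>,
    where \<open>w = 1\<close> is a solution, there is thus no other modulo
    \<open>C\<close>.\<close>
  define \<Psi> where "\<Psi> = (\<lambda>(D, k'). inverse (rep D) * k' * \<tau> (rep D))"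
  have surj: "K \<subseteq> \<Psi> ` (rcoss C W \<times> (K \<inter> A))"
  proof
    fix k assume k: "k \<in> K"
    then obtain w where w: "w \<in> W" "w * k * inverse (\<tau> w) \<in> A" using fixpt by blast
    obtain k' where "k' \<in> K \<inter> A" "k = inverse (rep (rcos C w)) * k' * \<tau> (rep (rcos C w))" using move[OF k w] by blast
    moreover have "rcos C w \<in> rcoss C W" using w by (simp add: rcoss_def)
    ultimately show "k \<in> \<Psi> ` (rcoss C W \<times> (K \<inter> A))"
      unfolding \<Psi>_def by (intro image_eqI[of _ _ "(rcos C w, k')"]) auto
  qed
  have cAW: "card (rcoss A G) = card (rcoss C W)"
  proof -
    have "rcoss A G = rcoss A W" by (rule rcoss_eq[OF A(1) _ WG]) (use AW in blast)
    moreover have "card (rcoss A W) * card (A \<inter> W) = card W" by (rule card_rcoss[OF A(1) sW])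
    moreover have "card (rcoss C W) * card C = card W" by (rule lagrange_rcoss[OF sC sW CW])
    moreover have "A \<inter> W = C" using WA by blast
    ultimately have "card (rcoss A G) * card C = card (rcoss C W) * card C" by simp
      then show ?thesis using card_pos[OF sC] by simp
  qed
  have "card K = card (rcoss C W) * card (K \<inter> A)"
    using card_K[OF sG HG order_refl] card_K[OF A] card_rcoss_mult[OF sH A(1) sG A(2,3)] KG cAW
    by (simp add: Int_absorb2)
  then have cP: "card (rcoss C W \<times> (K \<inter> A)) = card K" by (simp add: card_cartesian_product)
  have finP: "finite (rcoss C W \<times> (K \<inter> A))"
    using finite_rcoss[OF sgrp_finite[OF sW]] sgrp_finite[OF A(1)] by auto
  have "card (\<Psi> ` (rcoss C W \<times> (K \<inter> A))) = card (rcoss C W \<times> (K \<inter> A))"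
    using card_mono[OF finite_imageI[OF finP] surj] card_image_le[OF finP, of \<Psi>] cP by simp
  then have inj: "inj_on \<Psi> (rcoss C W \<times> (K \<inter> A))" by (rule eq_card_imp_inj_on[OF finP])
  have only: "w \<in> C" if k: "k \<in> K \<inter> A" and w: "w \<in> W" "w * k * inverse (\<tau> w) \<in> A" for k w
  proof -
    have kK: "k \<in> K" and kA: "k \<in> A" using k by auto
    have one: "1 \<in> W" "1 * k * inverse (\<tau> 1) \<in> A" using sW kA hm_one[OF hm\<tau>] by auto
    obtain k1 where k1: "k1 \<in> K \<inter> A" "k = \<Psi> (rcos C w, k1)" using move[OF kK w] by (auto simp: \<Psi>_def)
    obtain k2 where k2: "k2 \<in> K \<inter> A" "k = \<Psi> (rcos C 1, k2)" using move[OF kK one] by (auto simp: \<Psi>_def)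
    have "(rcos C w, k1) = (rcos C 1, k2)"
      by (rule inj_onD[OF inj]) (use k1 k2 w one in \<open>auto simp: rcoss_def\<close>)
    then show ?thesis using rcos_eq_iff[OF sC, of 1 w] by simp
  qed
  obtain \<phi> :: "'a \<Rightarrow> nat perm" where \<phi>: "hm \<phi> G" "\<And>g. g \<in> G \<Longrightarrow> \<phi> g = 1 \<longleftrightarrow> g \<in> C"
    using quotient_perm[OF sG C] by metis
  note m = hm_mult[OF \<phi>(1)] and i = hm_inv[OF \<phi>(1)]
  \<comment> \<open>With \<open>s = k * \<tau> w * inverse k\<close>, the element
    \<open>w * s\<close> again satisfies the fixed point condition for \<open>k\<close>: the error
    is a commutator of \<open>w\<close> and \<open>s\<close>, which lies in \<open>C\<close>. Hence
    \<open>w * s\<close> lies in \<open>C\<close>.\<close>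
  have inv: "\<phi> (k * \<tau> w * inverse k) = inverse (\<phi> w)" if k: "k \<in> K \<inter> A" and w: "w \<in> W" for k w
  proof -
    define s where "s = k * \<tau> w * inverse k"
    have kG: "k \<in> G" "k \<in> K" "k \<in> A" and wG: "w \<in> G" and \<tau>w: "\<tau> w \<in> W" "\<tau> w \<in> G" using k w KG WG \<tau>W by auto
    have sW': "s \<in> W" unfolding s_def by (rule nrm_conj[OF W kG(1) \<tau>w(1)])
    have sG': "s \<in> G" using sW' WG by blast
    have \<tau>s: "\<tau> s = inverse k * w * k" using kG wG \<tau>w sG by (simp add: s_def \<tau>_mult \<tau>_inv \<tau>K \<tau>\<tau>)
    have "w * s * k * inverse (\<tau> (w * s)) = (w * s * inverse w * inverse s) * k"
      using wG sG' by (simp add: \<tau>_mult \<tau>s) (simp add: s_def grp_simps)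
    also have "\<dots> \<in> A" using ab[OF w sW'] CA A(1) kG by auto
    finally have "w * s \<in> C" using only[OF k, of "w * s"] w sW' sW by simp
    then have "\<phi> (w * s) = 1" using \<phi>(2) CG by blast
    then have "\<phi> w * \<phi> s = 1" using m[OF wG sG'] by simp
    then show ?thesis by (metis s_def inv_cancel(1) mult_1_right)
  qed
  have k1: "1 \<in> K \<inter> A" using oneK A(1) by simp
  \<comment> \<open>Both \<open>k \<tau>\<close> and \<open>1 \<tau>\<close> invert
    \<open>W / C\<close>, so \<open>k\<close> centralises it.\<close>
  have cent: "\<phi> k * \<phi> w = \<phi> w * \<phi> k" if k: "k \<in> K \<inter> A" and w: "w \<in> W" for k w
  proof -
    have kG: "k \<in> G" and wG: "w \<in> G" "\<tau> w \<in> G" using k w KG WG \<tau>G by auto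
    have e: "\<phi> (\<tau> w) = inverse (\<phi> w)" using inv[OF k1 w] by simp
    have "\<phi> k * inverse (\<phi> w) * inverse (\<phi> k) = inverse (\<phi> w)"
      using inv[OF k w] kG wG sG by (simp add: m i e)
    then have "inverse (\<phi> k * inverse (\<phi> w) * inverse (\<phi> k)) = \<phi> w" by simp
    then have "\<phi> k * \<phi> w * inverse (\<phi> k) * \<phi> k = \<phi> w * \<phi> k" by (simp add: grp_simps)
    then show ?thesis by (simp add: mult.assoc)
  qed
  define L where "L = gen (K \<inter> A)"
  have KA: "K \<inter> A \<subseteq> A" by blast
  have sL: "sgrp L" and LA: "L \<subseteq> A" using sgrp_gen[OF A(1) KA] gen_least[OF A(1) KA] by (auto simp: L_def)
  have centL: "\<phi> l * \<phi> w = \<phi> w * \<phi> l" if l: "l \<in> L" and w: "w \<in> W" for l w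
    using l[unfolded L_def] A(1) KA
  proof (induction rule: gen_induct)
    case one
    show ?case by (simp add: hm_one[OF \<phi>(1)])
  next
    case (incl s)
    then show ?case using cent w by blast
  next
    case (mult y z)
    then have yz: "y \<in> G" "z \<in> G" using LA A(3) by (auto simp: L_def)
    then have "\<phi> (y * z) * \<phi> w = \<phi> y * (\<phi> z * \<phi> w)" by (simp add: m mult.assoc)
    also have "\<dots> = (\<phi> y * \<phi> w) * \<phi> z" unfolding mult.IH(2) by (simp only: mult.assoc)
    also have "\<dots> = (\<phi> w * \<phi> y) * \<phi> z" by (simp only: mult.IH(1))
    also have "\<dots> = \<phi> w * \<phi> (y * z)" using yz by (simp add: m mult.assoc)
    finally show ?case .
  qed
  \<comment> \<open>This gives \<open>G = L W\<close>. As \<open>L\<close> centralises the abelian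
    group \<open>W / C\<close>, each commutator of \<open>G\<close> is congruent modulo
    \<open>C\<close> to one of \<open>L\<close>, and these lie in \<open>A\<close>.\<close>
  have "K \<subseteq> pset L W"
  proof
    fix k assume k: "k \<in> K"
    then obtain w where w: "w \<in> W" "w * k * inverse (\<tau> w) \<in> A" using fixpt by blast
    define l where "l = w * k * inverse (\<tau> w)"
    have "l \<in> K \<inter> A" using w twist[OF _ k, of w] WG by (auto simp: l_def)
    then have l: "l \<in> L" using gen_incl[of "K \<inter> A"] by (auto simp: L_def)
    have "inverse l * inverse w * l \<in> W" using nrm_conj'[OF W sG, of l "inverse w"] l LA A(3) w sW by auto
    then have "(inverse l * inverse w * l) * \<tau> w \<in> W" using w \<tau>W sW by auto
    then have "l * ((inverse l * inverse w * l) * \<tau> w) \<in> pset L W" using l by (intro psetI)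
    moreover have "k = l * ((inverse l * inverse w * l) * \<tau> w)" by (simp add: l_def grp_simps)
    ultimately show "k \<in> pset L W" by simp
  qed
  moreover have "sgrp (pset L W)" by (rule pset_nrm_sgrp[OF sG sL _ W]) (use LA A in auto)
  ultimately have GLW: "G \<subseteq> pset L W" using gen_least gK by blast
  show "comms G \<subseteq> A"
  proof
    fix z assume "z \<in> comms G"
    then obtain x y where xy: "x \<in> G" "y \<in> G" "z = x * y * inverse x * inverse y" by (metis commsE)
    obtain l v where lv: "l \<in> L" "v \<in> W" "x = l * v" using GLW xy by (blast elim: psetE)
    obtain l' v' where lv': "l' \<in> L" "v' \<in> W" "y = l' * v'" using GLW xy by (blast elim: psetE)
    have G: "l \<in> G" "l' \<in> G" "v \<in> G" "v' \<in> G" using lv lv' LA A(3) WG by auto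
    have LA': "l \<in> A" "l' \<in> A" using lv lv' LA by auto
    have vv: "\<phi> v * \<phi> v' = \<phi> v' * \<phi> v"
    proof -
      have "\<phi> (v * v' * inverse v * inverse v') = 1" using \<phi>(2) ab[OF lv(2) lv'(2)] CG by blast
      then have "\<phi> v * \<phi> v' * inverse (\<phi> v) * inverse (\<phi> v') = 1" using G sG by (simp add: m i)
      then have "\<phi> v * \<phi> v' * inverse (\<phi> v) = \<phi> v'" by simp
      then have "\<phi> v * \<phi> v' * inverse (\<phi> v) * \<phi> v = \<phi> v' * \<phi> v" by simp
      then show ?thesis by (simp add: mult.assoc)
    qed
    define p where "p = l * l' * inverse l * inverse l'"
    have "\<phi> x * \<phi> y = \<phi> l * (\<phi> v * \<phi> l') * \<phi> v'" using lv lv' G by (simp add: m mult.assoc)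
    also have "\<dots> = \<phi> l * \<phi> l' * (\<phi> v * \<phi> v')" unfolding centL[OF lv'(1) lv(2), symmetric] by (simp only: mult.assoc)
    finally have 1: "\<phi> x * \<phi> y = \<phi> l * \<phi> l' * (\<phi> v * \<phi> v')" .
    have "\<phi> y * \<phi> x = \<phi> l' * (\<phi> v' * \<phi> l) * \<phi> v" using lv lv' G by (simp add: m mult.assoc)
    also have "\<dots> = \<phi> l' * \<phi> l * (\<phi> v' * \<phi> v)" unfolding centL[OF lv(1) lv'(2), symmetric] by (simp only: mult.assoc)
    finally have 2: "\<phi> y * \<phi> x = \<phi> l' * \<phi> l * (\<phi> v * \<phi> v')" by (simp only: vv)
    have "\<phi> z = (\<phi> x * \<phi> y) * inverse (\<phi> y * \<phi> x)" using xy sG by (simp add: m i grp_simps)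
    also have "\<dots> = \<phi> l * \<phi> l' * inverse (\<phi> l' * \<phi> l)" unfolding 1 2 by (simp add: grp_simps)
    also have "\<dots> = \<phi> p" using G sG by (simp add: p_def m i grp_simps)
    finally have "\<phi> (z * inverse p) = 1" using hm_eq_iff[OF \<phi>(1), of z p] xy G sG by (simp add: p_def)
    then have "z * inverse p \<in> C" using \<phi>(2) xy G sG by (simp add: p_def)
    moreover have "p \<in> A" using LA' A(1) by (simp add: p_def)
    ultimately have "z * inverse p * p \<in> A" using CA A(1) by (metis sgrp_mult subsetD)
    then show "z \<in> A" by (simp add: mult.assoc)
  qed
qed

text \<open>If \<open>dhull = G\<close>, then \<open>H\<close> covers \<open>G / G'\<close>, so
  \<tau> is trivial there. An element of \<open>K\<close> equals its inverse modulo
  \<open>G'\<close> and has odd order, hence lies in \<open>G'\<close>. As \<open>K\<close>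
  generates \<open>G\<close>, the solvable group \<open>G\<close> would be perfect.\<close>

lemma perfect_odd_contradiction:
  assumes "sol G" "odd (card G)" "G \<noteq> {1}" shows "dhull \<noteq> G"
proof
  assume dG: "dhull = G"
  have nd: "nrm (der G) G" by (rule der_nrm[OF sG nrm_self[OF sG]])
  obtain \<phi> :: "'a \<Rightarrow> nat perm" where \<phi>: "hm \<phi> G" "\<And>g. g \<in> G \<Longrightarrow> \<phi> g = 1 \<longleftrightarrow> g \<in> der G"
    using quotient_perm[OF sG nd] by metis
  have "H \<union> comms G \<subseteq> G" using HG comms_subset[OF sG] by blast
  then have "\<phi> ` G = gen (\<phi> ` (H \<union> comms G))" using hm_gen[OF \<phi>(1)] dG by (simp add: dhull_def)
  also have "\<dots> \<subseteq> \<phi> ` H"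
  proof (rule gen_least)
    show s: "sgrp (\<phi> ` H)" by (rule hm_image_sgrp[OF \<phi>(1) sH HG])
    have "\<phi> c = 1" if "c \<in> comms G" for c
      using that \<phi>(2) comms_subset[OF sG] gen_incl[of "comms G"] by (auto simp: der_def)
    then show "\<phi> ` (H \<union> comms G) \<subseteq> \<phi> ` H" using s by auto
  qed
  finally have \<phi>H: "\<phi> ` G \<subseteq> \<phi> ` H" .
  have \<phi>\<tau>: "\<phi> (\<tau> g) = \<phi> g" if g: "g \<in> G" for g
  proof -
    obtain h where h: "h \<in> H" "\<phi> g = \<phi> h" using \<phi>H g by blast
    have hG: "h \<in> G" using h inG by blast
    define d where "d = inverse h * g"
    have d: "d \<in> G" "g = h * d" using g hG sG by (simp_all add: d_def)
    have "\<phi> d = 1" using h g hG sG by (simp add: d_def hm_mult[OF \<phi>(1)] hm_inv[OF \<phi>(1)])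
    then have "d \<in> der G" using \<phi>(2) d by blast
    moreover have "\<tau> ` der G = der G" using hm_der[OF hm\<tau> sG] image_\<tau> by simp
    ultimately have "\<phi> (\<tau> d) = 1" using \<phi>(2) \<tau>G d by blast
    then show ?thesis using d hG h \<tau>G by (simp add: \<tau>_mult \<tau>H hm_mult[OF \<phi>(1)] \<open>\<phi> d = 1\<close>)
  qed
  have "K \<subseteq> der G"
  proof
    fix k assume k: "k \<in> K"
    have kG: "k \<in> G" using k inG by blast
    have "inverse (\<phi> k) = \<phi> k" using \<phi>\<tau>[OF kG] \<tau>K[OF k] hm_inv[OF \<phi>(1) kG] by simp
    then have "\<phi> k ^ 2 = 1" by (metis power2_eq_square right_inv)
    moreover have "\<phi> k ^ card G = 1"
      using power_card[OF sG kG] hm_power[OF \<phi>(1) kG, of "card G"] hm_one[OF \<phi>(1)] by simp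
    ultimately have "\<phi> k = 1" using coprime_powers_eq_one[of "\<phi> k" 2 "card G"] assms(2) by simp
    then show "k \<in> der G" using \<phi>(2) kG by blast
  qed
  then have "G \<subseteq> der G" using gen_least[OF der_sgrp[OF sG]] gK by blast
  then show False using der_subset[OF sG] sol_der_proper[OF assms(1) sG assms(3)] by blast
qed

end

lemma odd_two_Int_trivial: assumes "odd_sol A" "pgrp 2 B" shows "A \<inter> B \<subseteq> {1}"
proof
  fix x assume x: "x \<in> A \<inter> B"
  then have "x ^ card A = 1" using assms(1) power_card by (auto simp: odd_sol_def)
  moreover obtain a where "x ^ (2 ^ a) = 1" using assms(2) x by (auto simp: pgrp_def)
  moreover have "coprime (2 ^ a) (card A)" using assms(1) by (simp add: odd_sol_def)
  ultimately show "x \<in> {1}" using coprime_powers_eq_one[of x "2 ^ a" "card A"] by simp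
qed

context bruck
begin

text \<open>If \<open>H R = G\<close> for the 2-radical \<open>R\<close>, the index of
  \<open>H\<close> is a power of 2. Otherwise let \<open>A\<close> be a maximal subgroup containing
  \<open>H R\<close>. The odd part of \<open>gen (K \<inter> A)\<close> centralises
  \<open>R\<close>, hence is trivial, so \<open>A\<close> has only the prime 2 in its index over
  \<open>H\<close>. Solvability provides an abelian normal subgroup \<open>W / C\<close> of
  \<open>G / C\<close>, with \<open>C\<close> the core of \<open>A\<close>, that complements
  \<open>A / C\<close>. If the index of \<open>A\<close> is a power of 2,
  \<open>index_two_group\<close> applies. Otherwise it is odd, and \<open>odd_block_system\<close>
  places \<open>comms G\<close> inside \<open>A\<close>, against \<open>dhull = G\<close>.\<close>

lemma solvable_no_odd:
  assumes sol: "sol G" and no_odd: "\<And>A. \<lbrakk>nrm A G; odd_sol A\<rbrakk> \<Longrightarrow> A = {1}"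
    and dG: "dhull = G"
    and tn: "\<And>A. \<lbrakk>sgrp A; H \<subseteq> A; A \<subset> G\<rbrakk> \<Longrightarrow> two_nilpotent (gen (K \<inter> A))"
  shows "pgrp 2 G"
proof -
  obtain R where R: "nrm R G" "pgrp 2 R" "\<And>A. \<lbrakk>nrm A G; pgrp 2 A\<rbrakk> \<Longrightarrow> A \<subseteq> R"
    using pgrp2_radical_ex[OF sG] by metis
  have sR: "sgrp R" and RG: "R \<subseteq> G" using nrm_sgrp[OF R(1)] nrm_subset[OF R(1)] by auto
  define B where "B = pset H R"
  have B: "sgrp B" "H \<subseteq> B" "R \<subseteq> B" "B \<subseteq> G"
    using pset_nrm_sgrp[OF sG sH HG R(1)] pset_superset[OF sH sR] pset_least[OF sG HG RG] by (auto simp: B_def)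
  show ?thesis
  proof (cases "B = G")
    case True
    show ?thesis
    proof (rule index_two_group[OF sG HG order_refl])
      show "q = 2" if "prime q" "q dvd card (rcoss H G)" for q
      proof -
        have "card (rcoss H G) dvd card R"
          by (rule card_rcoss_dvd[OF sH sR]) (use True RG in \<open>auto simp: B_def elim!: psetE\<close>)
        then show ?thesis using pgrp_prime_dvd[OF R(2) two_is_prime_nat that(1)] that(2) dvd_trans by blast
      qed
      show "q = 2" if "prime q" "q dvd card (rcoss G G)" for q
      proof -
        have "card (rcoss G G) * card G = card G" by (rule lagrange_rcoss[OF sG sG order_refl])
        then have "card (rcoss G G) = 1" using card_pos[OF sG] by simp
        then show ?thesis using that not_prime_unit by simp
      qed
    qed
  next
    case False
    then obtain A where A: "sgrp A" "B \<subseteq> A" "A \<subset> G"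
      and max: "\<And>M'. \<lbrakk>sgrp M'; A \<subset> M'; M' \<subseteq> G\<rbrakk> \<Longrightarrow> M' = G"
      using sgrp_maximal[OF sG B(1)] B(4) by blast
    have HA: "H \<subseteq> A" "R \<subseteq> A" "A \<subseteq> G" using A B by auto
    interpret S: folder "gen (K \<inter> A)" "H \<inter> gen (K \<inter> A)" "K \<inter> A" by (rule subfolder[OF A(1) HA(1,3)])
    have L: "pgrp 2 (gen (K \<inter> A))"
    proof -
      obtain N where N: "nrm N A" "N \<subseteq> gen (K \<inter> A)" "odd_sol N" "\<And>g. g \<in> gen (K \<inter> A) \<Longrightarrow> \<exists>a. g ^ (2 ^ a) \<in> N"
        using two_nilpotent_odd_part[OF A(1) subfolder_nrm[OF A(1) HA(1,3)] tn[OF A(1) HA(1) A(3)]] by metis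
      have sN: "sgrp N" and NA: "N \<subseteq> A" using nrm_sgrp[OF N(1)] nrm_subset[OF N(1)] by auto
      have "N \<subseteq> R"
      proof
        fix n assume n: "n \<in> N"
        have nG: "n \<in> G" using n NA HA by blast
        show "n \<in> R"
        proof (rule centralizer_2_radical[OF sG sol no_odd R nG])
          fix r assume r: "r \<in> R"
          have "n * r * inverse n \<in> R" by (rule nrm_conj[OF R(1) nG r])
          then have "n * r * inverse n * inverse r \<in> R" using r sR by simp
          moreover have "r * inverse n * inverse r \<in> N" using nrm_conj[OF N(1), of r "inverse n"] r HA n sN by auto
          then have "n * (r * inverse n * inverse r) \<in> N" using n sN by simp
          ultimately have "n * r * inverse n * inverse r \<in> N \<inter> R" by (simp add: mult.assoc)
          then have "n * r * inverse n * inverse r = 1" using odd_two_Int_trivial[OF N(3) R(2)] by blast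
          then have "n * r * inverse n = r" by simp
          then have "n * r * inverse n * n = r * n" by simp
          then show "n * r = r * n" by (simp add: mult.assoc)
        qed
      qed
      then have "N \<subseteq> {1}" using odd_two_Int_trivial[OF N(3) R(2)] by blast
      then show ?thesis using N(4) S.sG by (fastforce simp: pgrp_def)
    qed
    have q1: "q = 2" if "prime q" "q dvd card (rcoss H A)" for q
      using pgrp_prime_dvd[OF L two_is_prime_nat that(1)] that(2) index_dvd[OF A(1) HA(1,3)] dvd_trans by blast
    define C where "C = {g \<in> G. \<forall>x\<in>G. x * g * inverse x \<in> A}"
    have C: "nrm C G"
    proof (rule nrmI)
      show "sgrp C"
      proof (rule sgrpI)
        fix x y assume xy: "x \<in> C" "y \<in> C"
        have "g * (x * y) * inverse g \<in> A" if "g \<in> G" for g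
        proof -
          have "g * (x * y) * inverse g = (g * x * inverse g) * (g * y * inverse g)" by (simp add: grp_simps)
          then show ?thesis using xy that A(1) by (simp add: C_def)
        qed
        then show "x * y \<in> C" using xy sG by (simp add: C_def)
      qed (use sG A(1) sgrp_finite[OF sG] in \<open>auto simp: C_def\<close>)
      fix g n assume g: "g \<in> G" "n \<in> C"
      have "x * (g * n * inverse g) * inverse x \<in> A" if "x \<in> G" for x
      proof -
        have "x * (g * n * inverse g) * inverse x = (x * g) * n * inverse (x * g)" by (simp add: grp_simps)
        then show ?thesis using g that sG by (simp add: C_def)
      qed
      then show "g * n * inverse g \<in> C" using g sG by (simp add: C_def)
    qed (auto simp: C_def)
    have CA: "C \<subseteq> A"
    proof
      fix c assume "c \<in> C"
      then have "\<forall>x\<in>G. x * c * inverse x \<in> A" by (simp add: C_def)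
      from bspec[OF this sgrp_one[OF sG]] have "1 * c * inverse 1 \<in> A" .
      then show "c \<in> A" by simp
    qed
    have core: "N \<subseteq> C" if "nrm N G" "N \<subseteq> A" for N
      using that nrm_conj[OF that(1)] nrm_subset[OF that(1)] by (auto simp: C_def)
    have sC: "sgrp C" and CG: "C \<subseteq> G" using nrm_sgrp[OF C] nrm_subset[OF C] by auto
    \<comment> \<open>The last derived subgroup \<open>E\<close> not contained in \<open>A\<close>
      has its commutators in \<open>A\<close>, hence in the core \<open>C\<close>. So
      \<open>W = C E\<close> is abelian modulo \<open>C\<close> and supplements the maximal subgroup
      \<open>A\<close>.\<close>
    define i where "i = (LEAST i. (der ^^ i) G \<subseteq> A)"
    obtain n where "(der ^^ n) G \<subseteq> {1}" using sol by (auto simp: sol_def)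
    then have "(der ^^ n) G \<subseteq> A" using A(1) sgrp_one by blast
    then have iA: "(der ^^ i) G \<subseteq> A" unfolding i_def by (rule LeastI)
    then have "i \<noteq> 0" using A(3) by (intro notI) auto
    then obtain j where j: "i = Suc j" using not0_implies_Suc by blast
    define E where "E = (der ^^ j) G"
    have E: "nrm E G" unfolding E_def by (rule der_pow_nrm[OF sG nrm_self[OF sG]])
    have sE: "sgrp E" and EG: "E \<subseteq> G" using nrm_sgrp[OF E] nrm_subset[OF E] by auto
    have EA: "\<not> E \<subseteq> A" unfolding E_def using not_less_Least[of j "\<lambda>i. (der ^^ i) G \<subseteq> A"] by (simp add: i_def[symmetric] j)
    have dE: "der E \<subseteq> C" using iA core[OF der_nrm[OF sG E]] by (simp add: E_def j)
    have \<tau>E: "\<tau> ` E = E" using hm_der_pow[OF hm\<tau> sG order_refl, of j] by (simp add: E_def image_\<tau>)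
    have \<tau>A: "\<tau> a \<in> A" if "a \<in> A" for a
    proof -
      obtain h k where hk: "h \<in> H" "k \<in> K \<inter> A" "a = h * k"
        using subfolder_factor[OF A(1) HA(1,3) \<open>a \<in> A\<close>] by blast
      then show ?thesis using A(1) HA by (auto simp: \<tau>_hk)
    qed
    have \<tau>C: "\<tau> c \<in> C" if c: "c \<in> C" for c
    proof -
      have "x * \<tau> c * inverse x \<in> A" if x: "x \<in> G" for x
      proof -
        have cG: "c \<in> G" using c CG by blast
        have "\<tau> x * c * inverse (\<tau> x) \<in> A" using c \<tau>G[OF x] by (simp add: C_def)
        then have "\<tau> (\<tau> x * c * inverse (\<tau> x)) \<in> A" by (rule \<tau>A)
        moreover have "\<tau> (\<tau> x * c * inverse (\<tau> x)) = x * \<tau> c * inverse x"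
          using x cG \<tau>G sG by (simp add: \<tau>_mult \<tau>_inv \<tau>\<tau>)
        ultimately show ?thesis by simp
      qed
      then show ?thesis using c \<tau>G by (simp add: C_def)
    qed
    obtain \<phi> :: "'a \<Rightarrow> nat perm" where \<phi>: "hm \<phi> G" "\<And>g. g \<in> G \<Longrightarrow> \<phi> g = 1 \<longleftrightarrow> g \<in> C"
      using quotient_perm[OF sG C] by metis
    note m = hm_mult[OF \<phi>(1)] and inv = hm_inv[OF \<phi>(1)]
    define W where "W = pset C E"
    have W: "nrm W G" unfolding W_def by (rule nrm_pset[OF sG C E])
    have sW: "sgrp W" and WG: "W \<subseteq> G" using nrm_sgrp[OF W] nrm_subset[OF W] by auto
    have CW: "C \<subseteq> W" and EW: "E \<subseteq> W" using pset_superset[OF sC sE] by (auto simp: W_def)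
    have \<tau>W: "\<tau> ` W \<subseteq> W"
    proof
      fix y assume "y \<in> \<tau> ` W"
      then obtain c e where ce: "c \<in> C" "e \<in> E" "y = \<tau> (c * e)" by (auto simp: W_def elim!: psetE)
      then have "c \<in> G" "e \<in> G" using CG EG by auto
      then have "y = \<tau> c * \<tau> e" using ce by (simp add: \<tau>_mult)
      moreover have "\<tau> e \<in> E" using ce \<tau>E by blast
      ultimately show "y \<in> W" using ce \<tau>C by (auto simp: W_def intro: psetI)
    qed
    have \<phi>W: "\<phi> x * \<phi> y = \<phi> y * \<phi> x" if xW: "x \<in> W" and yW: "y \<in> W" for x y
    proof -
      obtain c e where x: "c \<in> C" "e \<in> E" "x = c * e" using xW unfolding W_def by (rule psetE)
      obtain c' e' where y: "c' \<in> C" "e' \<in> E" "y = c' * e'" using yW unfolding W_def by (rule psetE)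
      have G: "c \<in> G" "e \<in> G" "c' \<in> G" "e' \<in> G" using x y CG EG by auto
      have "\<phi> (e * e' * inverse e * inverse e') = 1"
        using der_comm[OF x(2) y(2)] dE \<phi>(2) CG by blast
      then have "\<phi> e * \<phi> e' * inverse (\<phi> e) * inverse (\<phi> e') = 1" using G sG by (simp add: m inv)
      then have "\<phi> e * \<phi> e' * inverse (\<phi> e) = \<phi> e'" by simp
      then have "\<phi> e * \<phi> e' * inverse (\<phi> e) * \<phi> e = \<phi> e' * \<phi> e" by simp
      then have "\<phi> e * \<phi> e' = \<phi> e' * \<phi> e" by (simp add: mult.assoc)
      moreover have "\<phi> c = 1" "\<phi> c' = 1" using x y G \<phi>(2) by blast+
      then have "\<phi> x = \<phi> e" "\<phi> y = \<phi> e'" using x y G by (simp_all add: m)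
      ultimately show ?thesis by simp
    qed
    have ab: "x * y * inverse x * inverse y \<in> C" if "x \<in> W" "y \<in> W" for x y
    proof -
      have G: "x \<in> G" "y \<in> G" using that WG by auto
      have "\<phi> (x * y * inverse x * inverse y) = \<phi> x * \<phi> y * inverse (\<phi> y * \<phi> x)"
        using G sG by (simp add: m inv grp_simps)
      also have "\<dots> = 1" unfolding \<phi>W[OF that] by (rule right_inv)
      finally show ?thesis using \<phi>(2) G sG by simp
    qed
    have full: "\<exists>a\<in>A. \<exists>w\<in>V. g = a * w" if V: "nrm V G" "\<not> V \<subseteq> A" and g: "g \<in> G" for V g
    proof -
      have sV: "sgrp V" and VG: "V \<subseteq> G" using nrm_sgrp[OF V(1)] nrm_subset[OF V(1)] by auto
      have "pset A V = G"
      proof (rule max)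
        show "sgrp (pset A V)" by (rule pset_nrm_sgrp[OF sG A(1) HA(3) V(1)])
        show "A \<subset> pset A V" using pset_superset[OF A(1) sV] V(2) by blast
        show "pset A V \<subseteq> G" by (rule pset_least[OF sG HA(3) VG])
      qed
      then have "g \<in> pset A V" using g by simp
      then show ?thesis by (auto elim!: psetE)
    qed
    have WnA: "\<not> W \<subseteq> A" using EA EW by blast
    \<comment> \<open>\<open>A\<close> normalises \<open>W \<inter> A\<close>, and so does
      \<open>W\<close> because \<open>W / C\<close> is abelian; together they make up
      \<open>G\<close>.\<close>
    have "nrm (W \<inter> A) G"
    proof (rule nrmI)
      show "sgrp (W \<inter> A)" by (rule sgrp_Int[OF sW A(1)])
      show "W \<inter> A \<subseteq> G" using HA by blast
      fix g x assume g: "g \<in> G" and x: "x \<in> W \<inter> A"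
      obtain a w where aw: "a \<in> A" "w \<in> W" "g = a * w" using full[OF W WnA g] by blast
      have "w * x * inverse w * inverse x \<in> A" using ab[of w x] aw x CA by blast
      then have "w * x * inverse w * inverse x * x \<in> A" using x sgrp_mult[OF A(1)] by blast
      then have "w * x * inverse w \<in> A" by (simp add: mult.assoc)
      then have "a * (w * x * inverse w) * inverse a \<in> A" using aw(1) A(1) by simp
      then have "g * x * inverse g \<in> A" by (simp add: aw grp_simps)
      moreover have "g * x * inverse g \<in> W" using nrm_conj[OF W g] x by blast
      ultimately show "g * x * inverse g \<in> W \<inter> A" by blast
    qed
    then have WA: "W \<inter> A = C" using core[of "W \<inter> A"] CW CA by blast
    \<comment> \<open>The preimage of the 2-part of \<open>W / C\<close>. If it is not inside
      \<open>A\<close>, it already supplements \<open>A\<close>, and the index of \<open>A\<close>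
      is a power of 2. If it is, it equals \<open>C\<close>, and the index is odd.\<close>
    define V where "V = {w \<in> W. \<exists>a. w ^ (2 ^ a) \<in> C}"
    have VW: "V \<subseteq> W" by (auto simp: V_def)
    have CV: "C \<subseteq> V"
    proof
      fix c assume "c \<in> C"
      then have "c \<in> W" "c ^ (2 ^ 0) \<in> C" using CW by auto
      then show "c \<in> V" unfolding V_def by blast
    qed
    have V: "nrm V G"
    proof (rule nrmI)
      show "sgrp V"
      proof (rule sgrpI)
        show "finite V" using sgrp_finite[OF sW] by (simp add: V_def)
        show "1 \<in> V" using CV sC by auto
        fix x y assume "x \<in> V" "y \<in> V"
        then obtain a b where xy: "x \<in> W" "y \<in> W" "x ^ (2 ^ a) \<in> C" "y ^ (2 ^ b) \<in> C" by (auto simp: V_def)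
        have xyG: "x \<in> G" "y \<in> G" using xy WG by auto
        define n where "n = (2::nat) ^ (a + b)"
        have "(x ^ (2 ^ a)) ^ (2 ^ b) \<in> C" "(y ^ (2 ^ b)) ^ (2 ^ a) \<in> C" using xy sC by auto
        then have xn: "x ^ n \<in> C" "y ^ n \<in> C"
          by (simp_all add: n_def power_add mult.commute flip: power_mult)
        have "\<phi> ((x * y) ^ n) = (\<phi> x * \<phi> y) ^ n" using hm_power[OF \<phi>(1)] m xyG sG by simp
        also have "\<dots> = \<phi> x ^ n * \<phi> y ^ n"
          using power_mult_class2[of "\<phi> y" "\<phi> x" 1 n] \<phi>W xy by simp
        also have "\<dots> = 1" using hm_power[OF \<phi>(1)] \<phi>(2) xn xyG sG CG by (metis mult_1_left subsetD)
        finally have "(x * y) ^ n \<in> C" using \<phi>(2) xyG sG by simp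
        then show "x * y \<in> V" using xy sW by (auto simp: V_def n_def)
      qed
      fix g v assume g: "g \<in> G" "v \<in> V"
      then obtain a where a: "v \<in> W" "v ^ (2 ^ a) \<in> C" by (auto simp: V_def)
      have "(g * v * inverse g) ^ (2 ^ a) \<in> C" unfolding conj_power by (rule nrm_conj[OF C g(1) a(2)])
      then show "g * v * inverse g \<in> V" using nrm_conj[OF W g(1) a(1)] by (auto simp: V_def)
    qed (use VW WG in blast)
    have sV: "sgrp V" and VG: "V \<subseteq> G" using nrm_sgrp[OF V] nrm_subset[OF V] by auto
    have index: "card (rcoss A G) = card (rcoss C U)" if U: "nrm U G" "\<not> U \<subseteq> A" "C \<subseteq> U" "U \<subseteq> W" for U
    proof -
      have sU: "sgrp U" and UG: "U \<subseteq> G" using nrm_sgrp[OF U(1)] nrm_subset[OF U(1)] by auto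
      have "rcoss A G = rcoss A U" by (rule rcoss_eq[OF A(1) _ UG]) (use full[OF U(1,2)] in blast)
      moreover have "card (rcoss A U) * card (A \<inter> U) = card U" by (rule card_rcoss[OF A(1) sU])
      moreover have "card (rcoss C U) * card C = card U" by (rule lagrange_rcoss[OF sC sU U(3)])
      moreover have "A \<inter> U = C" using WA U CA by blast
      ultimately have "card (rcoss A G) * card C = card (rcoss C U) * card C" by simp
      then show ?thesis using card_pos[OF sC] by simp
    qed
    show ?thesis
    proof (cases "V \<subseteq> A")
      case False
      show ?thesis
      proof (rule index_two_group[OF A(1) HA(1,3) q1])
        fix q assume q: "prime q" "q dvd card (rcoss A G)"
        then have "q dvd card (rcoss C V)" using index[OF V False CV VW] by simp
        moreover have "nrm C V" by (rule nrm_mono[OF C CV VG])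
        ultimately show "q = 2"
          using quotient_prime_dvd[OF sV _ _ q(1)] by (simp add: V_def)
      qed
    next
      case True
      then have VC: "V = C" using WA VW CV by blast
      have "odd (card (rcoss A G))"
      proof
        assume "even (card (rcoss A G))"
        then have e: "2 dvd card (rcoss C W)" using index[OF W WnA CW order_refl] by simp
        \<comment> \<open>Inversion on a group \<open>W / C\<close> of even order fixes an even
          number of elements. But a coset equal to its inverse squares to \<open>C\<close>, so it
          lies in \<open>V / C\<close>, which is trivial, and only one is fixed.\<close>
        define f where "f = (\<lambda>D. (\<lambda>x. inverse x) ` D :: 'a set)"
        have fC: "f (rcos C w) = rcos C (inverse w)" if w: "w \<in> W" for w
        proof
          have wG: "w \<in> G" using w WG by blast
          show "f (rcos C w) \<subseteq> rcos C (inverse w)"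
          proof
            fix y assume "y \<in> f (rcos C w)"
            then obtain c where c: "c \<in> C" "y = inverse (c * w)" by (auto simp: f_def rcos_def)
            then have "y = (inverse w * inverse c * w) * inverse w" by (simp add: grp_simps)
            moreover have "inverse w * inverse c * w \<in> C" using nrm_conj'[OF C sG wG] c sC by simp
            ultimately show "y \<in> rcos C (inverse w)" by (auto simp: rcos_def)
          qed
          show "rcos C (inverse w) \<subseteq> f (rcos C w)"
          proof
            fix y assume "y \<in> rcos C (inverse w)"
            then obtain c where c: "c \<in> C" "y = c * inverse w" by (auto simp: rcos_def)
            then have "y = inverse ((w * inverse c * inverse w) * w)" by (simp add: grp_simps)
            moreover have "w * inverse c * inverse w \<in> C" using nrm_conj[OF C wG] c sC by simp
            ultimately show "y \<in> f (rcos C w)" by (auto simp: f_def rcos_def)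
          qed
        qed
        have fin: "finite (rcoss C W)" by (simp add: finite_rcoss sgrp_finite sW)
        have "card (rcoss C W) mod 2 = card {D \<in> rcoss C W. f D = D} mod 2"
          by (rule card_fixpoints_prime[OF two_is_prime_nat fin])
             (use sW fC in \<open>auto simp: rcoss_def numeral_2_eq_2\<close>)
        moreover have "{D \<in> rcoss C W. f D = D} = {C}"
        proof -
          have "rcos C w = C" if w: "w \<in> W" "rcos C (inverse w) = rcos C w" for w
          proof -
            have "w * w \<in> C" using w(2) rcos_eq_iff[OF sC, of "inverse w" w] by simp
            then have "w ^ (2 ^ 1) \<in> C" by (simp add: power2_eq_square)
            then have "w \<in> V" using w(1) unfolding V_def by blast
            then show ?thesis using VC rcos_eq_self[OF sC] by simp
          qed
          moreover have "C \<in> rcoss C W" "f C = C"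
          proof -
            have "rcos C 1 = C" by (simp add: rcos_def)
            moreover have "1 \<in> W" using sW by simp
            ultimately show "C \<in> rcoss C W" "f C = C" using fC[of 1] by (auto simp: rcoss_def)
          qed
          moreover have "D = C" if "D \<in> rcoss C W" "f D = D" for D
          proof -
            from that(1) obtain w where "w \<in> W" "D = rcos C w" by (auto simp: rcoss_def)
            then show ?thesis using calculation(1)[of w] that(2) fC[of w] by simp
          qed
          ultimately show ?thesis by blast
        qed
        ultimately show False using e by simp
      qed
      then have "comms G \<subseteq> A"
        using odd_block_system[OF A(1) HA(1,3) C W CW WA \<tau>W full[OF W WnA] ab] by blast
      then have "dhull \<subseteq> A" unfolding dhull_def using gen_least[OF A(1)] HA(1) by blast
      then show ?thesis using dG A(3) by blast
    qed
  qed
qed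

end

context folder
begin

lemma subfolder_card: assumes "sgrp A" "A \<subset> G" shows "card (gen (K \<inter> A)) < card G"
proof -
  have "gen (K \<inter> A) \<subseteq> A" by (rule gen_least[OF assms(1)]) blast
  then have "gen (K \<inter> A) \<subset> G" using assms(2) by blast
  then show ?thesis using psubset_card_mono sgrp_finite[OF sG] by blast
qed

lemma subfolder_sol: assumes "sgrp A" "A \<subseteq> G" "sol G" shows "sol (gen (K \<inter> A))"
  using sol_mono[OF assms(3)] gen_least[OF assms(1), of "K \<inter> A"] assms(2) by blast

end

text \<open>The critical case is \<open>dhull = G\<close>, where the first \<open>dl\<close> step
  does not descend. Then \<open>G\<close> is no 2-group, because in a 2-group \<open>H\<close> would
  lie in a normal subgroup of index two, which also contains \<open>comms G\<close>. So by
  \<open>solvable_no_odd\<close> there is an odd solvable normal subgroup \<open>N\<close>. It is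
  proper by \<open>perfect_odd_contradiction\<close>, and
  \<open>K \<inter> H N = K \<inter> N\<close> by \<open>odd_block\<close>; the induction hypotheses
  for the quotient and for this subfolder combine.\<close>

theorem bruck_sol_lsol:
  fixes G H K :: "nat perm set"
  assumes "bruck G H K \<tau>" "sol G" shows "lsol H K"
  using assms
proof (induction "card G" arbitrary: G H K \<tau> rule: less_induct)
  case less
  interpret bruck G H K \<tau> by (rule less.prems(1))
  have IH: "lsol H (K \<inter> A)" if A: "sgrp A" "H \<subseteq> A" "A \<subset> G" for A
  proof -
    have AG: "A \<subseteq> G" using A by blast
    have "lsol (H \<inter> gen (K \<inter> A)) (K \<inter> A)"
      by (rule less.hyps[OF subfolder_card[OF A(1,3)] subbruck[OF A(1,2) AG] subfolder_sol[OF A(1) AG less.prems(2)]])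
    then show ?thesis using subfolder_lsol[OF A(1,2) AG] by blast
  qed
  show ?case
  proof (cases "K \<subseteq> {1}")
    case True
    then show ?thesis by (rule lsol_trivial)
  next
    case ne: False
    have G1: "G \<noteq> {1}" using ne KG by blast
    show ?thesis
    proof (cases "dhull = G")
      case False
      then have "lsol H (dl H K)" unfolding dl_hull using IH[OF dhull(1,2)] dhull(4) by blast
      then show ?thesis by (rule lsol_dl)
    next
      case dG: True
      have "pgrp 2 G \<or> lsol H K"
      proof (cases "\<exists>A. nrm A G \<and> odd_sol A \<and> A \<noteq> {1}")
        case True
        then obtain N where N: "nrm N G" "odd_sol N" "N \<noteq> {1}" "\<tau> ` N \<subseteq> N" using odd_normal_closure_\<tau> by metis
        have o: "odd (card N)" and sN: "sgrp N" and NG: "N \<subseteq> G" using N nrm_subset by (auto simp: odd_sol_def)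
        have "N \<noteq> G" using perfect_odd_contradiction[OF less.prems(2)] o G1 dG by blast
        obtain \<phi> :: "nat perm \<Rightarrow> nat perm" and \<tau>' where \<phi>: "sharp_hm \<phi>" "\<And>g. g \<in> G \<Longrightarrow> \<phi> g = 1 \<longleftrightarrow> g \<in> N"
          "bruck (\<phi> ` G) (\<phi> ` H) (\<phi> ` K) \<tau>'" "card (\<phi> ` G) < card G"
          using odd_quotient[OF N] by metis
        have h: "hm \<phi> G" using \<phi>(1) by (simp add: sharp_hm_def)
        have q: "lsol (\<phi> ` H) (\<phi> ` K)"
          by (rule less.hyps[OF \<phi>(4,3) sol_image[OF h sG order_refl less.prems(2)]])
        define A where "A = pset H N"
        have A: "sgrp A" "H \<subseteq> A" "A \<subseteq> G" "N \<subseteq> A"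
          using pset_nrm_sgrp[OF sG sH HG N(1)] pset_superset[OF sH sN] pset_least[OF sG HG NG] by (auto simp: A_def)
        have KA: "K \<inter> A = K \<inter> N" using odd_block[OF N(1) o N(4)] A(4) by (auto simp: A_def)
        have "gen (K \<inter> A) \<subseteq> N" unfolding KA by (rule gen_least[OF sN]) blast
        then have "gen (K \<inter> A) \<subset> G" using NG \<open>N \<noteq> G\<close> by blast
        then have c: "card (gen (K \<inter> A)) < card G" using psubset_card_mono sgrp_finite[OF sG] by blast
        have "lsol (H \<inter> gen (K \<inter> A)) (K \<inter> A)"
          by (rule less.hyps[OF c subbruck[OF A(1-3)] subfolder_sol[OF A(1,3) less.prems(2)]])
        then have "lsol H (K \<inter> A)" using subfolder_lsol[OF A(1-3)] by blast
        then have "lsol H K"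
          using lsol_extension[OF h KG q, of "K \<inter> A"] \<phi>(2) KG A(4) by blast
        then show ?thesis ..
      next
        case False
        then have no_odd: "\<And>A. \<lbrakk>nrm A G; odd_sol A\<rbrakk> \<Longrightarrow> A = {1}" by blast
        have "two_nilpotent (gen (K \<inter> A))" if A: "sgrp A" "H \<subseteq> A" "A \<subset> G" for A
        proof -
          have AG: "A \<subseteq> G" using A by blast
          show ?thesis
            using bruck_lsol_two_nilpotent[OF subbruck[OF A(1,2) AG]] IH[OF A] subfolder_lsol[OF A(1,2) AG] by blast
        qed
        then show ?thesis using solvable_no_odd[OF less.prems(2) no_odd dG] by blast
      qed
      moreover have "\<not> pgrp 2 G"
      proof
        assume p: "pgrp 2 G"
        have "H \<noteq> G" using HK1 ne KG by blast
        then obtain M where M: "sgrp M" "H \<subseteq> M" "M \<subset> G" "\<And>v u. \<lbrakk>v \<in> G; u \<in> M\<rbrakk> \<Longrightarrow> v * u * inverse v \<in> M"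
          "\<And>x y. \<lbrakk>x \<in> G; y \<in> G; x \<notin> M; y \<notin> M\<rbrakk> \<Longrightarrow> x * y \<in> M"
          using pgrp2_index2[OF p sH] HG by (metis psubsetI)
        have "comms G \<subseteq> M"
        proof
          fix c assume "c \<in> comms G"
          then obtain x y where c: "x \<in> G" "y \<in> G" "c = x * y * inverse x * inverse y" by (rule commsE)
          consider "x \<in> M" | "y \<in> M" | "x \<notin> M" "y \<notin> M" by blast
          then show "c \<in> M"
          proof cases
            case 1
            then have "x * (y * inverse x * inverse y) \<in> M" using M c by simp
            then show ?thesis by (simp add: c mult.assoc)
          next
            case 2
            then have "(x * y * inverse x) * inverse y \<in> M" using M c by simp
            then show ?thesis by (simp add: c mult.assoc)
          next
            case 3
            then have "x * y \<in> M" "y * x \<in> M" using M(5) c by blast+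
            then have "(x * y) * inverse (y * x) \<in> M" using sgrp_mult[OF M(1) _ sgrp_inv[OF M(1)]] by blast
            then show ?thesis by (simp add: c grp_simps)
          qed
        qed
        then have "dhull \<subseteq> M" unfolding dhull_def using gen_least[OF M(1)] M(2) by blast
        then show False using dG M(3) by blast
      qed
      ultimately show ?thesis by blast
    qed
  qed
qed

section \<open>Reduction to folders with an inverting automorphism\<close>

context folder
begin

text \<open>Exactly the ambiguity of \<open>t\<close> in the equation \<open>g K = K t\<close>,
  hence what has to be divided out before \<tau> exists.\<close>

definition nucleus :: "'a set" where
  "nucleus = {g \<in> G. \<forall>k\<in>K. k * g \<in> K}"

lemma nucleusD: "\<lbrakk>g \<in> nucleus; k \<in> K\<rbrakk> \<Longrightarrow> k * g \<in> K" "g \<in> nucleus \<Longrightarrow> g \<in> K" "g \<in> nucleus \<Longrightarrow> g \<in> G"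
  using oneK by (auto simp: nucleus_def)

lemma sgrp_nucleus: "sgrp nucleus"
proof (rule sgrpI)
  fix x y assume xy: "x \<in> nucleus" "y \<in> nucleus"
  have "k * (x * y) \<in> K" if "k \<in> K" for k
  proof -
    have "k * x * y \<in> K" by (intro nucleusD(1) xy that)
    then show ?thesis by (simp add: mult.assoc)
  qed
  then show "x * y \<in> nucleus" using xy sG by (simp add: nucleus_def)
qed (use sG sgrp_finite[OF sG] in \<open>auto simp: nucleus_def\<close>)

text \<open>By \<open>factor\<close> it suffices to conjugate by \<open>H\<close>, which normalises
  \<open>K\<close>, and by \<open>l\<close> in \<open>K\<close>, where \<open>k * (l * x * inverse
  l) = inverse l * ((l * k * l) * x) * inverse l\<close> uses \<open>tw\<close> on both sides of the
  nucleus property.\<close>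

lemma nrm_nucleus: "nrm nucleus G"
proof (rule nrmI[OF sgrp_nucleus])
  have conjH: "h * x * inverse h \<in> nucleus" if h: "h \<in> H" and x: "x \<in> nucleus" for h x
  proof -
    have hG: "h \<in> G" using h HG by blast
    have "k * (h * x * inverse h) \<in> K" if k: "k \<in> K" for k
    proof -
      have "inverse h * k * inverse (inverse h) \<in> K" by (rule Ar[OF _ k]) (use h sH in simp)
      then have "(inverse h * k * inverse (inverse h)) * x \<in> K" by (rule nucleusD(1)[OF x])
      then have "h * ((inverse h * k * inverse (inverse h)) * x) * inverse h \<in> K" by (rule Ar[OF h])
      then show ?thesis by (simp add: mult.assoc)
    qed
    then show ?thesis using hG x sG by (simp add: nucleus_def)
  qed
  have conjK: "l * x * inverse l \<in> nucleus" if l: "l \<in> K" and x: "x \<in> nucleus" for l x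
  proof -
    have lG: "l \<in> G" using l KG by blast
    have "k * (l * x * inverse l) \<in> K" if k: "k \<in> K" for k
    proof -
      have "(l * k * l) * x \<in> K" by (rule nucleusD(1)[OF x tw[OF l k]])
      then have "inverse l * ((l * k * l) * x) * inverse l \<in> K" using tw invK[OF l] by blast
      then show ?thesis by (simp add: mult.assoc)
    qed
    then show ?thesis using lG x sG by (simp add: nucleus_def)
  qed
  fix g n assume g: "g \<in> G" and n: "n \<in> nucleus"
  obtain h l where hl: "h \<in> H" "l \<in> K" "g = h * l" using factor[OF g] by blast
  have "h * (l * n * inverse l) * inverse h \<in> nucleus" by (intro conjH conjK hl n)
  then show "g * n * inverse g \<in> nucleus" by (simp add: hl grp_simps)
qed (auto simp: nucleus_def)

text \<open>The nucleus factor can be absorbed into \<open>l\<close>: with a conjugate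
  \<open>n'\<close> of it, \<open>n' * l\<close> is again in \<open>K\<close>, and
  \<open>sharp\<close> compares \<open>k\<close> with \<open>n' * l\<close>.\<close>

lemma nucleus_sharp:
  assumes g: "g \<in> G" and k: "k \<in> K" and l: "l \<in> K" and i: "g * k * inverse l * inverse g \<in> pset H nucleus"
  shows "k * inverse l \<in> nucleus"
proof -
  obtain h n where hn: "h \<in> H" "n \<in> nucleus" "g * k * inverse l * inverse g = h * n" using i by (rule psetE)
  define n' where "n' = inverse g * n * g"
  have n': "n' \<in> nucleus" unfolding n'_def by (rule nrm_conj'[OF nrm_nucleus sG g hn(2)])
  have "inverse l * n' * l \<in> nucleus" using nrm_conj'[OF nrm_nucleus sG _ n'] l KG by blast
  then have "l * (inverse l * n' * l) \<in> K" using nucleusD(1) l by blast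
  then have n'l: "n' * l \<in> K" by (simp add: mult.assoc)
  have "g * k * inverse (n' * l) * inverse g = (g * k * inverse l * inverse g) * inverse n"
    by (simp add: n'_def grp_simps)
  also have "\<dots> = h" unfolding hn(3) by (simp add: mult.assoc)
  finally have "k = n' * l" using sharp[OF k n'l g] hn(1) by simp
  then show ?thesis using n' by (simp add: mult.assoc)
qed

text \<open>The automorphism \<open>\<tau>\<close> is determined by \<open>g K = K \<tau>(g)\<close>.\<close>

lemma trivial_nucleus_bruck:
  assumes triv: "nucleus = {1}"
  obtains \<tau> where "bruck G H K \<tau>"
proof -
  define P where "P = (\<lambda>g t. t \<in> G \<and> (\<forall>k\<in>K. g * k * inverse t \<in> K))"
  have ex: "\<exists>t. P g t" if g: "g \<in> G" for g
  proof -
    obtain h m where hm: "h \<in> H" "m \<in> K" "g = h * m" using factor[OF g] by blast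
    \<comment> \<open>The solution \<open>t = h * inverse m\<close>: here
      \<open>g * k * inverse t\<close> is \<open>m * k * m\<close> conjugated by
      \<open>h\<close>.\<close>
    have "g * k * inverse (h * inverse m) \<in> K" if "k \<in> K" for k
    proof -
      have "h * (m * k * m) * inverse h \<in> K" by (intro Ar tw hm that)
      then show ?thesis by (simp add: hm grp_simps)
    qed
    moreover have "h \<in> G" "m \<in> G" using hm HG KG by auto
    then have "h * inverse m \<in> G" using sG by simp
    ultimately show ?thesis unfolding P_def by blast
  qed
  \<comment> \<open>The map \<open>k \<mapsto> g * k * inverse t\<close> permutes the finite set
    \<open>K\<close>, so two solutions differ by an element of \<open>nucleus\<close>.\<close>
  have unique: "t = t'" if t: "P g t" "P g t'" and g: "g \<in> G" for g t t'
  proof -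
    define f where "f = (\<lambda>k. g * k * inverse t)"
    have fK: "finite K" using KG sgrp_finite[OF sG] finite_subset by blast
    have fsub: "f ` K \<subseteq> K" using t(1) by (auto simp: f_def P_def)
    have finj: "inj_on f K" by (auto simp: f_def inj_on_def)
    have surj: "f ` K = K" by (rule endo_inj_surj[OF fK fsub finj])
    have "k * (t * inverse t') \<in> K" if "k \<in> K" for k
    proof -
      obtain l where l: "l \<in> K" "k = g * l * inverse t" using surj \<open>k \<in> K\<close> by (auto simp: f_def image_iff)
      have "k * (t * inverse t') = g * l * inverse t'" by (simp add: l mult.assoc)
      then show ?thesis using t(2) l by (simp add: P_def)
    qed
    moreover have "t * inverse t' \<in> G" using t sG by (simp add: P_def)
    ultimately have "t * inverse t' \<in> nucleus" by (simp add: nucleus_def)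
    then show ?thesis using triv by simp
  qed
  define \<tau> where "\<tau> = (\<lambda>g. THE t. P g t)"
  have val: "\<tau> g = t" if "P g t" "g \<in> G" for g t
    unfolding \<tau>_def by (rule the_equality[where P = "P g", OF that(1)]) (rule unique[OF _ that])
  have P\<tau>: "P g (\<tau> g)" if "g \<in> G" for g using ex[OF that] val that by metis
  have "bruck G H K \<tau>"
  proof unfold_locales
    show "hm \<tau> G"
      unfolding hm_def
    proof (intro conjI ballI)
      fix x y assume x: "x \<in> G" and y: "y \<in> G"
      show "\<tau> (x * y) = \<tau> x * \<tau> y"
      proof (rule val)
        have "x * y * k * inverse (\<tau> x * \<tau> y) \<in> K" if "k \<in> K" for k
        proof -
          have "x * (y * k * inverse (\<tau> y)) * inverse (\<tau> x) \<in> K" using P\<tau>[OF x] P\<tau>[OF y] that by (simp add: P_def)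
          then show ?thesis by (simp add: grp_simps)
        qed
        then show "P (x * y) (\<tau> x * \<tau> y)" using P\<tau>[OF x] P\<tau>[OF y] sG by (simp add: P_def)
      qed (use x y sG in simp)
    qed (rule sG)
    show "\<tau> k = inverse k" if "k \<in> K" for k
      by (rule val) (use that tw KG sG in \<open>auto simp: P_def\<close>)
    show "\<tau> h = h" if "h \<in> H" for h
      by (rule val) (use that Ar HG in \<open>auto simp: P_def\<close>)
  qed
  then show thesis by (rule that)
qed

end

text \<open>A trivial nucleus gives a Bruck folder. If the nucleus is all of \<open>G\<close>, then
  \<open>K = G\<close> and \<open>H\<close> is trivial, the loop is a group and \<open>dhull\<close>
  is the derived subgroup. Otherwise both the quotient by the nucleus and the nucleus itself, as the
  subfolder over \<open>H nucleus\<close>, are smaller.\<close>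

lemma folder_lsol_iff_sol_perm:
  fixes G H K :: "nat perm set"
  assumes "folder G H K" shows "lsol H K \<longleftrightarrow> sol G"
  using assms
proof (induction "card G" arbitrary: G H K rule: less_induct)
  case less
  interpret folder G H K by (rule less.prems)
  show ?case
  proof (cases "nucleus = {1}")
    case True
    then obtain \<tau> where b: "bruck G H K \<tau>" using trivial_nucleus_bruck by metis
    show ?thesis using bruck_lsol_two_nilpotent[OF b] two_nilpotent_sol[OF sG] bruck_sol_lsol[OF b] by blast
  next
    case nt: False
    note N = nrm_nucleus sgrp_nucleus
    have NK: "nucleus \<subseteq> K" and NG: "nucleus \<subseteq> G" using nucleusD by blast+
    show ?thesis
    proof (cases "nucleus = G")
      case True
      then have KG': "K = G" using NK KG by blast
      have H1: "H = {1}" using HK1 HG KG' sH sgrp_one by blast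
      have ne: "\<not> K \<subseteq> {1}" using nt True KG' oneK by blast
      have dd: "dhull = der G"
      proof
        have "1 \<in> der G" using der_sgrp[OF sG] by simp
        then have "H \<union> comms G \<subseteq> der G" using gen_incl[of "comms G"] by (simp add: H1 der_def)
        then show "dhull \<subseteq> der G" unfolding dhull_def by (rule gen_least[OF der_sgrp[OF sG]])
        show "der G \<subseteq> dhull" unfolding der_def by (rule gen_least[OF dhull(1,3)])
      qed
      have gd: "gen (K \<inter> dhull) = dhull" using gen_sgrp[OF dhull(1)] dhull(4) KG' by (simp add: Int_absorb1)
      have IH: "lsol H (K \<inter> dhull) \<longleftrightarrow> sol dhull" if "dhull \<noteq> G"
      proof -
        have c: "card (gen (K \<inter> dhull)) < card G" by (rule subfolder_card[OF dhull(1)]) (use that dhull(4) in blast)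
        show ?thesis
          using less.hyps[OF c subfolder[OF dhull(1,2,4)]] subfolder_lsol[OF dhull(1,2,4)] gd by simp
      qed
      show ?thesis
      proof
        assume l: "lsol H K"
        then have "sol dhull" using IH[OF dhull_proper[OF l ne]] lsol_mono[OF l] by blast
        then show "sol G" using sol_der dd by simp
      next
        assume s: "sol G"
        have "G \<noteq> {1}" using ne KG by blast
        then have "dhull \<noteq> G" using sol_der_proper[OF s sG] dd by simp
        then have "lsol H (dl H K)" unfolding dl_hull using IH sol_mono[OF s dhull(4)] by blast
        then show "lsol H K" by (rule lsol_dl)
      qed
    next
      case False
      obtain \<phi> :: "nat perm \<Rightarrow> nat perm" where \<phi>: "sharp_hm \<phi>" "\<And>g. g \<in> G \<Longrightarrow> \<phi> g = 1 \<longleftrightarrow> g \<in> nucleus"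
      proof (rule quotient_folder[OF N(1)])
        show "k * inverse l \<in> nucleus"
          if "g \<in> G" "k \<in> K" "l \<in> K" "g * k * inverse l * inverse g \<in> pset H nucleus" for g k l
          by (rule nucleus_sharp[OF that])
      qed blast
      have h: "hm \<phi> G" using \<phi>(1) by (simp add: sharp_hm_def)
      obtain n where n: "n \<in> nucleus" "n \<noteq> 1" using nt N(2) sgrp_one by blast
      have c: "card (\<phi> ` G) < card G" using card_image_hm_less[OF h, of n] n NG \<phi>(2) by blast
      have q: "lsol (\<phi> ` H) (\<phi> ` K) \<longleftrightarrow> sol (\<phi> ` G)" by (rule less.hyps[OF c image_folder[OF \<phi>(1)]])
      define A where "A = pset H nucleus"
      have A: "sgrp A" "H \<subseteq> A" "A \<subseteq> G" "nucleus \<subseteq> A"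
        using pset_nrm_sgrp[OF sG sH HG N(1)] pset_superset[OF sH N(2)] pset_least[OF sG HG NG] by (auto simp: A_def)
      have KA: "K \<inter> A = nucleus"
      proof
        show "K \<inter> A \<subseteq> nucleus" using nucleus_sharp[of 1 _ 1] sG oneK by (auto simp: A_def)
      qed (use NK A in blast)
      have gN: "gen (K \<inter> A) = nucleus" unfolding KA by (rule gen_sgrp[OF N(2)])
      have "nucleus \<subset> G" using NG False by blast
      then have cN: "card (gen (K \<inter> A)) < card G" unfolding gN using psubset_card_mono sgrp_finite[OF sG] by blast
      have i: "lsol H nucleus \<longleftrightarrow> sol nucleus"
        using less.hyps[OF cN subfolder[OF A(1-3)]] subfolder_lsol[OF A(1-3)] gN KA by simp
      show ?thesis
      proof
        assume l: "lsol H K"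
        have "sol (\<phi> ` G)" using q image_lsol[OF \<phi>(1) l] by blast
        moreover have "sol nucleus" using i lsol_mono[OF l NK] by blast
        ultimately show "sol G" using sol_extension[OF h] \<phi>(2) by blast
      next
        assume s: "sol G"
        have "lsol (\<phi> ` H) (\<phi> ` K)" using q sol_image[OF h sG order_refl s] by blast
        moreover have "lsol H nucleus" using i sol_mono[OF s NG] by blast
        ultimately show "lsol H K" using lsol_extension[OF h KG] \<phi>(2) KG by blast
      qed
    qed
  qed
qed

text \<open>The regular representation, as a quotient by the trivial subgroup, moves an arbitrary
  folder to \<open>nat perm\<close>.\<close>

theorem (in folder) lsol_iff_sol: "lsol H K \<longleftrightarrow> sol G"
proof -
  have n1: "nrm {1} G" using sG by (intro nrmI) auto
  obtain \<phi> :: "'a \<Rightarrow> nat perm" where \<phi>: "hm \<phi> G" "\<And>g. g \<in> G \<Longrightarrow> \<phi> g = 1 \<longleftrightarrow> g \<in> {1}"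
    using quotient_perm[OF sG n1] by metis
  have inj: "x = y" if "x \<in> G" "y \<in> G" "\<phi> x = \<phi> y" for x y
    using hm_eq_iff[OF \<phi>(1) that(1,2)] \<phi>(2)[of "x * inverse y"] that sG by simp
  have sh: "sharp_hm \<phi>"
    unfolding sharp_hm_def
  proof (intro conjI ballI impI)
    fix g k l assume a: "g \<in> G" "k \<in> K" "l \<in> K" "\<phi> (g * k * inverse l * inverse g) \<in> \<phi> ` H"
    then obtain h where h: "h \<in> H" "\<phi> (g * k * inverse l * inverse g) = \<phi> h" by blast
    have "k \<in> G" "l \<in> G" "h \<in> G" using a h KG HG by auto
    then have "g * k * inverse l * inverse g \<in> G" "h \<in> G" using a(1) sG by simp_all
    then have "g * k * inverse l * inverse g = h" using inj h by blast
    then have "k = l" using sharp[of k l g] a h by blast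
    then show "\<phi> k = \<phi> l" by simp
  qed (rule \<phi>(1))
  have "lsol H K \<longleftrightarrow> lsol (\<phi> ` H) (\<phi> ` K)"
    using image_lsol[OF sh] lsol_extension[OF \<phi>(1) KG, of H "{1}"] \<phi>(2) KG lsol_trivial[of "{1}" H] by blast
  also have "\<dots> \<longleftrightarrow> sol (\<phi> ` G)" by (rule folder_lsol_iff_sol_perm[OF image_folder[OF sh]])
  also have "\<dots> \<longleftrightarrow> sol G"
    using sol_image[OF \<phi>(1) sG order_refl] sol_extension[OF \<phi>(1), of "{1}"] \<phi>(2) sol_trivial by blast
  finally show ?thesis .
qed

section \<open>Loops and folders\<close>

lemma generate_mk_group:
  assumes "sgrp A" "S \<subseteq> A" shows "generate (mk_group A) S = gen S"
proof
  interpret Group.group "mk_group A" by (rule group_mk_group[OF assms(1)])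
  have s: "sgrp (gen S)" "gen S \<subseteq> A" using sgrp_gen[OF assms] gen_least[OF assms] by auto
  show "generate (mk_group A) S \<subseteq> gen S"
    by (rule generate_subgroup_incl[OF gen_incl subgroup_mk_group[OF s(1) assms(1) s(2)]])
  have g: "subgroup (generate (mk_group A) S) (mk_group A)" by (rule generate_is_subgroup) (simp add: assms)
  show "gen S \<subseteq> generate (mk_group A) S"
  proof (rule gen_least)
    have sub: "generate (mk_group A) S \<subseteq> A" using subgroup.subset[OF g] by simp
    show "sgrp (generate (mk_group A) S)"
      using finite_subset[OF sub sgrp_finite[OF assms(1)]] subgroup.one_closed[OF g] subgroup.m_closed[OF g]
      by (intro sgrpI) auto
  qed (auto intro: generate.incl)
qed

lemma derived_mk_group:
  assumes "sgrp A" "sgrp B" "B \<subseteq> A" shows "derived (mk_group A) B = der B"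
proof -
  have "derived_set (mk_group A) B = comms B"
  proof -
    have "h1 * h2 * (inv\<^bsub>mk_group A\<^esub> h1) * (inv\<^bsub>mk_group A\<^esub> h2) = h1 * h2 * inverse h1 * inverse h2"
      if "h1 \<in> B" "h2 \<in> B" for h1 h2
      using that assms(3) mk_group_inv[OF assms(1)] by (simp add: subset_iff)
    then show ?thesis by (auto simp: comms_def image_iff)
  qed
  moreover have "comms B \<subseteq> A" using comms_subset[OF assms(2)] assms(3) by blast
  ultimately show ?thesis by (simp add: derived_def der_def generate_mk_group[OF assms(1)])
qed

lemma solvable_mk_group: assumes "sgrp A" shows "solvable (mk_group A) \<longleftrightarrow> sol A"
proof -
  interpret Group.group "mk_group A" by (rule group_mk_group[OF assms])
  have e: "(derived (mk_group A) ^^ n) A = (der ^^ n) A \<and> sgrp ((der ^^ n) A) \<and> (der ^^ n) A \<subseteq> A" for n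
  proof (induction n)
    case (Suc n)
    then have "der ((der ^^ n) A) \<subseteq> (der ^^ n) A" using der_subset by blast
    then show ?case using Suc derived_mk_group[OF assms, of "(der ^^ n) A"] der_sgrp[of "(der ^^ n) A"] by auto
  qed (use assms in simp)
  have "(der ^^ n) A = {1} \<longleftrightarrow> (der ^^ n) A \<subseteq> {1}" for n using e[of n] sgrp_one by blast
  then show ?thesis unfolding solvable_iff_trivial_derived_seq sol_def using e by simp
qed

lemma loop_mk_group: assumes "sgrp A" shows "loop (mk_group A)"
proof (rule loopI)
  fix x z assume xz: "x \<in> carrier (mk_group A)" "z \<in> carrier (mk_group A)"
  then show "\<exists>y\<in>carrier (mk_group A). y \<otimes>\<^bsub>mk_group A\<^esub> x = z"
    using assms by (intro bexI[of _ "z * inverse x"]) (auto simp: mult.assoc)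
  show "\<exists>y\<in>carrier (mk_group A). x \<otimes>\<^bsub>mk_group A\<^esub> y = z"
    using assms xz by (intro bexI[of _ "inverse x * z"]) auto
qed (use assms in auto)

lemma comm_group_Mod_kernel:
  assumes X: "loop X" and A: "sgrp A" and f: "f \<in> hom X (mk_group A)"
    and comm: "\<And>x y. \<lbrakk>x \<in> carrier X; y \<in> carrier X\<rbrakk> \<Longrightarrow> f x * f y = f y * f x"
  shows "comm_group (X Mod kernel X (mk_group A) f)"
proof -
  interpret X: loop X by (rule X)
  define N where "N = kernel X (mk_group A) f"
  note mk = X loop_mk_group[OF A] f
  interpret Q: loop "X Mod N" unfolding N_def by (rule loop_Mod_kernel(1)[OF mk])
  have car: "carrier (X Mod N) = (\<lambda>x. N #>\<^bsub>X\<^esub> x) ` carrier X"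
    by (auto simp: FactGroup_def RCOSETS_def)
  have mult: "(N #>\<^bsub>X\<^esub> x) <#>\<^bsub>X\<^esub> (N #>\<^bsub>X\<^esub> y) = N #>\<^bsub>X\<^esub> (x \<otimes>\<^bsub>X\<^esub> y)"
    if "x \<in> carrier X" "y \<in> carrier X" for x y
    using kernel_rcos_mult[OF mk that] by (simp add: N_def)
  have eq: "N #>\<^bsub>X\<^esub> x = N #>\<^bsub>X\<^esub> y" if "x \<in> carrier X" "y \<in> carrier X" "f x = f y" for x y
    unfolding N_def using kernel_rcos_eq_fibre[OF mk that(1)] kernel_rcos_eq_fibre[OF mk that(2)] that(3) by simp
  have fm: "f (x \<otimes>\<^bsub>X\<^esub> y) = f x * f y" if "x \<in> carrier X" "y \<in> carrier X" for x y
    using hom_mult[OF f that] by simp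
  show ?thesis
    unfolding N_def[symmetric]
  proof (rule comm_groupI)
    fix a b c assume "a \<in> carrier (X Mod N)" "b \<in> carrier (X Mod N)" "c \<in> carrier (X Mod N)"
    then obtain x y z where *: "x \<in> carrier X" "y \<in> carrier X" "z \<in> carrier X"
      "a = N #>\<^bsub>X\<^esub> x" "b = N #>\<^bsub>X\<^esub> y" "c = N #>\<^bsub>X\<^esub> z" by (auto simp: car)
    show "a \<otimes>\<^bsub>X Mod N\<^esub> b \<otimes>\<^bsub>X Mod N\<^esub> c = a \<otimes>\<^bsub>X Mod N\<^esub> (b \<otimes>\<^bsub>X Mod N\<^esub> c)"
      using * X.m_closed by (simp add: mult) (rule eq, auto simp: fm mult.assoc X.m_closed)
  next
    fix a b assume "a \<in> carrier (X Mod N)" "b \<in> carrier (X Mod N)"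
    then obtain x y where *: "x \<in> carrier X" "y \<in> carrier X"
      "a = N #>\<^bsub>X\<^esub> x" "b = N #>\<^bsub>X\<^esub> y" by (auto simp: car)
    show "a \<otimes>\<^bsub>X Mod N\<^esub> b = b \<otimes>\<^bsub>X Mod N\<^esub> a"
      using * X.m_closed comm by (simp add: mult) (rule eq, auto simp: fm)
  next
    fix a assume a: "a \<in> carrier (X Mod N)"
    show "\<one>\<^bsub>X Mod N\<^esub> \<otimes>\<^bsub>X Mod N\<^esub> a = a" by (rule Q.l_one[OF a])
    obtain b where "b \<in> carrier (X Mod N)" "b \<otimes>\<^bsub>X Mod N\<^esub> a = \<one>\<^bsub>X Mod N\<^esub>"
      using Q.r_div[OF a Q.one_closed] .
    then show "\<exists>b\<in>carrier (X Mod N). b \<otimes>\<^bsub>X Mod N\<^esub> a = \<one>\<^bsub>X Mod N\<^esub>" by blast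
  next
    show "\<one>\<^bsub>X Mod N\<^esub> \<in> carrier (X Mod N)" by (rule Q.one_closed)
  next
    fix a b assume "a \<in> carrier (X Mod N)" "b \<in> carrier (X Mod N)"
    then show "a \<otimes>\<^bsub>X Mod N\<^esub> b \<in> carrier (X Mod N)" by (rule Q.m_closed)
  qed
qed

text \<open>Members of \<open>Bij S\<close> are \<open>undefined\<close> off \<open>S\<close>,
  whereas a \<open>perm\<close> fixes almost every point; hence the extension by the
  identity.\<close>

definition perm_of :: "'a set \<Rightarrow> ('a \<Rightarrow> 'a) \<Rightarrow> 'a perm" where
  "perm_of S f = Perm (\<lambda>x. if x \<in> S then f x else x)"

lemma apply_perm_of:
  assumes "finite S" "f \<in> Bij S" shows "apply (perm_of S f) x = (if x \<in> S then f x else x)"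
proof -
  have b: "bij_betw f S S" using assms(2) by (simp add: Bij_def)
  have "bij_betw (\<lambda>x. if x \<in> S then f x else x) S S"
    using b by (subst bij_betw_cong[of _ _ f]) auto
  moreover have "bij_betw (\<lambda>x. if x \<in> S then f x else x) (- S) (- S)"
    by (subst bij_betw_cong[of _ _ id]) auto
  ultimately have "bij_betw (\<lambda>x. if x \<in> S then f x else x) (S \<union> - S) (S \<union> - S)"
    by (rule bij_betw_combine) blast
  then have "bij (\<lambda>x. if x \<in> S then f x else x)" by simp
  moreover have "finite {x. (if x \<in> S then f x else x) \<noteq> x}"
    by (rule finite_subset[OF _ assms(1)]) auto
  ultimately show ?thesis unfolding perm_of_def by (subst Perm_inverse) auto
qed

lemma perm_of_mult:
  assumes "finite S" "f \<in> Bij S" "g \<in> Bij S"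
  shows "perm_of S (f \<otimes>\<^bsub>BijGroup S\<^esub> g) = perm_of S f * perm_of S g"
proof (rule perm_eqI)
  fix x
  have c: "f \<otimes>\<^bsub>BijGroup S\<^esub> g = compose S f g" using assms by (simp add: BijGroup_def)
  have "x \<in> S \<Longrightarrow> g x \<in> S" using assms(3) by (auto simp: Bij_def dest: bij_betwE)
  then show "apply (perm_of S (f \<otimes>\<^bsub>BijGroup S\<^esub> g)) x = apply (perm_of S f * perm_of S g) x"
    using assms compose_Bij[OF assms(2,3)] by (simp add: c apply_times apply_perm_of) (simp add: compose_def)
qed

lemma perm_of_inj:
  assumes "finite S" "f \<in> Bij S" "g \<in> Bij S" "perm_of S f = perm_of S g" shows "f = g"
proof
  fix x
  have "apply (perm_of S f) x = apply (perm_of S g) x" using assms(4) by simp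
  then show "f x = g x"
    using assms(2,3) apply_perm_of[OF assms(1,2), of x] apply_perm_of[OF assms(1,3), of x]
    by (cases "x \<in> S") (auto simp: Bij_def extensional_def)
qed

section \<open>The folder of a finite Bol loop that is an A_r-loop\<close>

locale finite_bol_Ar = right_bol_loop X + Ar_loop X for X (structure) +
  assumes finite_carrier: "finite (carrier X)"
begin

abbreviation "env \<equiv> enveloping_group X"

definition \<rho> :: "'a \<Rightarrow> 'a perm" where "\<rho> x = perm_of (carrier X) (right_mult X x)"

definition "G = perm_of (carrier X) ` carrier env"
definition "H = perm_of (carrier X) ` inner_mapping_group X"
definition "K = \<rho> ` carrier X"

lemma env_carrier: "carrier env = generate (BijGroup (carrier X)) (right_mult X ` carrier X)"
proof -
  have "right_mult X ` carrier X \<subseteq> carrier (BijGroup (carrier X))"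
    using right_mult_Bij by (auto simp: BijGroup_def)
  then show ?thesis
    by (simp add: enveloping_group_def carrier_subgroup_generated Int_absorb1)
qed

lemma group_env: "Group.group env"
  unfolding enveloping_group_def by (rule group.group_subgroup_generated[OF group_BijGroup])

lemma env_Bij: "f \<in> carrier env \<Longrightarrow> f \<in> Bij (carrier X)"
  using group.generate_in_carrier[OF group_BijGroup, of "right_mult X ` carrier X" "carrier X" f] right_mult_Bij
  by (auto simp: env_carrier BijGroup_def)

lemma env_mult: "f \<otimes>\<^bsub>env\<^esub> g = f \<otimes>\<^bsub>BijGroup (carrier X)\<^esub> g"
  by (simp add: enveloping_group_def)

lemma env_one: "\<one>\<^bsub>env\<^esub> = (\<lambda>x\<in>carrier X. x)"
  by (simp add: enveloping_group_def BijGroup_def)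

lemma perm_mult: "\<lbrakk>f \<in> carrier env; g \<in> carrier env\<rbrakk> \<Longrightarrow>
    perm_of (carrier X) (f \<otimes>\<^bsub>env\<^esub> g) = perm_of (carrier X) f * perm_of (carrier X) g"
  by (simp add: env_mult perm_of_mult[OF finite_carrier] env_Bij)

lemma perm_one: "perm_of (carrier X) \<one>\<^bsub>env\<^esub> = 1"
  by (rule perm_eqI) (simp add: env_one apply_perm_of[OF finite_carrier id_Bij])

lemma right_mult_env: "x \<in> carrier X \<Longrightarrow> right_mult X x \<in> carrier env"
  by (simp add: env_carrier generate.incl)

lemma G_stable: "\<lbrakk>g \<in> G; x \<in> carrier X\<rbrakk> \<Longrightarrow> apply g x \<in> carrier X"
proof -
  assume x: "x \<in> carrier X" and "g \<in> G"
  then obtain f where f: "f \<in> carrier env" "g = perm_of (carrier X) f" by (auto simp: G_def)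
  have "bij_betw f (carrier X) (carrier X)" using env_Bij[OF f(1)] by (simp add: Bij_def)
  then have "f x \<in> carrier X" using x bij_betwE by blast
  then show ?thesis using x f apply_perm_of[OF finite_carrier env_Bij[OF f(1)]] by simp
qed

lemma apply_\<rho>: "\<lbrakk>x \<in> carrier X; y \<in> carrier X\<rbrakk> \<Longrightarrow> apply (\<rho> x) y = y \<otimes> x"
  by (simp add: \<rho>_def apply_perm_of[OF finite_carrier right_mult_Bij]) (simp add: right_mult_def)

lemma G_outside: "\<lbrakk>g \<in> G; x \<notin> carrier X\<rbrakk> \<Longrightarrow> apply g x = x"
  using env_Bij by (auto simp: G_def apply_perm_of[OF finite_carrier])

lemma G_eqI: "\<lbrakk>g \<in> G; h \<in> G; \<And>x. x \<in> carrier X \<Longrightarrow> apply g x = apply h x\<rbrakk> \<Longrightarrow> g = h"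
  by (rule perm_eqI) (metis G_outside)

lemma apply_inverse_cancel: "apply (inverse g) (apply g x) = x" "apply g (apply (inverse g) x) = x"
  by (simp_all add: apply_sequence)

lemma \<rho>_G: "x \<in> carrier X \<Longrightarrow> \<rho> x \<in> G"
  by (simp add: \<rho>_def G_def right_mult_env)

lemma \<rho>_inj: assumes "x \<in> carrier X" "y \<in> carrier X" "\<rho> x = \<rho> y" shows "x = y"
proof -
  have "\<one> \<otimes> x = \<one> \<otimes> y"
    using apply_\<rho>[OF assms(1) one_closed] apply_\<rho>[OF assms(2) one_closed] unfolding assms(3) by (rule trans[OF sym])
  then show ?thesis using l_one assms(1,2) by simp
qed

lemma sgrp_G: "sgrp G"
proof (rule sgrpI)
  have "Bij (carrier X) \<subseteq> carrier X \<rightarrow>\<^sub>E carrier X"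
    by (auto simp: Bij_def PiE_def dest: bij_betwE)
  moreover have "carrier env \<subseteq> Bij (carrier X)" using env_Bij by blast
  moreover have "finite (carrier X \<rightarrow>\<^sub>E carrier X)" by (rule finite_PiE[OF finite_carrier]) (rule finite_carrier)
  ultimately have "finite (carrier env)" by (meson finite_subset)
  then show "finite G" by (simp add: G_def)
  show "1 \<in> G" unfolding G_def
    by (rule image_eqI[of _ _ "\<one>\<^bsub>env\<^esub>"]) (simp_all add: perm_one monoid.one_closed[OF group.is_monoid[OF group_env]])
  fix x y assume "x \<in> G" "y \<in> G"
  then obtain f g where "f \<in> carrier env" "g \<in> carrier env" "x = perm_of (carrier X) f" "y = perm_of (carrier X) g"
    by (auto simp: G_def)
  then show "x * y \<in> G" unfolding G_def
    by (intro image_eqI[of _ _ "f \<otimes>\<^bsub>env\<^esub> g"])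
       (simp_all add: perm_mult monoid.m_closed[OF group.is_monoid[OF group_env]])
qed

lemma H_eq: "H = {g \<in> G. apply g \<one> = \<one>}"
  using one_closed env_Bij
  by (auto simp: H_def G_def inner_mapping_group_def stabilizer_def apply_perm_of[OF finite_carrier])

lemma gen_K: "gen K = G"
proof
  have KG: "K \<subseteq> G" using \<rho>_G by (auto simp: K_def)
  show "gen K \<subseteq> G" by (rule gen_least[OF sgrp_G KG])
  have s: "sgrp (gen K)" by (rule sgrp_gen[OF sgrp_G KG])
  interpret B: Group.group "BijGroup (carrier X)" by (rule group_BijGroup)
  have "perm_of (carrier X) f \<in> gen K" if "f \<in> generate (BijGroup (carrier X)) (right_mult X ` carrier X)" for f
    using that
  proof (induction rule: generate.induct)
    case one
    have "\<one>\<^bsub>BijGroup (carrier X)\<^esub> = \<one>\<^bsub>env\<^esub>" by (simp add: enveloping_group_def)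
    then show ?case using s perm_one by simp
  next
    case (incl h)
    then show ?case using gen_incl[of K] by (auto simp: K_def \<rho>_def)
  next
    case (inv h)
    then have h: "h \<in> Bij (carrier X)" "perm_of (carrier X) h \<in> K" using right_mult_Bij by (auto simp: K_def \<rho>_def)
    have hc: "h \<in> carrier (BijGroup (carrier X))" using h by (simp add: BijGroup_def)
    have "perm_of (carrier X) (inv\<^bsub>BijGroup (carrier X)\<^esub> h) * perm_of (carrier X) h
        = perm_of (carrier X) (inv\<^bsub>BijGroup (carrier X)\<^esub> h \<otimes>\<^bsub>BijGroup (carrier X)\<^esub> h)"
    proof (rule perm_of_mult[OF finite_carrier _ h(1), symmetric])
      have "carrier (BijGroup (carrier X)) = Bij (carrier X)" by (simp add: BijGroup_def)
      then show "inv\<^bsub>BijGroup (carrier X)\<^esub> h \<in> Bij (carrier X)" using B.inv_closed[OF hc] by simp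
    qed
    also have "\<dots> = perm_of (carrier X) \<one>\<^bsub>env\<^esub>" unfolding B.l_inv[OF hc] by (simp add: enveloping_group_def)
    also note perm_one
    finally have "perm_of (carrier X) (inv\<^bsub>BijGroup (carrier X)\<^esub> h) = inverse (perm_of (carrier X) h)"
      using mult_inv_eq_one[of _ "inverse (perm_of (carrier X) h)"] by simp
    moreover have "inverse (perm_of (carrier X) h) \<in> gen K"
      using sgrp_inv[OF s] h(2) gen_incl[of K] by blast
    ultimately show ?case by simp
  next
    case (eng h1 h2)
    then have "h1 \<in> carrier env" "h2 \<in> carrier env" by (simp_all add: env_carrier)
    then show ?case using perm_mult[of h1 h2] eng s by (simp add: env_mult)
  qed
  then show "G \<subseteq> gen K" by (auto simp: G_def env_carrier)
qed

lemma H_hom: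
  assumes "h \<in> H" "x \<in> carrier X" "y \<in> carrier X" shows "apply h (x \<otimes> y) = apply h x \<otimes> apply h y"
proof -
  obtain f where f: "f \<in> inner_mapping_group X" "h = perm_of (carrier X) f" using assms(1) by (auto simp: H_def)
  then have fe: "f \<in> carrier env" and fh: "f \<in> hom X X"
    using inner_mappings_auto by (auto simp: inner_mapping_group_def stabilizer_def auto_def)
  show ?thesis
    using hom_mult[OF fh assms(2,3)] assms m_closed f apply_perm_of[OF finite_carrier env_Bij[OF fe]] by simp
qed

sublocale folder G H K
proof
  show "sgrp G" by (rule sgrp_G)
  have HG: "H \<subseteq> G" by (auto simp: H_eq)
  have KG: "K \<subseteq> G" using \<rho>_G by (auto simp: K_def)
  show sH: "sgrp H"
    using sgrp_G sgrp_finite[OF sgrp_G] by (intro sgrpI) (auto simp: H_eq apply_times)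
  show "H \<subseteq> G" "K \<subseteq> G" "gen K = G" by (rule HG KG gen_K)+
  have "\<rho> \<one> = 1"
    by (rule G_eqI) (use \<rho>_G one_closed sgrp_G apply_\<rho> r_one in auto)
  then show "1 \<in> K" using one_closed by (metis K_def imageI)
  fix k l assume "k \<in> K" "l \<in> K"
  then obtain x y where xy: "x \<in> carrier X" "y \<in> carrier X" "k = \<rho> x" "l = \<rho> y" by (auto simp: K_def)
  have klG: "k \<in> G" "l \<in> G" using xy \<rho>_G by auto
  have "k * l * k = \<rho> ((x \<otimes> y) \<otimes> x)"
  proof (rule G_eqI)
    fix z assume z: "z \<in> carrier X"
    show "apply (k * l * k) z = apply (\<rho> ((x \<otimes> y) \<otimes> x)) z"
      using z xy right_bol[OF xy(1,2) z] by (simp add: apply_times apply_\<rho> m_closed)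
  qed (use klG sgrp_G xy \<rho>_G m_closed in auto)
  then show "k * l * k \<in> K" using xy m_closed by (auto simp: K_def)
  \<comment> \<open>In a product the right factor acts first, so the \<open>K\<close>-factor of
    \<open>k * l\<close> must agree with it at the point \<open>w\<close> that \<open>k * l\<close>
    sends to the identity: \<open>z\<close> is the solution of
    \<open>w \<otimes> z = \<one>\<close>.\<close>
  define w where "w = apply (inverse (k * l)) \<one>"
  have wX: "w \<in> carrier X" unfolding w_def by (rule G_stable[OF _ one_closed]) (use klG sgrp_G in simp)
  obtain z where z: "z \<in> carrier X" "w \<otimes> z = \<one>" using l_div[OF wX one_closed] .
  define h where "h = k * l * inverse (\<rho> z)"
  have "h \<in> G" using klG z \<rho>_G sgrp_G by (simp add: h_def)
  moreover have "apply h \<one> = \<one>"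
  proof -
    have "apply (inverse (\<rho> z)) \<one> = w" using apply_\<rho>[OF z(1) wX] z(2) apply_inverse_cancel(1) by metis
    then have "apply h \<one> = apply (k * l) w" by (simp add: h_def apply_times)
    then show ?thesis unfolding w_def by (simp only: apply_inverse_cancel(2))
  qed
  ultimately have "h \<in> H" by (simp add: H_eq)
  moreover have "k * l = h * \<rho> z" by (simp add: h_def mult.assoc)
  ultimately show "\<exists>h\<in>H. \<exists>m\<in>K. k * l = h * m" using z by (auto simp: K_def)
  fix g assume g: "g \<in> G" and i: "g * k * inverse l * inverse g \<in> H"
  \<comment> \<open>An element of \<open>H\<close> fixes the identity; transported back,
    \<open>k\<close> and \<open>l\<close> agree at the point \<open>v\<close>, and left cancellation
    gives equality.\<close>
  define v where "v = apply (inverse l) (apply (inverse g) \<one>)"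
  have vX: "v \<in> carrier X" unfolding v_def using g klG sgrp_G one_closed by (intro G_stable) auto
  have "apply g (apply k v) = \<one>" using i by (simp add: H_eq apply_times v_def)
  then have "apply k v = apply (inverse g) \<one>" by (metis apply_inverse_cancel(1))
  also have "\<dots> = apply l v" by (simp add: v_def apply_inverse_cancel)
  finally have "v \<otimes> x = v \<otimes> y" using xy vX by (simp add: apply_\<rho>)
  then show "k = l" using l_cancel[OF vX xy(1,2)] xy by simp
next
  fix h k assume h: "h \<in> H" and "k \<in> K"
  then obtain x where x: "x \<in> carrier X" "k = \<rho> x" by (auto simp: K_def)
  have hG: "h \<in> G" using h by (simp add: H_eq)
  have hx: "apply h x \<in> carrier X" by (rule G_stable[OF hG x(1)])
  have "h * k * inverse h = \<rho> (apply h x)"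
  proof (rule G_eqI)
    fix z assume z: "z \<in> carrier X"
    have z': "apply (inverse h) z \<in> carrier X" by (rule G_stable[OF _ z]) (use hG sgrp_G in simp)
    have "apply (h * k * inverse h) z = apply h (apply (inverse h) z \<otimes> x)"
      using x z' by (simp add: apply_times apply_\<rho>)
    also have "\<dots> = z \<otimes> apply h x" using H_hom[OF h z' x(1)] by (simp add: apply_inverse_cancel)
    finally show "apply (h * k * inverse h) z = apply (\<rho> (apply h x)) z" using z hx by (simp add: apply_\<rho>)
  qed (use hG x hx \<rho>_G sgrp_G in auto)
  then show "h * k * inverse h \<in> K" using hx by (simp add: K_def)
qed

lemma sol_iff_solvable_env: "sol G \<longleftrightarrow> solvable env"
proof -
  interpret P: group_hom env "mk_group G" "perm_of (carrier X)"
  proof (rule group_hom.intro[OF group_env group_mk_group[OF sgrp_G]], unfold_locales)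
    show "perm_of (carrier X) \<in> hom env (mk_group G)" by (auto simp: hom_def G_def perm_mult)
  qed
  have "inj_on (perm_of (carrier X)) (carrier env)"
    using perm_of_inj[OF finite_carrier] env_Bij by (auto simp: inj_on_def)
  moreover have "perm_of (carrier X) ` carrier env = carrier (mk_group G)" by (simp add: G_def)
  ultimately show ?thesis
    using P.inj_hom_imp_solvable P.surj_hom_imp_solvable solvable_mk_group[OF sgrp_G] by blast
qed

end

section \<open>Series of subloops and iterates of \<open>dl\<close>\<close>

context finite_bol_Ar
begin

text \<open>Every \<open>p\<close> in \<open>gen (\<rho>\<close> + "Y)" acts on the quotient
  \<open>Q\<close> of the subloop \<open>Y\<close> as translation by the class of its value at the
  identity. Since \<open>Q\<close> is commutative, the reversal of factors is harmless and \<alpha>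
  is a homomorphism into \<open>Q\<close>. It kills \<open>H\<close> and all commutators, and on
  right multiplications it is the projection to \<open>Q\<close>.\<close>

lemma subloop_dl:
  assumes Y: "subloop Y X" and Z: "normal_subloop Z (X\<lparr>carrier := Y\<rparr>)"
    and comm: "comm_group (X\<lparr>carrier := Y\<rparr> Mod Z)"
  shows "dl H (\<rho> ` Y) \<subseteq> \<rho> ` Z"
proof -
  define U where "U = X\<lparr>carrier := Y\<rparr>"
  have U: "loop U" and YX: "Y \<subseteq> carrier X" using Y by (auto simp: U_def subloop_def)
  interpret U: loop U by (rule U)
  obtain V :: "'a set monoid" and f where V: "loop V" "f \<in> hom U V" "Z = kernel U V f"
    using Z by (auto simp: normal_subloop_def U_def)
  define Q where "Q = U Mod Z"
  interpret Q: comm_group Q using comm by (simp add: Q_def U_def)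
  define q where "q = (\<lambda>x. Z #>\<^bsub>U\<^esub> x)"
  note mk = loop_Mod_kernel[OF U V(1,2), folded V(3), folded Q_def q_def]
  have qY: "q x \<in> carrier Q" if "x \<in> Y" for x
    using hom_in_carrier[OF mk(2)] that by (simp add: U_def)
  have qm: "q (x \<otimes> y) = q x \<otimes>\<^bsub>Q\<^esub> q y" if "x \<in> Y" "y \<in> Y" for x y
    using hom_mult[OF mk(2)] that by (simp add: U_def)
  have YY: "x \<otimes> y \<in> Y" if "x \<in> Y" "y \<in> Y" for x y using U.m_closed that by (simp add: U_def)
  have one: "\<one> \<in> Y" using U.one_closed by (simp add: U_def)
  have q1: "q \<one> = \<one>\<^bsub>Q\<^esub>" using loop_hom_one[OF U mk(1,2)] by (simp add: U_def)
  have ker: "x \<in> Z" if "x \<in> Y" "q x = \<one>\<^bsub>Q\<^esub>" for x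
  proof -
    have "x \<in> kernel U Q q" using that by (simp add: kernel_def U_def)
    then show ?thesis using mk(3) by simp
  qed
  have KY: "\<rho> ` Y \<subseteq> G" using \<rho>_G YX by blast
  have sL: "sgrp (gen (\<rho> ` Y))" by (rule sgrp_gen[OF sG KY])
  have act: "\<forall>y\<in>Y. apply p y \<in> Y \<and> q (apply p y) = q y \<otimes>\<^bsub>Q\<^esub> q (apply p \<one>)" if "p \<in> gen (\<rho> ` Y)" for p
    using that sG KY
  proof (induction rule: gen_induct)
    case one
    show ?case using q1 qY by simp
  next
    case (incl s)
    then obtain x where x: "x \<in> Y" "s = \<rho> x" by blast
    show ?case
    proof
      fix y assume y: "y \<in> Y"
      have X: "x \<in> carrier X" "y \<in> carrier X" using x y YX by auto
      have "apply s y = y \<otimes> x" "apply s \<one> = x" using X by (simp_all add: x(2) apply_\<rho> one_closed l_one)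
      then show "apply s y \<in> Y \<and> q (apply s y) = q y \<otimes>\<^bsub>Q\<^esub> q (apply s \<one>)" using YY[OF y x(1)] qm[OF y x(1)] by simp
    qed
  next
    case (mult a b)
    show ?case
    proof
      fix y assume y: "y \<in> Y"
      have by': "apply b y \<in> Y" "q (apply b y) = q y \<otimes>\<^bsub>Q\<^esub> q (apply b \<one>)" and b1: "apply b \<one> \<in> Y"
        using mult.IH(2) y one by blast+
      have a1: "apply a \<one> \<in> Y" using mult.IH(1) one by blast
      have "apply a (apply b y) \<in> Y" using mult.IH(1) by' by blast
      moreover have "q (apply a (apply b y)) = q y \<otimes>\<^bsub>Q\<^esub> q (apply a (apply b \<one>))"
      proof -
        have c: "q y \<in> carrier Q" "q (apply b \<one>) \<in> carrier Q" "q (apply a \<one>) \<in> carrier Q"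
          using qY y b1 a1 by blast+
        have "q (apply a (apply b y)) = q (apply b y) \<otimes>\<^bsub>Q\<^esub> q (apply a \<one>)" using mult.IH(1) by'(1) by blast
        moreover have "q (apply a (apply b \<one>)) = q (apply b \<one>) \<otimes>\<^bsub>Q\<^esub> q (apply a \<one>)"
          using mult.IH(1) b1 by blast
        ultimately show ?thesis unfolding by'(2) using Q.m_assoc[OF c] by (metis (no_types))
      qed
      ultimately show "apply (a * b) y \<in> Y \<and> q (apply (a * b) y) = q y \<otimes>\<^bsub>Q\<^esub> q (apply (a * b) \<one>)"
        unfolding apply_times o_apply ..
    qed
  qed
  define \<alpha> where "\<alpha> = (\<lambda>p. q (apply p \<one>))"
  have \<alpha>c: "\<alpha> p \<in> carrier Q" if "p \<in> gen (\<rho> ` Y)" for p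
    unfolding \<alpha>_def using act[OF that] one by (blast intro: qY)
  have \<alpha>m: "\<alpha> (a * b) = \<alpha> a \<otimes>\<^bsub>Q\<^esub> \<alpha> b" if a: "a \<in> gen (\<rho> ` Y)" and b: "b \<in> gen (\<rho> ` Y)" for a b
  proof -
    have "apply b \<one> \<in> Y" using act[OF b] one by blast
    then have "\<alpha> (a * b) = \<alpha> b \<otimes>\<^bsub>Q\<^esub> \<alpha> a" unfolding \<alpha>_def apply_times o_apply using act[OF a] by blast
    then show ?thesis using Q.m_comm \<alpha>c a b by simp
  qed
  have \<alpha>1: "\<alpha> 1 = \<one>\<^bsub>Q\<^esub>" by (simp add: \<alpha>_def q1)
  define M where "M = {p \<in> gen (\<rho> ` Y). \<alpha> p = \<one>\<^bsub>Q\<^esub>}"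
  have "gen (H \<inter> gen (\<rho> ` Y) \<union> comms (gen (\<rho> ` Y))) \<subseteq> M"
  proof (rule gen_least)
    show "sgrp M" using sL sgrp_finite[OF sL] by (intro sgrpI) (auto simp: M_def \<alpha>1 \<alpha>m)
    have "p \<in> M" if "p \<in> H" "p \<in> gen (\<rho> ` Y)" for p using that q1 by (simp add: M_def \<alpha>_def H_eq)
    moreover have "c \<in> M" if c: "c \<in> comms (gen (\<rho> ` Y))" for c
    proof -
      obtain x y where xy: "x \<in> gen (\<rho> ` Y)" "y \<in> gen (\<rho> ` Y)" "c = x * y * inverse x * inverse y"
        using c by (rule commsE)
      have ix: "inverse x \<in> gen (\<rho> ` Y)" "inverse y \<in> gen (\<rho> ` Y)" using xy sL by auto
      have e: "\<alpha> x \<otimes>\<^bsub>Q\<^esub> \<alpha> (inverse x) = \<one>\<^bsub>Q\<^esub>" "\<alpha> y \<otimes>\<^bsub>Q\<^esub> \<alpha> (inverse y) = \<one>\<^bsub>Q\<^esub>"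
        using \<alpha>m[OF xy(1) ix(1)] \<alpha>m[OF xy(2) ix(2)] \<alpha>1 by simp_all
      have "\<alpha> c = \<alpha> x \<otimes>\<^bsub>Q\<^esub> \<alpha> y \<otimes>\<^bsub>Q\<^esub> \<alpha> (inverse x) \<otimes>\<^bsub>Q\<^esub> \<alpha> (inverse y)"
        using xy ix sL by (simp add: \<alpha>m)
      also have "\<dots> = (\<alpha> x \<otimes>\<^bsub>Q\<^esub> \<alpha> (inverse x)) \<otimes>\<^bsub>Q\<^esub> (\<alpha> y \<otimes>\<^bsub>Q\<^esub> \<alpha> (inverse y))"
        using \<alpha>c[OF xy(1)] \<alpha>c[OF xy(2)] \<alpha>c[OF ix(1)] \<alpha>c[OF ix(2)] by (simp add: Q.m_ac)
      also have "\<dots> = \<one>\<^bsub>Q\<^esub>" by (simp add: e)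
      finally show ?thesis using comms_subset[OF sL] c by (auto simp: M_def)
    qed
    ultimately show "H \<inter> gen (\<rho> ` Y) \<union> comms (gen (\<rho> ` Y)) \<subseteq> M" by blast
  qed
  then show ?thesis
  proof -
    assume sub: "gen (H \<inter> gen (\<rho> ` Y) \<union> comms (gen (\<rho> ` Y))) \<subseteq> M"
    show ?thesis
    proof
      fix p assume p: "p \<in> dl H (\<rho> ` Y)"
      then obtain x where x: "x \<in> Y" "p = \<rho> x" by (auto simp: dl_def)
      have "p \<in> M" using p sub by (auto simp: dl_def)
      then have "q (apply p \<one>) = \<one>\<^bsub>Q\<^esub>" by (simp add: M_def \<alpha>_def)
      moreover have "apply p \<one> = x" using x YX apply_\<rho>[of x \<one>] one_closed l_one by auto
      ultimately show "p \<in> \<rho> ` Z" using ker x by simp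
    qed
  qed
qed

text \<open>By \<open>subloop_dl\<close> and monotonicity, the iterates of \<open>dl\<close> stay
  below any given series read from the top.\<close>

lemma solvable_loop_imp_lsol: assumes "solvable_loop X" shows "lsol H K"
proof -
  obtain n S where S: "S 0 = {\<one>}" "S n = carrier X" "\<And>i. i \<le> n \<Longrightarrow> subloop (S i) X"
    "\<And>i. i < n \<Longrightarrow> normal_subloop (S i) (X\<lparr>carrier := S (Suc i)\<rparr>)"
    "\<And>i. i < n \<Longrightarrow> comm_group (X\<lparr>carrier := S (Suc i)\<rparr> Mod S i)"
    using assms unfolding solvable_loop_def by blast
  have "(dl H ^^ j) K \<subseteq> \<rho> ` S (n - j)" if "j \<le> n" for j
    using that
  proof (induction j)
    case 0
    then show ?case by (simp add: S K_def)
  next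
    case (Suc j)
    then have e: "Suc (n - Suc j) = n - j" and l: "n - Suc j < n" by auto
    have "(dl H ^^ Suc j) K \<subseteq> dl H (\<rho> ` S (n - j))" using dl_mono[of _ "\<rho> ` S (n - j)" H] Suc by simp
    also have "\<dots> \<subseteq> \<rho> ` S (n - Suc j)"
      using subloop_dl[OF S(3) S(4,5)[OF l, unfolded e]] by simp
    finally show ?case .
  qed
  from this[of n] have "(dl H ^^ n) K \<subseteq> {\<rho> \<one>}" by (simp add: S)
  moreover have "\<rho> \<one> = 1"
    by (rule G_eqI) (use \<rho>_G one_closed sG apply_\<rho> r_one in auto)
  ultimately show ?thesis unfolding lsol_def by auto
qed

lemma dl_pow_folder: "folder (gen ((dl H ^^ j) K)) (H \<inter> gen ((dl H ^^ j) K)) ((dl H ^^ j) K)"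
proof (induction j)
  case 0
  show ?case using folder_axioms HG by (simp add: gK Int_absorb2)
next
  case (Suc j)
  define D where "D = (dl H ^^ j) K"
  interpret D: folder "gen D" "H \<inter> gen D" D using Suc by (simp add: D_def)
  have e: "dl H D = D \<inter> D.dhull" using dl_local[of D "gen D" H] D.dl_hull by simp
  have "gen (D \<inter> D.dhull) \<subseteq> gen D" by (rule gen_mono) blast
  then have "H \<inter> gen D \<inter> gen (D \<inter> D.dhull) = H \<inter> gen (D \<inter> D.dhull)" by blast
  then show ?case using D.subfolder[OF D.dhull(1,2,4)] by (simp add: D_def[symmetric] e)
qed

lemma subloop_of_folder:
  assumes D: "folder (gen D) (H \<inter> gen D) D" and DK: "D \<subseteq> K"
  shows "subloop {x \<in> carrier X. \<rho> x \<in> D} X"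
proof -
  interpret D: folder "gen D" "H \<inter> gen D" D by (rule D)
  define Y where "Y = {x \<in> carrier X. \<rho> x \<in> D}"
  have YX: "Y \<subseteq> carrier X" by (auto simp: Y_def)
  have fY: "finite Y" using finite_carrier YX finite_subset by blast
  have "\<rho> \<one> = 1"
    by (rule G_eqI) (use \<rho>_G one_closed sG apply_\<rho> r_one in auto)
  then have one: "\<one> \<in> Y" using D.oneK one_closed by (simp add: Y_def)
  have YY: "x \<otimes> y \<in> Y" if x: "x \<in> Y" and y: "y \<in> Y" for x y
  proof -
    have xy: "x \<in> carrier X" "y \<in> carrier X" "\<rho> x \<in> D" "\<rho> y \<in> D" using x y by (auto simp: Y_def)
    \<comment> \<open>The product \<open>x \<otimes> y\<close> is the value of
      \<open>\<rho> y * \<rho> x\<close> at the identity, but \<open>fac\<close> puts the factor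
      from \<open>H\<close> on the left. Factorising the inverse product moves it to the right,
      where it fixes the identity.\<close>
    obtain h m where hm: "h \<in> H" "m \<in> D" "inverse (\<rho> x) * inverse (\<rho> y) = h * m"
      using D.fac[OF D.invK D.invK, OF xy(3,4)] by blast
    obtain z where z: "z \<in> carrier X" "inverse m = \<rho> z" using D.invK[OF hm(2)] DK by (auto simp: K_def)
    have "\<rho> y * \<rho> x = inverse (inverse (\<rho> x) * inverse (\<rho> y))" by (simp add: inv_mult)
    also have "\<dots> = \<rho> z * inverse h" by (simp add: hm(3) inv_mult z(2))
    finally have e: "\<rho> y * \<rho> x = \<rho> z * inverse h" .
    have "inverse h \<in> H" using hm(1) sH by simp
    then have "apply (inverse h) \<one> = \<one>" by (simp add: H_eq)
    then have "apply (\<rho> y * \<rho> x) \<one> = z" using z one_closed l_one by (simp add: e apply_times apply_\<rho>)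
    moreover have "apply (\<rho> y * \<rho> x) \<one> = x \<otimes> y" using xy one_closed l_one by (simp add: apply_times apply_\<rho>)
    ultimately have "x \<otimes> y = z" by simp
    then show ?thesis using z D.invK[OF hm(2)] by (simp add: Y_def)
  qed
  have "loop (X\<lparr>carrier := Y\<rparr>)"
  proof (rule loopI)
    fix x z assume "x \<in> carrier (X\<lparr>carrier := Y\<rparr>)" "z \<in> carrier (X\<lparr>carrier := Y\<rparr>)"
    then have x: "x \<in> Y" and z: "z \<in> Y" by auto
    have "inj_on (\<lambda>y. y \<otimes> x) Y" using r_cancel x YX by (intro inj_onI) blast
    then have "(\<lambda>y. y \<otimes> x) ` Y = Y" using YY x by (intro endo_inj_surj[OF fY]) auto
    then show "\<exists>y\<in>carrier (X\<lparr>carrier := Y\<rparr>). y \<otimes>\<^bsub>X\<lparr>carrier := Y\<rparr>\<^esub> x = z" using z by (force simp: image_iff)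
    have "inj_on (\<lambda>y. x \<otimes> y) Y" using l_cancel x YX by (intro inj_onI) blast
    then have "(\<lambda>y. x \<otimes> y) ` Y = Y" using YY x by (intro endo_inj_surj[OF fY]) auto
    then show "\<exists>y\<in>carrier (X\<lparr>carrier := Y\<rparr>). x \<otimes>\<^bsub>X\<lparr>carrier := Y\<rparr>\<^esub> y = z" using z by (force simp: image_iff)
  next
    fix x y z assume a: "x \<in> carrier (X\<lparr>carrier := Y\<rparr>)" "y \<in> carrier (X\<lparr>carrier := Y\<rparr>)" "z \<in> carrier (X\<lparr>carrier := Y\<rparr>)"
    show "y \<otimes>\<^bsub>X\<lparr>carrier := Y\<rparr>\<^esub> x = z \<otimes>\<^bsub>X\<lparr>carrier := Y\<rparr>\<^esub> x \<Longrightarrow> y = z"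
      using a YX r_cancel[of x y z] by auto
    show "x \<otimes>\<^bsub>X\<lparr>carrier := Y\<rparr>\<^esub> y = x \<otimes>\<^bsub>X\<lparr>carrier := Y\<rparr>\<^esub> z \<Longrightarrow> y = z"
      using a YX l_cancel[of x y z] by auto
  qed (use one YY YX l_one r_one in auto)
  then show ?thesis using YX by (simp add: subloop_def Y_def)
qed

text \<open>The quotient is realised in the abelian group \<open>gen D / dhull\<close>:
  \<open>\<rho> (x \<otimes> y)\<close> and \<open>\<rho> y * \<rho> x\<close> agree at the
  identity, so they differ by an element of \<open>H\<close>, which lies in \<open>dhull\<close>.
  Hence \<rho> followed by the projection is a homomorphism, and its kernel is given by
  \<open>D \<inter> dhull\<close>.\<close>

lemma normal_subloop_dl:
  assumes D: "folder (gen D) (H \<inter> gen D) D" and DK: "D \<subseteq> K"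
  defines "Y \<equiv> {x \<in> carrier X. \<rho> x \<in> D}" and "Z \<equiv> {x \<in> carrier X. \<rho> x \<in> dl H D}"
  shows "normal_subloop Z (X\<lparr>carrier := Y\<rparr>) \<and> comm_group (X\<lparr>carrier := Y\<rparr> Mod Z)"
proof -
  interpret D: folder "gen D" "H \<inter> gen D" D by (rule D)
  define U where "U = X\<lparr>carrier := Y\<rparr>"
  have YX: "Y \<subseteq> carrier X" by (auto simp: Y_def)
  have U: "loop U" using subloop_of_folder[OF D DK] by (simp add: subloop_def U_def Y_def)
  interpret U: loop U by (rule U)
  have nrm: "nrm D.dhull (gen D)" by (rule D.nrm_comms[OF D.dhull(1,3,4)])
  obtain \<phi> :: "'a perm \<Rightarrow> nat perm" where \<phi>: "hm \<phi> (gen D)" "\<And>g. g \<in> gen D \<Longrightarrow> \<phi> g = 1 \<longleftrightarrow> g \<in> D.dhull"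
    using quotient_perm[OF D.sG nrm] by metis
  have ab: "\<phi> y * \<phi> x = \<phi> x * \<phi> y" if "x \<in> gen D" "y \<in> gen D" for x y
  proof -
    have "y * x * inverse y * inverse x \<in> D.dhull" using commsI[OF that(2,1)] D.dhull(3) by blast
    then have "\<phi> (y * x * inverse (x * y)) = 1" using \<phi>(2) that D.sG by (simp add: grp_simps)
    then have "\<phi> (y * x) = \<phi> (x * y)" using hm_eq_iff[OF \<phi>(1)] that D.sG by simp
    then show ?thesis using hm_mult[OF \<phi>(1)] that by simp
  qed
  define A where "A = \<phi> ` gen D"
  have A: "sgrp A" unfolding A_def by (rule hm_image_sgrp[OF \<phi>(1) D.sG order_refl])
  define f where "f = (\<lambda>x. \<phi> (\<rho> x))"
  have \<rho>D: "\<rho> x \<in> gen D" if "x \<in> Y" for x using that D.KG by (auto simp: Y_def)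
  have f: "f \<in> hom U (mk_group A)"
    unfolding hom_def
  proof (intro CollectI conjI ballI funcsetI)
    show "f x \<in> carrier (mk_group A)" if "x \<in> carrier U" for x
      using that \<rho>D by (simp add: f_def A_def U_def)
    fix x y assume "x \<in> carrier U" "y \<in> carrier U"
    then have x: "x \<in> Y" and y: "y \<in> Y" and xy: "x \<otimes> y \<in> Y" using U.m_closed[of x y] by (auto simp: U_def)
    have X: "x \<in> carrier X" "y \<in> carrier X" "x \<otimes> y \<in> carrier X" using x y xy YX by auto
    define h where "h = inverse (\<rho> (x \<otimes> y)) * (\<rho> y * \<rho> x)"
    have hD: "h \<in> gen D" using \<rho>D[OF x] \<rho>D[OF y] \<rho>D[OF xy] D.sG by (simp add: h_def)
    have "apply (\<rho> y * \<rho> x) \<one> = apply (\<rho> (x \<otimes> y)) \<one>"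
      using X one_closed l_one by (simp add: apply_times apply_\<rho>)
    then have "apply h \<one> = \<one>" by (simp add: h_def apply_times apply_inverse_cancel)
    moreover have "h \<in> G" using X \<rho>_G sG by (simp add: h_def)
    ultimately have "h \<in> H" by (simp add: H_eq)
    then have "\<phi> h = 1" using hD \<phi>(2) D.dhull(2) by blast
    moreover have "\<rho> y * \<rho> x = \<rho> (x \<otimes> y) * h" by (simp add: h_def)
    ultimately have "\<phi> (\<rho> y) * \<phi> (\<rho> x) = \<phi> (\<rho> (x \<otimes> y))"
      using hm_mult[OF \<phi>(1) \<rho>D[OF y] \<rho>D[OF x]] hm_mult[OF \<phi>(1) \<rho>D[OF xy] hD] by simp
    then show "f (x \<otimes>\<^bsub>U\<^esub> y) = f x \<otimes>\<^bsub>mk_group A\<^esub> f y"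
      using ab[OF \<rho>D[OF x] \<rho>D[OF y]] by (simp add: f_def U_def)
  qed
  have "dl H D = D \<inter> D.dhull" using dl_local[of D "gen D" H] D.dl_hull by simp
  then have Z: "Z = kernel U (mk_group A) f"
    using \<phi>(2)[OF \<rho>D] by (auto simp: Z_def Y_def U_def kernel_def f_def)
  have "normal_subloop Z U"
    unfolding Z by (rule normal_subloop_kernel[OF U loop_mk_group[OF A] f])
  moreover have "comm_group (U Mod Z)"
    unfolding Z by (rule comm_group_Mod_kernel[OF U A f]) (use ab \<rho>D in \<open>simp add: f_def U_def\<close>)
  ultimately show ?thesis by (simp add: U_def)
qed

lemma lsol_imp_solvable_loop: assumes "lsol H K" shows "solvable_loop X"
proof -
  obtain n where n: "(dl H ^^ n) K \<subseteq> {1}" using assms by (auto simp: lsol_def)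
  define S where "S = (\<lambda>i. {x \<in> carrier X. \<rho> x \<in> (dl H ^^ (n - i)) K})"
  have sub: "(dl H ^^ j) K \<subseteq> K" for j by (rule dl_pow_subset)
  have \<rho>1: "\<rho> \<one> = 1"
    by (rule G_eqI) (use \<rho>_G one_closed sG apply_\<rho> r_one in auto)
  have "S 0 = {\<one>}"
  proof
    show "S 0 \<subseteq> {\<one>}"
    proof
      fix x assume "x \<in> S 0"
      then have "x \<in> carrier X" "\<rho> x = \<rho> \<one>" using n \<rho>1 by (auto simp: S_def)
      then show "x \<in> {\<one>}" using \<rho>_inj one_closed by blast
    qed
    have "1 \<in> (dl H ^^ n) K" by (rule folder.oneK[OF dl_pow_folder])
    then show "{\<one>} \<subseteq> S 0" using one_closed \<rho>1 by (simp add: S_def)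
  qed
  moreover have "S n = carrier X" by (auto simp: S_def K_def)
  moreover have "\<forall>i\<le>n. subloop (S i) X"
    unfolding S_def using subloop_of_folder[OF dl_pow_folder sub] by blast
  moreover have "normal_subloop (S i) (X\<lparr>carrier := S (Suc i)\<rparr>) \<and> comm_group (X\<lparr>carrier := S (Suc i)\<rparr> Mod S i)"
    if "i < n" for i
  proof -
    have "n - i = Suc (n - Suc i)" using that by simp
    then have "(dl H ^^ (n - i)) K = dl H ((dl H ^^ (n - Suc i)) K)" by simp
    then show ?thesis
      using normal_subloop_dl[OF dl_pow_folder sub, of "n - Suc i"] by (simp add: S_def)
  qed
  ultimately show ?thesis unfolding solvable_loop_def by blast
qed

end

theorem corollary4:
  fixes X :: "('a, 'b) monoid_scheme"
  assumes "finite (carrier X)"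
    and "right_bol_loop X"
    and "Ar_loop X"
  shows "solvable_loop X \<longleftrightarrow> solvable (enveloping_group X)"
proof -
  interpret finite_bol_Ar X
    using assms by (intro finite_bol_Ar.intro finite_bol_Ar_axioms.intro)
  show ?thesis
    using solvable_loop_imp_lsol lsol_imp_solvable_loop lsol_iff_sol sol_iff_solvable_env by blast
qed

end
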